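(* There exist an absolute constant $C$ and an online algorithm in the GST model (which, given a tree $G$, starts from an initial valid search tree on $G$ depending only on $G$, and processes each search $x_i$ before seeing $x_{i+1}$) such that for every tree $G$ on $n$ vertices and every search sequence $X=x_1,\dots,x_m$ of vertices of $G$ with $m\ge n$, the total cost of the algorithm on $X$ is at most $C\,(1+\log\log n)\,\mathrm{OPT}(G,X)$.
   Context: Search tree on a tree: a rooted tree $T$ is a valid search tree on an unrooted tree $G$ if the root $r$ of $T$ is a vertex of $G$ and the subtrees of $T\setminus r$ are valid search trees on the connected components of $G\setminus r$. Rotation on a non-root node $v$ of $T$ with parent $p$: swap $p$ and $v$; all children of $p$ remain children of $p$; for a child $u$ of $v$ with subtree node set $S_u$, if some node of $S_u$ is adjacent to $p$ in $G$ (at most one such child) then $u$ becomes a child of $p$; all other children of $v$ remain children of $v$. GST model: a valid search tree $T$ on $G$ is maintained with a single pointer; at unit cost one may move the pointer to a child or the parent of the current node, or rotate the current node. A search for $v$ is any sequence of unit-cost operations in which the pointer starts at the root and points to $v$ at some point. The cost of an algorithm on $X$ is the total number of unit-cost operations used for the searches $x_1,\dots,x_m$ in order. $\mathrm{OPT}(G,X)$ is the minimum such cost over all GST-model algorithms (even offline ones knowing $X$ in advance) and all initial valid search trees on $G$.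
   Formalization: Each search costs one plus its number of unit-cost operations, for the algorithm and for OPT alike; with operations alone the claim fails (two-vertex tree, repeated searches for the vertex not at the initial root: OPT is 0, the algorithm pays at least 1). *)

theory Defs
  imports Main "HOL-Analysis.Analysis"
begin

definition is_tree :: "nat set \<Rightarrow> (nat \<Rightarrow> nat \<Rightarrow> bool) \<Rightarrow> bool" where
  "is_tree V E \<longleftrightarrow> finite V \<and> V \<noteq> {} \<and>
     (\<forall>u v. E u v \<longrightarrow> u \<in> V \<and> v \<in> V \<and> u \<noteq> v \<and> E v u) \<and>
     (\<forall>u\<in>V. \<forall>v\<in>V. (\<lambda>a b. a \<in> V \<and> b \<in> V \<and> E a b)\<^sup>*\<^sup>* u v) \<and>
     card {{u, v} | u v. E u v} = card V - 1"

definition comp :: "(nat \<Rightarrow> nat \<Rightarrow> bool) \<Rightarrow> nat set \<Rightarrow> nat \<Rightarrow> nat set" where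
  "comp E S u = {v. (\<lambda>a b. a \<in> S \<and> b \<in> S \<and> E a b)\<^sup>*\<^sup>* u v}"

definition comps :: "(nat \<Rightarrow> nat \<Rightarrow> bool) \<Rightarrow> nat set \<Rightarrow> nat set set" where
  "comps E S = {comp E S u | u. u \<in> S}"

(* Rooted trees are represented by parent functions p (p v = None for the root
   and for vertices outside the tree).  st_on E S r p: the part of p on S is a
   valid search tree, rooted at r, on the (connected) induced subgraph G[S]:
   r \<in> S and every component C of G[S - {r}] carries a valid search tree whose
   root is a child of r. *)
inductive st_on :: "(nat \<Rightarrow> nat \<Rightarrow> bool) \<Rightarrow> nat set \<Rightarrow> nat \<Rightarrow> (nat \<Rightarrow> nat option) \<Rightarrow> bool"
  for E where
  "\<lbrakk> r \<in> S;
     \<forall>C \<in> comps E (S - {r}). \<exists>r' \<in> C. p r' = Some r \<and> st_on E C r' p \<rbrakk>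
   \<Longrightarrow> st_on E S r p"

definition valid_st :: "nat set \<Rightarrow> (nat \<Rightarrow> nat \<Rightarrow> bool) \<Rightarrow> (nat \<Rightarrow> nat option) \<Rightarrow> bool" where
  "valid_st V E p \<longleftrightarrow> (\<exists>r. p r = None \<and> st_on E V r p) \<and> (\<forall>v. v \<notin> V \<longrightarrow> p v = None)"

definition st_root :: "nat set \<Rightarrow> (nat \<Rightarrow> nat option) \<Rightarrow> nat" where
  "st_root V p = (THE r. r \<in> V \<and> p r = None)"

definition desc :: "(nat \<Rightarrow> nat option) \<Rightarrow> nat \<Rightarrow> nat set" where
  "desc p u = {s. (\<lambda>a b. p a = Some b)\<^sup>*\<^sup>* s u}"

definition rot :: "(nat \<Rightarrow> nat \<Rightarrow> bool) \<Rightarrow> (nat \<Rightarrow> nat option) \<Rightarrow> nat \<Rightarrow> nat \<Rightarrow> (nat \<Rightarrow> nat option)" where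
  "rot E p v q = (\<lambda>w.
     if w = v then p q
     else if w = q then Some v
     else if p w = Some v \<and> (\<exists>s \<in> desc p w. E s q) then Some q
     else p w)"

datatype gst_op = ToParent | ToChild nat | Rotate

type_synonym gst_state = "(nat \<Rightarrow> nat option) \<times> nat"  (* tree, pointer *)

fun gst_step :: "(nat \<Rightarrow> nat \<Rightarrow> bool) \<Rightarrow> gst_state \<Rightarrow> gst_op \<Rightarrow> gst_state option" where
  "gst_step E (p, c) ToParent = (case p c of None \<Rightarrow> None | Some q \<Rightarrow> Some (p, q))"
| "gst_step E (p, c) (ToChild w) = (if p w = Some c then Some (p, w) else None)"
| "gst_step E (p, c) Rotate = (case p c of None \<Rightarrow> None | Some q \<Rightarrow> Some (rot E p c q, c))"

fun gst_trace :: "(nat \<Rightarrow> nat \<Rightarrow> bool) \<Rightarrow> gst_state \<Rightarrow> gst_op list \<Rightarrow> gst_state list option" where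
  "gst_trace E s [] = Some [s]"
| "gst_trace E s (op1 # os) = (case gst_step E s op1 of None \<Rightarrow> None
      | Some s' \<Rightarrow> map_option (Cons s) (gst_trace E s' os))"

fun serves :: "nat set \<Rightarrow> (nat \<Rightarrow> nat \<Rightarrow> bool) \<Rightarrow> (nat \<Rightarrow> nat option) \<Rightarrow> nat list \<Rightarrow> gst_op list list \<Rightarrow> bool" where
  "serves V E p [] [] = True"
| "serves V E p (x # xs) (os # oss) =
     (case gst_trace E (p, st_root V p) os of None \<Rightarrow> False
      | Some ss \<Rightarrow> x \<in> snd ` set ss \<and> serves V E (fst (last ss)) xs oss)"
| "serves V E p _ _ = False"

(* cost: each search costs 1 (touching the root) plus its number of operations *)
definition gst_cost :: "gst_op list list \<Rightarrow> nat" where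
  "gst_cost oss = sum_list (map (\<lambda>os. Suc (length os)) oss)"

definition OPT :: "nat set \<Rightarrow> (nat \<Rightarrow> nat \<Rightarrow> bool) \<Rightarrow> nat list \<Rightarrow> nat" where
  "OPT V E X = Inf {gst_cost oss | p oss. valid_st V E p \<and> serves V E p X oss}"

definition online_ops ::
  "(nat set \<Rightarrow> (nat \<Rightarrow> nat \<Rightarrow> bool) \<Rightarrow> nat list \<Rightarrow> nat \<Rightarrow> gst_op list)
   \<Rightarrow> nat set \<Rightarrow> (nat \<Rightarrow> nat \<Rightarrow> bool) \<Rightarrow> nat list \<Rightarrow> gst_op list list" where
  "online_ops strat V E X = map (\<lambda>i. strat V E (take i X) (X ! i)) [0..<length X]"

end

(* Fix a search tree P on G of depth O(log n) in which every subtree has at most two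
   neighbours in G. Searching x makes the P-path to x preferred. The number of preferred
   children that change is bounded, up to constants, by OPT + n: the potential counting
   the vertices v such that the subtree of v and that of its preferred child have the same
   topmost node in the tree of OPT pays for the changes that do not cost OPT a separate
   node.

   The algorithm keeps the unique search tree that is heap-ordered for a priority
   computed from the preferred children: vertices are compared by the depth of the head
   of their preferred path, and within a path of O(log n) vertices by a ruler sequence
   (the level in a binary subdivision of the depths), so that a search meets only
   O(log log n) nodes per path. Since a subtree of P has at most two neighbours, changing
   the preferred child of z only requires raising at most four vertices of the path of z
   to its top: after that the priorities before and after the change induce the same
   search tree, and reversing the raising steps for the new priority completes the
   change at cost O(log log n). *)
theory Submission
  imports Defs
begin

section \<open>Graphs and search trees\<close>

text \<open>The strategy is that of Tango trees, with changed preferred children in the role of the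
  interleave bound. On trees a preferred path carries no linear order of keys, so splitting and
  joining the structures of two paths has no obvious description; the proof avoids giving one. A
  heap order fixes the whole search tree, the subtree of a vertex being its component among the
  vertices of no smaller priority, and a rotation can be undone in three operations. So
  restructuring reduces to a comparison of priorities.

  Having at most two neighbours helps twice: a path is cut at a given depth by removing at most two
  vertices, which bounds the nodes per level, and the two subtrees exchanged by a change are seen by
  at most 2 + 2 vertices.

  The double logarithm is \<open>k\<close>: the depth of \<open>P\<close> is below 2j with 2^j at
  most 2n, and the ruler has levels up to \<open>k\<close> with 2^k at most 4j. The additive n of
  the lower bound is absorbed because every search costs at least one and m is at least n.\<close>

definition reach :: "(nat \<Rightarrow> nat \<Rightarrow> bool) \<Rightarrow> nat set \<Rightarrow> nat \<Rightarrow> nat \<Rightarrow> bool" where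
  "reach E S = (\<lambda>a b. a \<in> S \<and> b \<in> S \<and> E a b)\<^sup>*\<^sup>*"

lemma comp_reach: "comp E S u = {v. reach E S u v}"
  by (simp add: comp_def reach_def)

definition conn :: "(nat \<Rightarrow> nat \<Rightarrow> bool) \<Rightarrow> nat set \<Rightarrow> bool" where
  "conn E S \<longleftrightarrow> (\<forall>u\<in>S. \<forall>v\<in>S. reach E S u v)"

definition bd :: "(nat \<Rightarrow> nat \<Rightarrow> bool) \<Rightarrow> nat set \<Rightarrow> nat set" where
  "bd E X = {b. b \<notin> X \<and> (\<exists>a\<in>X. E a b)}"

text \<open>Contains \<open>x\<close> itself, so its cardinality is the number of nodes on the root
  path, the depth measure of all cost bounds.\<close>

definition anc :: "(nat \<Rightarrow> nat option) \<Rightarrow> nat \<Rightarrow> nat set" where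
  "anc p x = {u. x \<in> desc p u}"

text \<open>Besides ordering by priority, the existence of some such labelling is how acyclicity of
  a parent function is expressed.\<close>

definition heap :: "(nat \<Rightarrow> nat option) \<Rightarrow> (nat \<Rightarrow> nat) \<Rightarrow> bool" where
  "heap p \<pi> \<longleftrightarrow> (\<forall>v u. p v = Some u \<longrightarrow> \<pi> u < \<pi> v)"

lemma heapD: "heap p \<pi> \<Longrightarrow> p v = Some u \<Longrightarrow> \<pi> u < \<pi> v"
  by (simp add: heap_def)

lemma reach_refl [simp]: "reach E S a a"
  by (simp add: reach_def)

lemma reach_trans: "reach E S a b \<Longrightarrow> reach E S b c \<Longrightarrow> reach E S a c"
  by (simp add: reach_def)

lemma reach_edge: "a \<in> S \<Longrightarrow> b \<in> S \<Longrightarrow> E a b \<Longrightarrow> reach E S a b"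
  unfolding reach_def by (rule r_into_rtranclp) simp

lemma reach_induct [consumes 1, case_names refl step]:
  assumes "reach E S a b" "Q a"
    "\<And>x y. reach E S a x \<Longrightarrow> x \<in> S \<Longrightarrow> y \<in> S \<Longrightarrow> E x y \<Longrightarrow> Q x \<Longrightarrow> Q y"
  shows "Q b"
  using assms(1) unfolding reach_def
  by (induction rule: rtranclp_induct) (use assms(2,3) in \<open>auto simp: reach_def\<close>)

lemma reach_mono: "reach E S a b \<Longrightarrow> S \<subseteq> S' \<Longrightarrow> reach E S' a b"
proof (induction rule: reach_induct)
  case (step x y)
  then have "reach E S' x y" by (intro reach_edge) auto
  with step show ?case using reach_trans by blast
qed simp

lemma reach_in: "reach E S a b \<Longrightarrow> a \<in> S \<Longrightarrow> b \<in> S"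
  by (induction rule: reach_induct) auto

lemma reach_cross:
  "reach E S x y \<Longrightarrow> x \<in> X \<Longrightarrow> y \<notin> X \<Longrightarrow> \<exists>a b. a \<in> S \<and> b \<in> S \<and> a \<in> X \<and> b \<notin> X \<and> E a b"
  by (induction rule: reach_induct) blast+

lemma reach_closed:
  assumes "reach E S x y" "x \<in> X" "\<And>a b. a \<in> S \<Longrightarrow> b \<in> S \<Longrightarrow> a \<in> X \<Longrightarrow> E a b \<Longrightarrow> b \<in> X"
  shows "y \<in> X"
  using reach_cross[OF assms(1,2)] assms(3) by blast

lemma reach_inside:
  assumes "reach E S x y" "x \<in> X" "\<And>a b. a \<in> S \<Longrightarrow> b \<in> S \<Longrightarrow> a \<in> X \<Longrightarrow> E a b \<Longrightarrow> b \<in> X"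
  shows "reach E (S \<inter> X) x y"
proof -
  from assms(1) have "reach E (S \<inter> X) x y \<and> y \<in> X"
  proof (induction rule: reach_induct)
    case (step a b)
    then have "b \<in> X" using assms(3) by blast
    with step have "reach E (S \<inter> X) a b" by (intro reach_edge) auto
    with step \<open>b \<in> X\<close> show ?case using reach_trans by blast
  qed (simp add: assms(2))
  then show ?thesis by simp
qed

section \<open>The descendant order of a parent function\<close>

lemma desc_refl [simp]: "u \<in> desc p u"
  by (simp add: desc_def)

lemma desc_trans: "x \<in> desc p y \<Longrightarrow> y \<in> desc p z \<Longrightarrow> x \<in> desc p z"
  by (simp add: desc_def)

lemma desc_parent: "p x = Some y \<Longrightarrow> x \<in> desc p y"
  by (auto simp: desc_def)

lemma desc_up: "x \<in> desc p y \<Longrightarrow> x \<noteq> y \<Longrightarrow> \<exists>z. p x = Some z \<and> z \<in> desc p y"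
  unfolding desc_def by (auto elim: converse_rtranclpE)

lemma desc_child: "x \<in> desc p y \<Longrightarrow> x \<noteq> y \<Longrightarrow> \<exists>c. p c = Some y \<and> x \<in> desc p c"
  unfolding desc_def by (auto elim: rtranclp.cases)

lemma desc_induct [consumes 1, case_names refl step]:
  assumes "x \<in> desc p y" "Q y" "\<And>x z. p x = Some z \<Longrightarrow> z \<in> desc p y \<Longrightarrow> Q z \<Longrightarrow> Q x"
  shows "Q x"
proof -
  from assms(1) have "(\<lambda>a b. p a = Some b)\<^sup>*\<^sup>* x y" by (simp add: desc_def)
  then show ?thesis
    by (induction rule: converse_rtranclp_induct) (use assms in \<open>auto simp: desc_def\<close>)
qed

lemma desc_comparable: "x \<in> desc p a \<Longrightarrow> x \<in> desc p b \<Longrightarrow> a \<in> desc p b \<or> b \<in> desc p a"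
proof (induction x rule: desc_induct)
  case refl then show ?case by simp
next
  case (step x z)
  show ?case
  proof (cases "x = b")
    case True
    then show ?thesis using step desc_parent desc_trans by metis
  next
    case False
    then show ?thesis using step desc_up[of x p b] by auto
  qed
qed

lemma heap_desc: "v \<in> desc p u \<Longrightarrow> heap p \<pi> \<Longrightarrow> v \<noteq> u \<Longrightarrow> \<pi> u < \<pi> v"
proof (induction v rule: desc_induct)
  case (step x z)
  then show ?case using heapD[of p \<pi> x z] by (cases "z = u") auto
qed simp

lemma heap_desc_le: "v \<in> desc p u \<Longrightarrow> heap p \<pi> \<Longrightarrow> \<pi> u \<le> \<pi> v"
  using heap_desc by (cases "v = u") (auto simp: less_imp_le)

locale sgraph =
  fixes V :: "nat set" and E :: "nat \<Rightarrow> nat \<Rightarrow> bool"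
  assumes fin: "finite V"
    and edge: "E a b \<Longrightarrow> a \<in> V \<and> b \<in> V \<and> a \<noteq> b \<and> E b a"
begin

lemma Esym: "E a b \<Longrightarrow> E b a" using edge by blast
lemma EV: "E a b \<Longrightarrow> a \<in> V" "E a b \<Longrightarrow> b \<in> V" using edge by blast+
lemma Eirr: "E a a \<Longrightarrow> False" using edge by blast

lemma reach_sym: "reach E S a b \<Longrightarrow> reach E S b a"
proof (induction rule: reach_induct)
  case (step y z)
  then have "reach E S z y" using Esym by (intro reach_edge) auto
  then show ?case using step.IH by (rule reach_trans)
qed simp

lemma comp_refl [simp]: "u \<in> comp E S u"
  by (simp add: comp_reach)

lemma comp_subset: "u \<in> S \<Longrightarrow> comp E S u \<subseteq> S"
  by (auto simp: comp_reach intro: reach_in)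

lemma connI: "(\<And>x. x \<in> S \<Longrightarrow> reach E S x r) \<Longrightarrow> conn E S"
  unfolding conn_def by (meson reach_sym reach_trans)

lemma comp_closed: "u \<in> S \<Longrightarrow> a \<in> comp E S u \<Longrightarrow> b \<in> S \<Longrightarrow> E a b \<Longrightarrow> b \<in> comp E S u"
proof -
  assume a: "u \<in> S" "a \<in> comp E S u" "b \<in> S" "E a b"
  then have "a \<in> S" using comp_subset by blast
  with a show ?thesis unfolding comp_reach using reach_edge[of a S b E] reach_trans[of E S u a b] by simp
qed

lemma comp_conn:
  assumes "u \<in> S" shows "conn E (comp E S u)"
proof (rule connI)
  fix v assume "v \<in> comp E S u"
  then have "reach E S u v" by (simp add: comp_reach)
  then have "reach E (S \<inter> comp E S u) u v"
    by (rule reach_inside) (use comp_closed[OF assms] in auto)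
  then show "reach E (comp E S u) v u" by (rule reach_sym[OF reach_mono]) auto
qed

lemma comp_eq: "v \<in> comp E S u \<Longrightarrow> comp E S v = comp E S u"
  unfolding comp_reach by (blast intro: reach_trans reach_sym)

lemma conn_sub_comp: "conn E C \<Longrightarrow> C \<subseteq> S \<Longrightarrow> u \<in> C \<Longrightarrow> C \<subseteq> comp E S u"
  unfolding conn_def comp_reach by (auto intro: reach_mono)

text \<open>A local form of validity: the adjacency condition makes every subtree connected,
  and the last condition makes the subtrees of siblings non-adjacent.\<close>
definition STT :: "(nat \<Rightarrow> nat option) \<Rightarrow> bool" where
  "STT p \<longleftrightarrow> (\<exists>\<rho>. heap p \<rho>) \<and>
     (\<forall>v u. p v = Some u \<longrightarrow> v \<in> V \<and> u \<in> V \<and> (\<exists>s\<in>desc p v. E s u)) \<and>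
     (\<forall>a b. E a b \<longrightarrow> a \<in> desc p b \<or> b \<in> desc p a)"

lemma STT_V: "STT p \<Longrightarrow> p v = Some u \<Longrightarrow> v \<in> V \<and> u \<in> V"
  and STT_adj: "STT p \<Longrightarrow> p v = Some u \<Longrightarrow> \<exists>s\<in>desc p v. E s u"
  and STT_comparable: "STT p \<Longrightarrow> E a b \<Longrightarrow> a \<in> desc p b \<or> b \<in> desc p a"
  unfolding STT_def by blast+

lemma STT_antisym: "STT p \<Longrightarrow> x \<in> desc p y \<Longrightarrow> y \<in> desc p x \<Longrightarrow> x = y"
  unfolding STT_def using heap_desc by (metis order_less_asym)

lemma STT_not_self: "STT p \<Longrightarrow> p x \<noteq> Some x"
  unfolding STT_def heap_def by blast

lemma STT_parent_notin: "STT p \<Longrightarrow> p x = Some y \<Longrightarrow> y \<notin> desc p x"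
  using STT_antisym desc_parent STT_not_self by metis

lemma desc_sub: "STT p \<Longrightarrow> u \<in> V \<Longrightarrow> desc p u \<subseteq> V"
proof
  fix x assume "STT p" "u \<in> V" "x \<in> desc p u"
  then show "x \<in> V" using desc_up STT_V by (cases "x = u") blast+
qed

lemma anc_sub: "STT p \<Longrightarrow> x \<in> V \<Longrightarrow> anc p x \<subseteq> V"
  unfolding anc_def using desc_child STT_V by blast

lemma anc_finite: "STT p \<Longrightarrow> finite (anc p x)"
proof -
  assume "STT p"
  then have "anc p x \<subseteq> insert x V" unfolding anc_def using desc_child STT_V by blast
  then show ?thesis using fin finite_subset by blast
qed

lemma desc_finite: "STT p \<Longrightarrow> finite (desc p x)"
proof -
  assume "STT p"
  then have "desc p x \<subseteq> insert x V" using desc_up STT_V by blast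
  then show ?thesis using fin finite_subset by blast
qed

lemma anc_parent:
  assumes "STT T" "T v = Some u"
  shows "anc T v = insert v (anc T u)" "v \<notin> anc T u" "card (anc T v) = Suc (card (anc T u))"
proof -
  show 1: "anc T v = insert v (anc T u)"
  proof (intro equalityI subsetI)
    fix a assume "a \<in> anc T v"
    then show "a \<in> insert v (anc T u)" using desc_up assms(2) by (fastforce simp: anc_def)
  next
    fix a assume "a \<in> insert v (anc T u)"
    then show "a \<in> anc T v" using desc_trans[OF desc_parent[of T v u, OF assms(2)]] by (auto simp: anc_def)
  qed
  show 2: "v \<notin> anc T u" using STT_parent_notin[OF assms] by (simp add: anc_def)
  show "card (anc T v) = Suc (card (anc T u))" using 1 2 anc_finite[OF assms(1), of u] by simp
qed

lemma desc_child_psub: "STT p \<Longrightarrow> p c = Some u \<Longrightarrow> desc p c \<subset> desc p u"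
  using desc_parent desc_trans STT_parent_notin by (metis desc_refl psubsetI subsetI)

text \<open>Induction on the size: each child subtree is connected, and by the adjacency condition
  it contains a neighbour of \<open>u\<close>.\<close>

lemma desc_conn: "STT p \<Longrightarrow> conn E (desc p u)"
proof (induction "card (desc p u)" arbitrary: u rule: less_induct)
  case less
  show ?case
  proof (rule connI)
    fix x assume x: "x \<in> desc p u"
    show "reach E (desc p u) x u"
    proof (cases "x = u")
      case False
      then obtain c where c: "p c = Some u" "x \<in> desc p c" using desc_child x by metis
      obtain s where s: "s \<in> desc p c" "E s u" using STT_adj less.prems c(1) by blast
      have ps: "desc p c \<subset> desc p u" using desc_child_psub less.prems c(1) by blast
      then have "conn E (desc p c)"
        using less desc_finite psubset_card_mono by blast
      then have "reach E (desc p c) x s" unfolding conn_def using c s by blast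
      then have "reach E (desc p u) x s" using ps reach_mono by blast
      moreover have "reach E (desc p u) s u" using s ps by (intro reach_edge) auto
      ultimately show ?thesis by (rule reach_trans)
    qed simp
  qed
qed

lemma desc_edge:
  assumes "STT p" "heap p \<pi>" "a \<in> desc p t" "E a b" "\<pi> t \<le> \<pi> b"
  shows "b \<in> desc p t"
proof -
  from STT_comparable[OF assms(1,4)] show ?thesis
  proof
    assume "a \<in> desc p b"
    then have "b \<in> desc p t \<or> t \<in> desc p b" using assms(3) desc_comparable by blast
    then show ?thesis using heap_desc[OF _ assms(2), of t b] assms(5) by force
  next
    assume "b \<in> desc p a" then show ?thesis using assms(3) desc_trans by blast
  qed
qed

lemma reach_desc:
  assumes "STT p" "heap p \<pi>" "reach E S t x" "\<And>w. w \<in> S \<Longrightarrow> \<pi> t \<le> \<pi> w"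
  shows "x \<in> desc p t"
  by (rule reach_closed[OF assms(3)]) (use assms desc_edge in auto)

text \<open>An edge can leave a subtree only towards a proper ancestor of its root, and such
  ancestors have smaller priority. The right-hand side no longer mentions \<open>p\<close>, so the
  priority alone fixes all subtrees.\<close>

lemma desc_eq_comp:
  assumes "STT p" "heap p \<pi>" "u \<in> V"
  shows "desc p u = comp E {w\<in>V. \<pi> u \<le> \<pi> w} u"
proof
  show "comp E {w\<in>V. \<pi> u \<le> \<pi> w} u \<subseteq> desc p u"
    using reach_desc[OF assms(1,2)] by (auto simp: comp_reach)
  show "desc p u \<subseteq> comp E {w\<in>V. \<pi> u \<le> \<pi> w} u"
    using desc_conn[OF assms(1)] desc_sub[OF assms(1,3)] heap_desc_le[OF _ assms(2)]
    by (intro conn_sub_comp) auto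
qed

lemma STT_desc_unique:
  assumes "STT p" "STT p'" "\<And>u. u \<in> V \<Longrightarrow> desc p u = desc p' u"
  shows "p = p'"
proof -
  have *: "q v = Some u \<Longrightarrow> q' v = Some u"
    if q: "STT q" "STT q'" and eq: "\<And>u. u \<in> V \<Longrightarrow> desc q u = desc q' u" for q q' v u
  proof -
    assume vu: "q v = Some u"
    then have V: "v \<in> V" "u \<in> V" using STT_V q by blast+
    have "v \<in> desc q' u" "v \<noteq> u" using vu eq V desc_parent STT_not_self q by metis+
    then obtain w where w: "q' v = Some w" "w \<in> desc q' u" using desc_up by metis
    then have wV: "w \<in> V" using STT_V q by blast
    have "v \<in> desc q w" "v \<noteq> w" using w wV eq desc_parent STT_not_self q by metis+
    then have "u \<in> desc q w" using vu desc_up by fastforce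
    then have "w = u" using w(2) wV V eq STT_antisym q by metis
    then show ?thesis using w by simp
  qed
  show ?thesis
  proof
    fix v show "p v = p' v"
      using *[OF assms(1,2,3), of v] *[OF assms(2,1) assms(3)[symmetric], of v]
      by (cases "p v"; cases "p' v") auto
  qed
qed

lemma heap_unique:
  assumes "STT p" "STT p'" "heap p \<pi>" "heap p' \<pi>" shows "p = p'"
  using assms desc_eq_comp by (intro STT_desc_unique) auto

text \<open>Well defined for nonempty connected \<open>S\<close>: edges join comparable vertices, so
  an element of \<open>S\<close> that is minimal for a heap order lies above all of
  \<open>S\<close>.\<close>

definition top :: "(nat \<Rightarrow> nat option) \<Rightarrow> nat set \<Rightarrow> nat" where
  "top p S = (THE t. t \<in> S \<and> S \<subseteq> desc p t)"

lemma top_eqI: "STT p \<Longrightarrow> t \<in> S \<Longrightarrow> S \<subseteq> desc p t \<Longrightarrow> top p S = t"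
  unfolding top_def by (rule the_equality) (use STT_antisym in blast)+

lemma top:
  assumes "STT p" "conn E S" "S \<subseteq> V" "S \<noteq> {}"
  shows "top p S \<in> S" "S \<subseteq> desc p (top p S)"
proof -
  obtain \<rho> where \<rho>: "heap p \<rho>" using assms(1) STT_def by blast
  have "finite S" using assms(3) fin finite_subset by blast
  then obtain t where t: "t \<in> S" "\<And>w. w \<in> S \<Longrightarrow> \<rho> t \<le> \<rho> w"
    using assms(4) by (metis arg_min_if_finite(1) arg_min_least)
  have "S \<subseteq> desc p t"
    using reach_desc[OF assms(1) \<rho> _ t(2)] t(1) assms(2) unfolding conn_def by blast
  with t top_eqI[OF assms(1)] show "top p S \<in> S" "S \<subseteq> desc p (top p S)" by metis+
qed

end

section \<open>Rotations\<close>

lemma finite_min_exists: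
  fixes f :: "nat \<Rightarrow> nat"
  assumes "finite S" "x \<in> S"
  shows "\<exists>m\<in>S. \<forall>w\<in>S. f m \<le> f w"
  using arg_min_if_finite(1)[OF assms(1)] arg_min_least[OF assms(1)] assms(2) by blast

context sgraph
begin

context
  fixes p v q
  assumes S: "STT p" and vq: "p v = Some q"
begin

lemma rot_v: "rot E p v q v = p q"
  by (simp add: rot_def)

lemma rot_q: "rot E p v q q = Some v"
  using STT_not_self[OF S] vq by (auto simp: rot_def)

lemma rot_moved: "p w = Some v \<Longrightarrow> s \<in> desc p w \<Longrightarrow> E s q \<Longrightarrow> rot E p v q w = Some q"
  using STT_not_self[OF S] vq STT_parent_notin[OF S, of v q] desc_parent[of p q v]
  by (auto simp: rot_def)

lemma rot_other:
  "w \<noteq> v \<Longrightarrow> w \<noteq> q \<Longrightarrow> \<not> (p w = Some v \<and> (\<exists>s\<in>desc p w. E s q)) \<Longrightarrow> rot E p v q w = p w"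
  by (auto simp: rot_def)

lemma rot_cases:
  obtains "w = v" "rot E p v q w = p q" | "w = q" "rot E p v q w = Some v"
  | s where "w \<noteq> v" "w \<noteq> q" "p w = Some v" "s \<in> desc p w" "E s q" "rot E p v q w = Some q"
  | "w \<noteq> v" "w \<noteq> q" "rot E p v q w = p w"
  using rot_v rot_q rot_moved rot_other by metis

lemma rot_desc_sup: "x \<in> desc p y \<Longrightarrow> y \<noteq> q \<Longrightarrow> x \<in> desc (rot E p v q) y"
proof (induction x rule: desc_induct)
  case (step x z)
  show ?case
  proof (cases rule: rot_cases[of x])
    case 1
    with step vq have "q \<in> desc (rot E p v q) y" by simp
    then show ?thesis using desc_up rot_q step.prems 1 by fastforce
  next
    case 2
    have "v \<in> desc (rot E p v q) y" using step 2 rot_v desc_parent desc_trans by metis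
    then show ?thesis using 2 desc_parent desc_trans by metis
  next
    case (3 s)
    have "q \<in> desc (rot E p v q) v" using rot_q desc_parent by metis
    then show ?thesis using step 3 desc_parent desc_trans by (metis option.inject)
  next
    case 4 then show ?thesis using step desc_parent desc_trans by metis
  qed
qed simp

lemma rot_desc_sub: "x \<in> desc (rot E p v q) y \<Longrightarrow> y \<noteq> v \<Longrightarrow> x \<in> desc p y"
proof (induction x rule: desc_induct)
  case (step x z)
  show ?case
  proof (cases rule: rot_cases[of x])
    case 1
    then have "q \<in> desc p y" using step desc_parent desc_trans by metis
    then show ?thesis using 1 vq desc_parent desc_trans by metis
  next
    case 2
    then have "v \<in> desc p y" using step by simp
    then show ?thesis using step.prems desc_up vq 2 by fastforce
  next
    case (3 s)
    then show ?thesis using step vq desc_parent desc_trans by (metis option.inject)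
  next
    case 4 then show ?thesis using step desc_parent desc_trans by metis
  qed
qed simp

lemma rot_desc_other: "y \<noteq> v \<Longrightarrow> y \<noteq> q \<Longrightarrow> desc (rot E p v q) y = desc p y"
  using rot_desc_sup rot_desc_sub by blast

lemma rot_desc_v: "desc (rot E p v q) v = desc p q"
proof (intro equalityI subsetI)
  fix x assume "x \<in> desc (rot E p v q) v"
  then show "x \<in> desc p q"
  proof (induction x rule: desc_induct)
    case refl then show ?case using vq desc_parent by metis
  next
    case (step x z)
    show ?case
    proof (cases rule: rot_cases[of x])
      case 1 then show ?thesis using vq desc_parent by metis
    next
      case (3 s) then show ?thesis using vq desc_parent desc_trans by metis
    next
      case 4 then show ?thesis using step desc_parent desc_trans by metis
    qed simp
  qed
next
  fix x assume "x \<in> desc p q"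
  then show "x \<in> desc (rot E p v q) v"
  proof (induction x rule: desc_induct)
    case refl then show ?case using rot_q desc_parent by metis
  next
    case (step x z)
    show ?case
    proof (cases rule: rot_cases[of x])
      case 2 then show ?thesis using desc_parent by metis
    next
      case (3 s)
      then show ?thesis using rot_q desc_parent desc_trans by metis
    next
      case 4 then show ?thesis using step desc_parent desc_trans by metis
    qed simp
  qed
qed

lemma rot_anc_sub: "anc (rot E p v q) y \<subseteq> insert v (anc p y)"
  unfolding anc_def using rot_desc_sub by blast

lemma rot_anc_sup: "anc p y \<subseteq> insert q (anc (rot E p v q) y)"
  unfolding anc_def using rot_desc_sup by blast

lemma rot_anc_v: "anc (rot E p v q) v \<subseteq> anc p v"
  using rot_anc_sub[of v] by (auto simp: anc_def)

text \<open>Only ancestry of \<open>q\<close> is lost, and only over vertices below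
  \<open>v\<close>. A neighbour of \<open>q\<close> strictly below \<open>v\<close> lies in a child
  subtree that the rotation hands to \<open>q\<close>; \<open>v\<close> itself ends up above
  \<open>q\<close>.\<close>

lemma rot_comparable:
  assumes "E a b" "a \<in> desc p b"
  shows "a \<in> desc (rot E p v q) b \<or> b \<in> desc (rot E p v q) a"
proof (cases "b = q")
  case False then show ?thesis using rot_desc_sup assms by blast
next
  case True
  have neq: "a \<noteq> q" "v \<noteq> q" using assms True Eirr STT_not_self[OF S] vq by auto
  consider "a = v" | "a \<in> desc p v" "a \<noteq> v" | "a \<notin> desc p v" by blast
  then show ?thesis
  proof cases
    case 1 then show ?thesis using True rot_q desc_parent by metis
  next
    case 2
    then obtain w where w: "p w = Some v" "a \<in> desc p w" using desc_child by metis
    then have "rot E p v q w = Some q" using rot_moved assms True by blast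
    moreover have "a \<in> desc (rot E p v q) w"
      using w rot_desc_sup STT_parent_notin[OF S] vq desc_parent by metis
    ultimately show ?thesis using True desc_parent desc_trans by metis
  next
    case 3
    obtain w where w: "p w = Some q" "a \<in> desc p w" using desc_child assms True neq by metis
    then have wn: "w \<noteq> v" "w \<noteq> q" using 3 STT_not_self[OF S] by auto
    then have "rot E p v q w = Some q" using rot_other w neq by auto
    then show ?thesis using True w wn rot_desc_other desc_parent desc_trans by metis
  qed
qed

lemma rot_adj:
  assumes "rot E p v q x = Some z"
  shows "\<exists>s\<in>desc (rot E p v q) x. E s z"
proof (cases rule: rot_cases[of x])
  case 1
  then show ?thesis using assms STT_adj[OF S, of q z] rot_desc_v by simp
next
  case 2
  then have z: "z = v" using assms by simp
  obtain s where s: "s \<in> desc p v" "E s q" using STT_adj[OF S vq] by blast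
  show ?thesis
  proof (cases "s = v")
    case True then show ?thesis using s z 2 Esym desc_refl by blast
  next
    case False
    then obtain w where w: "p w = Some v" "s \<in> desc p w" using desc_child s by metis
    obtain s' where s': "s' \<in> desc p w" "E s' v" using STT_adj[OF S w(1)] by blast
    have "rot E p v q w = Some q" using rot_moved w s by blast
    moreover have "s' \<in> desc (rot E p v q) w"
      using w s' rot_desc_sup STT_parent_notin[OF S] vq desc_parent by metis
    ultimately show ?thesis using s' z 2 desc_parent desc_trans by metis
  qed
next
  case (3 s)
  then show ?thesis using assms rot_desc_other by fastforce
next
  case 4
  then show ?thesis using assms rot_desc_other STT_adj[OF S] by simp
qed

lemma rot_STT: "STT (rot E p v q)"
proof -
  obtain \<rho> where \<rho>: "heap p \<rho>" using S STT_def by blast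
  \<comment> \<open>Doubling leaves a free slot: the new label of \<open>v\<close> is one less than
    that of \<open>q\<close> and still exceeds that of the old parent of \<open>q\<close>.\<close>
  define \<rho>' where "\<rho>' w = (if w = v then 2 * \<rho> q else 2 * \<rho> w + 1)" for w
  have "\<rho>' z < \<rho>' x" if "rot E p v q x = Some z" for x z
  proof (cases rule: rot_cases[of x])
    case 1 then show ?thesis
      using that heapD[OF \<rho>, of q z] heapD[OF \<rho> vq] by (auto simp: \<rho>'_def)
  next
    case 2 then show ?thesis using that heapD[OF \<rho> vq] by (auto simp: \<rho>'_def)
  next
    case (3 s) then show ?thesis
      using that heapD[OF \<rho> vq] heapD[OF \<rho>, of x v] by (auto simp: \<rho>'_def)
  next
    case 4 then show ?thesis
      using that heapD[OF \<rho>, of x z] heapD[OF \<rho> vq] by (auto simp: \<rho>'_def)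
  qed
  then have "heap (rot E p v q) \<rho>'" by (simp add: heap_def)
  moreover have "x \<in> V \<and> z \<in> V" if "rot E p v q x = Some z" for x z
    using rot_cases[of x] STT_V[OF S] vq that by (metis option.inject)
  moreover have "a \<in> desc (rot E p v q) b \<or> b \<in> desc (rot E p v q) a" if "E a b" for a b
    using STT_comparable[OF S that] rot_comparable that Esym by blast
  ultimately show ?thesis unfolding STT_def using rot_adj by blast
qed

end

text \<open>A rotation takes only \<open>q\<close> away from the ancestors of a vertex and adds only
  \<open>v\<close>. So the top can change only from \<open>q\<close>, and only to
  \<open>v\<close>.\<close>

lemma top_rot:
  assumes "STT p" "p v = Some q" "conn E S" "S \<subseteq> V" "S \<noteq> {}"
  shows "top (rot E p v q) S = (if top p S = q \<and> v \<in> S then v else top p S)"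
proof (cases "top p S = q")
  case False
  then have "S \<subseteq> desc (rot E p v q) (top p S)"
    using top(2)[OF assms(1,3-5)] rot_desc_sup[OF assms(1,2)] by blast
  then show ?thesis
    using False top_eqI[OF rot_STT[OF assms(1,2)]] top(1)[OF assms(1,3-5)] by auto
next
  case True
  have sub: "S \<subseteq> desc p q" and qS: "q \<in> S" using top[OF assms(1,3-5)] True by auto
  show ?thesis
  proof (cases "v \<in> S")
    case vS: True
    then show ?thesis using True sub rot_desc_v[OF assms(1,2)]
      top_eqI[OF rot_STT[OF assms(1,2)] vS] by auto
  next
    case vS: False
    define y where "y = top (rot E p v q) S"
    have y: "y \<in> S" "S \<subseteq> desc (rot E p v q) y"
      using top[OF rot_STT[OF assms(1,2)] assms(3-5)] y_def by auto
    then have "y \<noteq> v" using vS by auto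
    then have "q \<in> desc p y" using y qS rot_desc_sub[OF assms(1,2)] by blast
    then have "y = q" using STT_antisym[OF assms(1)] sub y(1) by blast
    then show ?thesis using True vS y_def by simp
  qed
qed

text \<open>An edge leaving the subtree of \<open>v\<close> leads to a proper ancestor of
  \<open>v\<close>, and among the vertices below \<open>q\<close> the only one is \<open>q\<close>.
  Thus the subtree of a child follows from that of its parent, which is what makes rotations
  invertible.\<close>

lemma desc_child_eq_comp:
  assumes "STT p" "p v = Some q"
  shows "desc p v = comp E (desc p q - {q}) v"
proof
  have sub: "desc p v \<subseteq> desc p q - {q}"
    using desc_child_psub[OF assms] STT_parent_notin[OF assms] by blast
  then show "desc p v \<subseteq> comp E (desc p q - {q}) v"
    using desc_conn[OF assms(1)] by (intro conn_sub_comp) auto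
  show "comp E (desc p q - {q}) v \<subseteq> desc p v"
  proof
    fix x assume "x \<in> comp E (desc p q - {q}) v"
    then have "reach E (desc p q - {q}) v x" by (simp add: comp_reach)
    then show "x \<in> desc p v"
    proof (rule reach_closed)
      fix a b assume ab: "b \<in> desc p q - {q}" "a \<in> desc p v" "E a b"
      from STT_comparable[OF assms(1) ab(3)] show "b \<in> desc p v"
      proof
        assume "a \<in> desc p b"
        then consider "b \<in> desc p v" | "v \<in> desc p b" "b \<noteq> v"
          using ab(2) desc_comparable desc_refl by metis
        then show ?thesis
        proof cases
          case 2
          then have "q \<in> desc p b" using desc_up assms(2) by fastforce
          then show ?thesis using STT_antisym[OF assms(1)] ab(1) by blast
        qed
      next
        assume "b \<in> desc p a" then show ?thesis using ab(2) desc_trans by blast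
      qed
    qed simp
  qed
qed

lemma rot_inverse:
  assumes "STT p" "p v = Some q"
  shows "rot E (rot E p v q) q v = p"
proof -
  let ?p = "rot E p v q"
  have S': "STT ?p" "?p q = Some v" using rot_STT rot_q assms by auto
  note S'' = rot_STT[OF S'] rot_q[OF S']
  show ?thesis
  proof (rule STT_desc_unique[OF S''(1) assms(1)])
    fix u assume "u \<in> V"
    \<comment> \<open>The two rotations can affect only the subtrees of \<open>q\<close> and
      \<open>v\<close>; the former is read off directly, the latter is a component of the former
      minus \<open>q\<close>.\<close>
    have q: "desc (rot E ?p q v) q = desc p q" using rot_desc_v[OF S'] rot_desc_v[OF assms] by simp
    consider "u = q" | "u = v" | "u \<noteq> q" "u \<noteq> v" by blast
    then show "desc (rot E ?p q v) u = desc p u"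
    proof cases
      case 1 then show ?thesis using q by simp
    next
      case 2 then show ?thesis
        using desc_child_eq_comp[OF S''] desc_child_eq_comp[OF assms] q by simp
    next
      case 3 then show ?thesis using rot_desc_other[OF S'] rot_desc_other[OF assms] by simp
    qed
  qed
qed

text \<open>Existence counterpart of \<open>heap_unique\<close>. Priorities need not be injective: a
  unique minimum in each connected set is enough, which is the notion of a vertex ranking.\<close>

lemma rank_tree_exists:
  fixes \<delta> :: "nat \<Rightarrow> nat"
  assumes uniq: "\<And>C u w. conn E C \<Longrightarrow> C \<subseteq> V \<Longrightarrow> u \<in> C \<Longrightarrow> w \<in> C \<Longrightarrow>
     (\<forall>x\<in>C. \<delta> u \<le> \<delta> x) \<Longrightarrow> (\<forall>x\<in>C. \<delta> w \<le> \<delta> x) \<Longrightarrow> u = w"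
  obtains p where "STT p" "heap p \<delta>"
proof -
  \<comment> \<open>\<open>D u\<close> is the subtree that \<open>u\<close> is forced to have, and
    \<open>A v\<close> collects the proper ancestors this gives to \<open>v\<close>. The parent is
    the ancestor of largest rank, written as a minimum of reversed ranks.\<close>
  define D where "D u = comp E {w\<in>V. \<delta> u \<le> \<delta> w} u" for u
  define A where "A v = {u\<in>V. u \<noteq> v \<and> v \<in> D u}" for v
  define p where "p v = (if v \<in> V \<and> A v \<noteq> {} then Some (arg_min_on (\<lambda>u. Max (\<delta> ` V) - \<delta> u) (A v)) else None)" for v
  have DV: "D u \<subseteq> {w\<in>V. \<delta> u \<le> \<delta> w}" if "u \<in> V" for u
    unfolding D_def by (rule comp_subset) (use that in auto)
  have Dconn: "conn E (D u)" if "u \<in> V" for u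
    unfolding D_def by (rule comp_conn) (use that in auto)
  have Duniq: "v = u" if "u \<in> V" "v \<in> D u" "\<delta> v \<le> \<delta> u" for u v
    using uniq[of "D u" v u] DV Dconn that by (force simp: D_def)
  have Aless: "\<delta> u < \<delta> v" if "u \<in> A v" for u v
    using Duniq[of u v] that by (force simp: A_def)
  \<comment> \<open>Two of the sets \<open>D\<close> with a common vertex are nested, so the
    prospective ancestors of a vertex form a chain.\<close>
  have chain: "w \<in> D u" if "u \<in> V" "w \<in> V" "v \<in> D u" "v \<in> D w" "\<delta> u \<le> \<delta> w" for u w v
  proof -
    have "D w \<subseteq> {x\<in>V. \<delta> u \<le> \<delta> x}" using DV[OF that(2)] that(5) by force
    then have "D w \<subseteq> comp E {w\<in>V. \<delta> u \<le> \<delta> w} v"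
      using conn_sub_comp[OF Dconn[OF that(2)]] that(4) by blast
    also have "\<dots> = D u" unfolding D_def by (rule comp_eq) (use that in \<open>simp add: D_def\<close>)
    finally show ?thesis unfolding D_def by (auto simp: D_def)
  qed
  have Dsub: "D w \<subseteq> D u" if "u \<in> V" "w \<in> D u" for u w
  proof -
    have w: "w \<in> V" "\<delta> u \<le> \<delta> w" using DV[OF that(1)] that(2) by auto
    have "D w \<subseteq> comp E {x\<in>V. \<delta> u \<le> \<delta> x} w"
      using DV[OF w(1)] w by (intro conn_sub_comp Dconn) (force simp: D_def)+
    then show ?thesis using comp_eq that(2) unfolding D_def by blast
  qed
  have Afin: "finite (A v)" for v using fin by (simp add: A_def)
  have pA: "u \<in> A v" "\<And>w. w \<in> A v \<Longrightarrow> \<delta> w \<le> \<delta> u" "v \<in> V" if "p v = Some u" for v u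
  proof -
    from that have u: "v \<in> V" "A v \<noteq> {}" "u = arg_min_on (\<lambda>u. Max (\<delta> ` V) - \<delta> u) (A v)"
      by (auto simp: p_def split: if_splits)
    then show "v \<in> V" "u \<in> A v" using arg_min_if_finite(1)[OF Afin] by blast+
    fix w assume w: "w \<in> A v"
    have "Max (\<delta> ` V) - \<delta> u \<le> Max (\<delta> ` V) - \<delta> w"
      using arg_min_least[OF Afin u(2) w, of "\<lambda>u. Max (\<delta> ` V) - \<delta> u"] u(3) by simp
    moreover have "\<delta> w \<le> Max (\<delta> ` V)" using w fin by (auto simp: A_def)
    ultimately show "\<delta> w \<le> \<delta> u" by linarith
  qed
  have pV: "u \<in> V" if "p v = Some u" for v u using pA(1)[OF that] by (auto simp: A_def)
  have h: "heap p \<delta>" unfolding heap_def using pA(1) Aless by blast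
  have sub: "x \<in> D u" if "x \<in> desc p u" "u \<in> V" for x u
    using that
  proof (induction x rule: desc_induct)
    case (step x z)
    have "z \<in> V" using pV step by blast
    have "x \<in> D z" using pA(1)[OF step(1)] by (simp add: A_def)
    then show ?case using Dsub step by blast
  qed (simp add: D_def)
  have sup: "x \<in> desc p u" if "x \<in> D u" "u \<in> V" "x \<in> V" for x u
    using that
  proof (induction "\<delta> x" arbitrary: x rule: less_induct)
    case less
    show ?case
    proof (cases "x = u")
      case False
      then have "u \<in> A x" using less by (simp add: A_def)
      then have "A x \<noteq> {}" by blast
      then obtain z where z: "p x = Some z" using less.prems by (simp add: p_def)
      then have zA: "z \<in> A x" "\<delta> u \<le> \<delta> z" using pA \<open>u \<in> A x\<close> by auto
      then have "z \<in> D u" using chain[of u z x] less.prems by (auto simp: A_def)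
      then have "z \<in> desc p u" using less zA Aless[OF zA(1)] by (auto simp: A_def)
      then show ?thesis using z desc_parent desc_trans by metis
    qed simp
  qed
  have cmp: "a \<in> desc p b \<or> b \<in> desc p a" if "E a b" for a b
  proof -
    have V: "a \<in> V" "b \<in> V" using that EV by auto
    have *: "y \<in> D x" if "x \<in> V" "y \<in> V" "E x y" "\<delta> x \<le> \<delta> y" for x y
      unfolding D_def comp_reach using that by (auto intro: reach_edge)
    show ?thesis using *[of a b] *[of b a] V that Esym sup[of b a] sup[of a b] by force
  qed
  \<comment> \<open>The component of \<open>v\<close> above rank \<open>\<delta> u\<close> has
    minimum \<open>v\<close>, as any other minimum would be an ancestor of \<open>v\<close> closer
    than \<open>u\<close>. An edge leaving it towards \<open>u\<close> ends at rank
    \<open>\<delta> u\<close> inside \<open>D u\<close>, hence at \<open>u\<close>.\<close>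
  have adj: "\<exists>s\<in>desc p v. E s u" if vu: "p v = Some u" for v u
  proof -
    let ?C = "comp E {w\<in>V. \<delta> u < \<delta> w} v"
    have vA: "v \<in> D u" "u \<in> V" "v \<in> V" "\<delta> u < \<delta> v"
      using pA(1,3)[OF vu] Aless[OF pA(1)[OF vu]] by (auto simp: A_def)
    have CV: "?C \<subseteq> {w\<in>V. \<delta> u < \<delta> w}" by (rule comp_subset) (use vA in auto)
    have Cc: "conn E ?C" by (rule comp_conn) (use vA in auto)
    have "finite ?C" using CV fin finite_subset by fastforce
    then obtain m where m: "m \<in> ?C" "\<And>w. w \<in> ?C \<Longrightarrow> \<delta> m \<le> \<delta> w"
      using finite_min_exists[of ?C v \<delta>] by auto
    have mV: "m \<in> V" "\<delta> u < \<delta> m" using m(1) CV by auto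
    have "?C \<subseteq> D m" unfolding D_def using CV m by (intro conn_sub_comp Cc) auto
    have "m = v"
    proof (rule ccontr)
      assume "m \<noteq> v"
      then have "m \<in> A v" using mV \<open>?C \<subseteq> D m\<close> comp_refl by (auto simp: A_def)
      then show False using pA(2)[OF vu] mV by fastforce
    qed
    have "reach E {w\<in>V. \<delta> u \<le> \<delta> w} v u"
      using vA(1) unfolding D_def comp_reach by (auto intro: reach_sym)
    moreover have "u \<notin> ?C" using CV by auto
    ultimately obtain a b where ab: "a \<in> ?C" "b \<notin> ?C" "b \<in> V" "\<delta> u \<le> \<delta> b" "E a b"
      "a \<in> V" using reach_cross[of E _ v u ?C] comp_refl by blast
    have "\<delta> b \<le> \<delta> u" using ab comp_closed[of v "{w\<in>V. \<delta> u < \<delta> w}" a b] vA by force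
    moreover have "b \<in> D u"
    proof -
      have "a \<in> D u"
      proof -
        have "D v \<subseteq> D u" using Dsub vA by blast
        then show ?thesis using ab(1) \<open>?C \<subseteq> D m\<close> \<open>m = v\<close> by blast
      qed
      then show ?thesis unfolding D_def using comp_closed[of u _ a b] ab vA by simp
    qed
    ultimately have "b = u" using Duniq vA by blast
    moreover have "a \<in> desc p v" using sup ab \<open>?C \<subseteq> D m\<close> \<open>m = v\<close> vA by blast
    ultimately show ?thesis using ab by blast
  qed
  have "STT p" unfolding STT_def using h pA(3) pV cmp adj by blast
  with h that show ?thesis by blast
qed

lemma inj_tree_exists:
  fixes \<pi> :: "nat \<Rightarrow> nat"
  assumes "inj_on \<pi> V"
  obtains p where "STT p" "heap p \<pi>"
proof (rule rank_tree_exists[of \<pi>])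
  fix C u w assume "C \<subseteq> V" "u \<in> C" "w \<in> C" "\<forall>x\<in>C. \<pi> u \<le> \<pi> x" "\<forall>x\<in>C. \<pi> w \<le> \<pi> x"
  then show "u = w" using assms by (meson inj_onD le_antisym subsetD)
qed (use that in blast)

end

section \<open>Validity\<close>

locale cgraph = sgraph +
  assumes ne: "V \<noteq> {}" and conV: "conn E V"
begin

lemma root_exists:
  assumes "STT p"
  shows "\<exists>r\<in>V. p r = None \<and> V \<subseteq> desc p r"
proof -
  let ?r = "top p V"
  have r: "?r \<in> V" "V \<subseteq> desc p ?r" using top[OF assms conV _ ne] by auto
  have "p ?r = None"
  proof (cases "p ?r")
    case (Some u)
    then have "u \<in> desc p ?r" using r STT_V[OF assms] by blast
    then show ?thesis using STT_parent_notin[OF assms Some] by blast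
  qed
  with r show ?thesis by blast
qed

lemma root_unique:
  assumes "STT p" "V \<subseteq> desc p r" "x \<in> V" "p x = None"
  shows "x = r"
  using assms desc_up[of x p r] by auto

lemma st_root:
  assumes "STT p"
  shows "st_root V p \<in> V" "p (st_root V p) = None" "V \<subseteq> desc p (st_root V p)"
proof -
  obtain r where r: "r \<in> V" "p r = None" "V \<subseteq> desc p r" using root_exists assms by blast
  have "st_root V p = r" unfolding st_root_def
    using r root_unique[OF assms r(3)] by (intro the_equality) blast+
  with r show "st_root V p \<in> V" "p (st_root V p) = None" "V \<subseteq> desc p (st_root V p)" by auto
qed

lemma anc_root: "STT p \<Longrightarrow> anc p (st_root V p) = {st_root V p}"
  using st_root(2) desc_up unfolding anc_def by (fastforce simp: desc_refl)

text \<open>An edge avoiding the root stays inside one component, and since \<open>S\<close> is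
  connected every component has an edge to the root. So the recursive definition yields the local
  conditions of \<open>STT\<close>.\<close>

lemma st_on_facts:
  assumes "st_on E S r p" "conn E S" "S \<subseteq> V"
  shows "r \<in> S \<and> (\<forall>v\<in>S. v \<in> desc p r) \<and>
    (\<forall>v\<in>S - {r}. \<exists>u\<in>S. p v = Some u \<and> (\<exists>s\<in>desc p v. E s u)) \<and>
    (\<forall>a\<in>S. \<forall>b\<in>S. E a b \<longrightarrow> a \<in> desc p b \<or> b \<in> desc p a)"
  using assms
proof (induction rule: st_on.induct)
  case (1 r S p)
  have sub: "comp E (S - {r}) v \<in> comps E (S - {r}) \<and> comp E (S - {r}) v \<subseteq> S - {r} \<and>
      conn E (comp E (S - {r}) v)" if "v \<in> S - {r}" for v
    using that comp_subset comp_conn by (auto simp: comps_def)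
  have ex: "\<exists>r'\<in>comp E (S - {r}) v. p r' = Some r \<and>
      (\<forall>x\<in>comp E (S - {r}) v. x \<in> desc p r') \<and>
      (\<forall>x\<in>comp E (S - {r}) v - {r'}. \<exists>u\<in>comp E (S - {r}) v. p x = Some u \<and> (\<exists>s\<in>desc p x. E s u)) \<and>
      (\<forall>a\<in>comp E (S - {r}) v. \<forall>b\<in>comp E (S - {r}) v. E a b \<longrightarrow> a \<in> desc p b \<or> b \<in> desc p a)"
    if "v \<in> S - {r}" for v
    using 1(2)[rule_format, of "comp E (S - {r}) v"] sub[OF that] 1(4) by blast
  have d: "v \<in> desc p r" if v: "v \<in> S" for v
  proof (cases "v = r")
    case False
    then show ?thesis using ex[of v] v comp_refl desc_parent desc_trans by (metis DiffI singletonD)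
  qed simp
  moreover have "\<exists>u\<in>S. p v = Some u \<and> (\<exists>s\<in>desc p v. E s u)" if v: "v \<in> S - {r}" for v
  proof -
    obtain r' where r': "r' \<in> comp E (S - {r}) v" "p r' = Some r"
      "\<forall>x\<in>comp E (S - {r}) v. x \<in> desc p r'"
      "\<forall>x\<in>comp E (S - {r}) v - {r'}. \<exists>u\<in>comp E (S - {r}) v. p x = Some u \<and> (\<exists>s\<in>desc p x. E s u)"
      using ex[OF v] by blast
    show ?thesis
    proof (cases "v = r'")
      case False
      then show ?thesis using r'(4) sub[OF v] comp_refl by blast
    next
      case True
      have "reach E S v r" using 1(1,3) v conn_def by auto
      moreover have "r \<notin> comp E (S - {r}) v" using sub[OF v] by blast
      ultimately obtain a b where ab: "a \<in> comp E (S - {r}) v" "b \<notin> comp E (S - {r}) v" "b \<in> S" "E a b"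
        using reach_cross[of E S v r "comp E (S - {r}) v"] comp_refl by blast
      then have "b = r" using comp_closed[of v "S - {r}" a b] v by blast
      then show ?thesis using True r' ab 1(1) by blast
    qed
  qed
  moreover have "a \<in> desc p b \<or> b \<in> desc p a" if ab: "a \<in> S" "b \<in> S" "E a b" for a b
  proof (cases "a = r \<or> b = r")
    case True then show ?thesis using d ab by blast
  next
    case False
    then have "b \<in> comp E (S - {r}) a" using comp_closed[of a "S - {r}" a b] ab by auto
    then show ?thesis using ex[of a] ab False comp_refl by blast
  qed
  ultimately show ?case using 1(1) by blast
qed

text \<open>The labelling is the distance to the root, well defined because the parent function is
  deterministic and stops at \<open>r\<close>.\<close>

lemma heap_from_root:
  assumes "p r = None" "\<And>v. p v \<noteq> None \<Longrightarrow> v \<in> desc p r"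
  shows "\<exists>\<rho>. heap p \<rho>"
proof -
  have inj: "m = n" if "((\<lambda>a b. p a = Some b) ^^ m) v r" "((\<lambda>a b. p a = Some b) ^^ n) v r" for m n v
    using that
  proof (induction m arbitrary: n v)
    case 0
    then have "v = r" by simp
    with 0(2) show ?case using assms(1) by (cases n) (auto simp del: relpowp.simps elim!: relpowp_Suc_E2)
  next
    case (Suc m)
    then obtain w where w: "p v = Some w" "((\<lambda>a b. p a = Some b) ^^ m) w r"
      by (meson relpowp_Suc_D2)
    then obtain n' where "n = Suc n'" using Suc.prems(2) assms(1) by (cases n) auto
    with Suc.prems(2) have "((\<lambda>a b. p a = Some b) ^^ Suc n') v r" by simp
    then have "((\<lambda>a b. p a = Some b) ^^ n') w r" using w(1) by (auto elim!: relpowp_Suc_E2 simp del: relpowp.simps)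
    then show ?case using Suc.IH[OF w(2)] \<open>n = Suc n'\<close> by simp
  qed
  define \<rho> where "\<rho> v = (THE n. ((\<lambda>a b. p a = Some b) ^^ n) v r)" for v
  have \<rho>: "\<rho> v = n" if "((\<lambda>a b. p a = Some b) ^^ n) v r" for v n
    unfolding \<rho>_def by (rule the_equality) (use that inj in auto)
  have "\<rho> u < \<rho> v" if "p v = Some u" for v u
  proof -
    have "v \<in> desc p r" "v \<noteq> r" using assms that by auto
    then have "u \<in> desc p r" using desc_up that by fastforce
    then have "(\<lambda>a b. p a = Some b)\<^sup>*\<^sup>* u r" by (simp add: desc_def)
    then obtain n where n: "((\<lambda>a b. p a = Some b) ^^ n) u r"
      by (rule rtranclp_imp_relpowp[THEN exE])
    then have "((\<lambda>a b. p a = Some b) ^^ Suc n) v r" using that by (meson relpowp_Suc_I2)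
    then show ?thesis using \<rho>[OF n] \<rho>[of "Suc n" v] by simp
  qed
  then show ?thesis unfolding heap_def by blast
qed

lemma valid_imp_STT:
  assumes "valid_st V E p" shows "STT p"
proof -
  obtain r where r: "p r = None" "st_on E V r p" and out: "\<And>v. v \<notin> V \<Longrightarrow> p v = None"
    using assms unfolding valid_st_def by blast
  note f = st_on_facts[OF r(2) conV subset_refl]
  have "\<exists>\<rho>. heap p \<rho>" by (rule heap_from_root[of p r]) (use r f out in auto)
  moreover have "v \<in> V \<and> u \<in> V \<and> (\<exists>s\<in>desc p v. E s u)" if vu: "p v = Some u" for v u
  proof -
    have "v \<in> V - {r}" using vu r out by force
    then show ?thesis using f vu by force
  qed
  moreover have "a \<in> desc p b \<or> b \<in> desc p a" if "E a b" for a b using f EV that by blast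
  ultimately show ?thesis unfolding STT_def by blast
qed

lemma STT_st_on:
  assumes "STT p" shows "st_on E (desc p r) r p"
proof (induction "card (desc p r)" arbitrary: r rule: less_induct)
  case less
  show ?case
  proof (rule st_on.intros)
    show "\<forall>C\<in>comps E (desc p r - {r}). \<exists>r'\<in>C. p r' = Some r \<and> st_on E C r' p"
    proof
      fix C assume "C \<in> comps E (desc p r - {r})"
      then obtain u where u: "u \<in> desc p r" "u \<noteq> r" "C = comp E (desc p r - {r}) u"
        by (auto simp: comps_def)
      then obtain c where c: "p c = Some r" "u \<in> desc p c" using desc_child by metis
      have eq: "desc p c = comp E (desc p r - {r}) c" by (rule desc_child_eq_comp[OF assms c(1)])
      then have "C = desc p c" using comp_eq[of u "desc p r - {r}" c] c u by simp
      moreover have "card (desc p c) < card (desc p r)"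
        by (rule psubset_card_mono[OF desc_finite[OF assms] desc_child_psub[OF assms c(1)]])
      ultimately show "\<exists>r'\<in>C. p r' = Some r \<and> st_on E C r' p" using c less by auto
    qed
  qed simp
qed

lemma STT_imp_valid: assumes "STT p" shows "valid_st V E p"
proof -
  obtain r where r: "r \<in> V" "p r = None" "V \<subseteq> desc p r" using root_exists assms by blast
  then have "desc p r = V" using desc_sub[OF assms] by blast
  then show ?thesis unfolding valid_st_def
    using STT_st_on[OF assms, of r] r STT_V[OF assms] by (metis not_Some_eq)
qed

end

section \<open>Graph-theoretic trees as rooted trees\<close>

lemma relpowp_Least_step:
  assumes "R\<^sup>*\<^sup>* v r" "v \<noteq> r"
  defines "d \<equiv> \<lambda>x. LEAST n. (R ^^ n) x r"
  shows "\<exists>u. R v u \<and> d v = Suc (d u)"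
proof -
  obtain n where "(R ^^ n) v r" using assms(1) rtranclp_imp_relpowp by fast
  then have dv: "(R ^^ d v) v r" unfolding d_def by (rule LeastI)
  then obtain m where m: "d v = Suc m" using assms(2) by (cases "d v") auto
  with dv have "(R ^^ Suc m) v r" by simp
  then obtain u where u: "R v u" "(R ^^ m) u r" by (rule relpowp_Suc_E2)
  have "d u \<le> m" unfolding d_def using u(2) by (rule Least_le)
  moreover have "(R ^^ d u) u r" unfolding d_def using u(2) by (rule LeastI)
  then have "(R ^^ Suc (d u)) v r" using u(1) by (intro relpowp_Suc_I2)
  then have "(LEAST n. (R ^^ n) v r) \<le> Suc (d u)" by (rule Least_le)
  then have "d v \<le> Suc (d u)" by (simp add: d_def)
  ultimately show ?thesis using m u by auto
qed

lemma is_tree_cgraph: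
  assumes "is_tree V E" shows "cgraph V E"
  using assms unfolding is_tree_def conn_def reach_def
  by unfold_locales (auto simp: conn_def reach_def)

text \<open>Shortest-path parents give \<open>card V - 1\<close> distinct edges, as many as the
  graph has, so there are no others. The rooted graph is then itself a search tree, and acyclicity
  arguments become statements about \<open>g\<close>.\<close>

lemma is_tree_parent:
  assumes T: "is_tree V E"
  shows "\<exists>g. sgraph.STT V E g \<and> (\<forall>a b. E a b \<longrightarrow> g a = Some b \<or> g b = Some a) \<and>
    (\<forall>a b. g a = Some b \<longrightarrow> E a b)"
proof -
  interpret cgraph V E using is_tree_cgraph[OF T] .
  obtain r where r: "r \<in> V" using ne by blast
  define d where "d = (\<lambda>x. LEAST n. ((\<lambda>a b. a \<in> V \<and> b \<in> V \<and> E a b) ^^ n) x r)"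
  have "\<exists>u\<in>V. E v u \<and> d v = Suc (d u)" if "v \<in> V - {r}" for v
    using relpowp_Least_step[of "\<lambda>a b. a \<in> V \<and> b \<in> V \<and> E a b" v r] that conV r
    unfolding d_def conn_def reach_def by blast
  then obtain par where par: "\<And>v. v \<in> V - {r} \<Longrightarrow> par v \<in> V \<and> E v (par v) \<and> d v = Suc (d (par v))"
    by metis
  let ?Es = "{{u, v} | u v. E u v}"
  let ?f = "\<lambda>v. {v, par v}"
  have finE: "finite ?Es" by (rule finite_subset[of _ "Pow V"]) (use EV fin in auto)
  have inj: "inj_on ?f (V - {r})"
  proof (rule inj_onI)
    fix v w assume vw: "v \<in> V - {r}" "w \<in> V - {r}" "{v, par v} = {w, par w}"
    show "v = w"
    proof (rule ccontr)
      assume "v \<noteq> w"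
      then have "v = par w" "w = par v" using vw(3) by (auto simp: doubleton_eq_iff)
      then have "d v = Suc (d w)" "d w = Suc (d v)" using par vw(1,2) by metis+
      then show False by simp
    qed
  qed
  have sub: "?f ` (V - {r}) \<subseteq> ?Es" using par by blast
  have "card ?Es = card V - 1" using T unfolding is_tree_def by blast
  then have "card (?f ` (V - {r})) = card ?Es" using card_image[OF inj] r fin by simp
  then have eq: "?f ` (V - {r}) = ?Es" using card_subset_eq[OF finE sub] by simp
  define g where "g v = (if v \<in> V - {r} then Some (par v) else None)" for v
  have g1: "g a = Some b \<or> g b = Some a" if "E a b" for a b
  proof -
    have "{a, b} \<in> ?f ` (V - {r})" unfolding eq using that by blast
    then obtain v where "v \<in> V - {r}" "{a, b} = {v, par v}" by (rule imageE)
    then show ?thesis unfolding g_def by (auto simp: doubleton_eq_iff)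
  qed
  have g2: "E a b" if "g a = Some b" for a b using that par by (auto simp: g_def split: if_splits)
  have "heap g d" unfolding heap_def g_def using par by auto
  then have "STT g" unfolding STT_def using g1 g2 EV desc_refl desc_parent by (metis)
  with g1 g2 show ?thesis by blast
qed

locale tgraph = cgraph +
  fixes g :: "nat \<Rightarrow> nat option"
  assumes gS: "STT g" and gE: "E a b \<Longrightarrow> g a = Some b \<or> g b = Some a"
    and Eg: "g a = Some b \<Longrightarrow> E a b"
begin

lemma g_cross:
  assumes "E a b" "a \<in> desc g w" "b \<notin> desc g w"
  shows "a = w \<and> g w = Some b"
proof -
  have "g a = Some b" using gE[OF assms(1)] assms desc_parent desc_trans by metis
  then show ?thesis using desc_up[OF assms(2)] assms(3) by auto
qed

lemma unique_nbr:
  assumes "conn E S" "b \<notin> S" "s \<in> S" "t \<in> S" "E s b" "E t b"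
  shows "s = t"
proof -
  have *: "x = y" if x: "x \<in> S" "y \<in> S" "E x b" "E y b" "g x = Some b" for x y
  proof (rule ccontr)
    assume "x \<noteq> y"
    have "b \<notin> desc g x" using STT_parent_notin[OF gS x(5)] .
    then have "y \<notin> desc g x" using g_cross[of y b x] x \<open>x \<noteq> y\<close> by blast
    moreover have "reach E S x y" using assms(1) x conn_def by auto
    ultimately obtain a c where "a \<in> S" "c \<in> S" "a \<in> desc g x" "c \<notin> desc g x" "E a c"
      using reach_cross[of E S x y "desc g x"] by auto
    then show False using g_cross[of a c x] x(5) assms(2) by auto
  qed
  show ?thesis
  proof (rule ccontr)
    assume "s \<noteq> t"
    then have "g b = Some s" "g b = Some t" using *[of s t] *[of t s] assms(3-6) gE by metis+
    with \<open>s \<noteq> t\<close> show False by simp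
  qed
qed

text \<open>Centroid argument in abstract form. Take the lowest \<open>c\<close> of \<open>S\<close>
  in the rooted graph for which \<open>S - desc g c\<close> is not bad. A bad component below
  \<open>c\<close> would sit under a child \<open>w\<close>, making \<open>S - desc g w\<close> not
  bad and \<open>w\<close> a lower choice; any other component is contained in
  \<open>S - desc g c\<close>.\<close>

lemma balanced_vertex:
  assumes S: "conn E S" "S \<subseteq> V" "S \<noteq> {}"
    and mono: "\<And>X Y. X \<subseteq> Y \<Longrightarrow> Y \<subseteq> S \<Longrightarrow> bad X \<Longrightarrow> bad Y"
    and disj: "\<And>X Y. X \<subseteq> S \<Longrightarrow> Y \<subseteq> S \<Longrightarrow> X \<inter> Y = {} \<Longrightarrow> bad X \<Longrightarrow> bad Y \<Longrightarrow> False"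
  shows "\<exists>c\<in>S. \<forall>u\<in>S - {c}. \<not> bad (comp E (S - {c}) u)"
proof -
  obtain \<rho> where \<rho>: "heap g \<rho>" using gS STT_def by blast
  have finS: "finite S" using S fin finite_subset by blast
  let ?G = "{c\<in>S. \<not> bad (S - desc g c)}"
  have "S - desc g (top g S) = {}" using top[OF gS S] by blast
  then have "\<not> bad (S - desc g (top g S))" using disj[of "{}" "{}"] by (metis Int_empty_left empty_subsetI)
  then have "top g S \<in> ?G" using top(1)[OF gS S] by blast
  then obtain c where c: "c \<in> ?G" "\<And>w. w \<in> ?G \<Longrightarrow> Max (\<rho> ` S) - \<rho> c \<le> Max (\<rho> ` S) - \<rho> w"
    using finite_min_exists[of ?G "top g S" "\<lambda>w. Max (\<rho> ` S) - \<rho> w"] finS by auto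
  have le: "\<rho> w \<le> \<rho> c" if "w \<in> ?G" for w
  proof -
    have "\<rho> w \<le> Max (\<rho> ` S)" using finS that by auto
    with c(2)[OF that] show ?thesis by linarith
  qed
  have "\<not> bad (comp E (S - {c}) u)" if u: "u \<in> S - {c}" for u
  proof
    let ?C = "comp E (S - {c}) u"
    assume bad: "bad ?C"
    have CS: "?C \<subseteq> S - {c}" by (rule comp_subset[OF u])
    show False
    proof (cases "u \<in> desc g c")
      case True
      then obtain w where w: "g w = Some c" "u \<in> desc g w" using desc_child u by blast
      have cw: "c \<notin> desc g w" using STT_parent_notin[OF gS w(1)] .
      have "?C \<subseteq> desc g w"
      proof
        fix x assume "x \<in> ?C"
        then have "reach E (S - {c}) u x" by (simp add: comp_reach)
        then show "x \<in> desc g w"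
          by (rule reach_closed) (use w g_cross in force)+
      qed
      moreover have "w \<in> S"
      proof -
        have "reach E S u c" using S(1) u c(1) conn_def by auto
        then obtain a b where "a \<in> S" "a \<in> desc g w" "b \<notin> desc g w" "E a b"
          using reach_cross[of E S u c "desc g w"] w cw by auto
        then show ?thesis using g_cross by blast
      qed
      ultimately have "bad (S \<inter> desc g w)" using mono[of ?C "S \<inter> desc g w"] CS bad by blast
      then have "\<not> bad (S - desc g w)" using disj[of "S \<inter> desc g w" "S - desc g w"] by blast
      then have "\<rho> w \<le> \<rho> c" using le \<open>w \<in> S\<close> by blast
      then show False using heapD[OF \<rho> w(1)] by simp
    next
      case False
      have "?C \<inter> desc g c = {}"
      proof -
        have "x \<in> - desc g c" if "x \<in> ?C" for x
        proof -
          have "reach E (S - {c}) u x" using that by (simp add: comp_reach)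
          then show ?thesis
            by (rule reach_closed) (use False g_cross[of _ _ c] Esym in blast)+
        qed
        then show ?thesis by blast
      qed
      then have "bad (S - desc g c)" using mono[of ?C "S - desc g c"] CS bad by blast
      then show False using c(1) by blast
    qed
  qed
  then show ?thesis using c by blast
qed

end

section \<open>Steiner-closed reference trees\<close>

text \<open>The hypothesis of \<open>rank_tree_exists\<close>, relative to a vertex set so that
  rankings of components can be combined.\<close>

definition ranking :: "(nat \<Rightarrow> nat \<Rightarrow> bool) \<Rightarrow> nat set \<Rightarrow> (nat \<Rightarrow> nat) \<Rightarrow> bool" where
  "ranking E S \<delta> \<longleftrightarrow> (\<forall>C u w. conn E C \<longrightarrow> C \<subseteq> S \<longrightarrow> u \<in> C \<longrightarrow> w \<in> C \<longrightarrow>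
     (\<forall>x\<in>C. \<delta> u \<le> \<delta> x) \<longrightarrow> (\<forall>x\<in>C. \<delta> w \<le> \<delta> x) \<longrightarrow> u = w)"

context tgraph
begin

lemma bd_finite: "finite (bd E X)"
  by (rule finite_subset[OF _ fin]) (auto simp: bd_def EV)

text \<open>Removing \<open>r\<close> can add one neighbour to a component, so a component may keep
  at most one neighbour of \<open>S\<close>. If \<open>S\<close> has at most one neighbour, a
  centroid achieves this and halves the size. If \<open>S\<close> has two, separating them may
  conflict with halving; a component of more than half the size is then tolerated when it touches
  neither, and \<open>r\<close> is its only possible neighbour.\<close>

lemma steiner_vertex:
  assumes S: "conn E S" "S \<subseteq> V" "S \<noteq> {}" "card (bd E S) \<le> 2"
  shows "\<exists>r\<in>S. \<forall>u\<in>S - {r}. let C = comp E (S - {r}) u in card (bd E C) \<le> 2 \<and>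
    (2 * card C \<le> card S \<or> card (bd E C) \<le> 1 \<and> 1 < card (bd E S))"
proof -
  define N where "N X = {b\<in>bd E S. \<exists>s\<in>X. E s b}" for X
  \<comment> \<open>Designed so that two disjoint bad sets would need more than
    \<open>card S\<close> vertices or at least three neighbours of \<open>S\<close>, each of which
    touches only one of the two sets.\<close>
  define bad where "bad X \<longleftrightarrow> 2 \<le> card (N X) \<or> card S < 2 * card X \<and> (card (bd E S) \<le> 1 \<or> N X \<noteq> {})" for X
  have finS: "finite S" using S fin finite_subset by blast
  have Nfin: "finite (N X)" for X using bd_finite[of S] by (simp add: N_def)
  have mono: "bad Y" if "X \<subseteq> Y" "Y \<subseteq> S" "bad X" for X Y
  proof -
    have sub: "N X \<subseteq> N Y" using that(1) by (auto simp: N_def)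
    then have "card (N X) \<le> card (N Y)" using Nfin card_mono by blast
    moreover have "card X \<le> card Y" using that finS finite_subset card_mono by metis
    ultimately show ?thesis using that(3) sub unfolding bad_def by auto
  qed
  have disj: False if XY: "X \<subseteq> S" "Y \<subseteq> S" "X \<inter> Y = {}" "bad X" "bad Y" for X Y
  proof -
    have "N X \<inter> N Y = {}"
    proof (rule equals0I)
      fix b assume "b \<in> N X \<inter> N Y"
      then obtain s t where st: "s \<in> X" "E s b" "t \<in> Y" "E t b" "b \<notin> S" by (auto simp: N_def bd_def)
      then have "s = t" using unique_nbr[OF S(1), of b s t] XY by blast
      then show False using st XY by blast
    qed
    then have "card (N X) + card (N Y) = card (N X \<union> N Y)" using Nfin by (simp add: card_Un_disjoint)
    also have "\<dots> \<le> card (bd E S)" by (rule card_mono[OF bd_finite]) (auto simp: N_def)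
    finally have n: "card (N X) + card (N Y) \<le> card (bd E S)" .
    have "card X + card Y = card (X \<union> Y)"
      using XY finS by (metis card_Un_disjoint finite_subset)
    also have "\<dots> \<le> card S" using XY finS by (intro card_mono) auto
    finally have c: "card X + card Y \<le> card S" .
    have "N X = {} \<longleftrightarrow> card (N X) = 0" "N Y = {} \<longleftrightarrow> card (N Y) = 0" using Nfin by simp_all
    then show False using n c S(4) XY(4,5) unfolding bad_def by linarith
  qed
  have "\<exists>c\<in>S. \<forall>u\<in>S - {c}. \<not> bad (comp E (S - {c}) u)"
    by (rule balanced_vertex[OF S(1-3)]) (fact mono, fact disj)
  then obtain r where r: "r \<in> S" "\<And>u. u \<in> S - {r} \<Longrightarrow> \<not> bad (comp E (S - {r}) u)"
    by blast
  have "card (bd E C) \<le> 2 \<and> (2 * card C \<le> card S \<or> card (bd E C) \<le> 1 \<and> 1 < card (bd E S))"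
    if u: "u \<in> S - {r}" and C: "C = comp E (S - {r}) u" for u C
  proof -
    have "bd E C \<subseteq> insert r (N C)"
    proof
      fix b assume "b \<in> bd E C"
      then obtain a where a: "b \<notin> C" "a \<in> C" "E a b" by (auto simp: bd_def)
      have "b \<notin> S - {r}" using comp_closed[OF u, of a b] a C by blast
      moreover have "a \<in> S" using a C comp_subset[OF u] by blast
      ultimately show "b \<in> insert r (N C)" using a by (auto simp: N_def bd_def)
    qed
    then have "card (bd E C) \<le> card (insert r (N C))" using Nfin by (intro card_mono) auto
    also have "\<dots> \<le> Suc (card (N C))" by (simp add: card_insert_if Nfin)
    finally have le: "card (bd E C) \<le> Suc (card (N C))" .
    have nb: "\<not> bad C" using r u C by blast
    have "card (N C) = 0 \<longleftrightarrow> N C = {}" using Nfin by simp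
    with nb le show ?thesis unfolding bad_def by linarith
  qed
  then show ?thesis using r(1) unfolding Let_def by blast
qed

text \<open>The rank is the depth of the recursion. Each step halves the set or lowers its number of
  neighbours from two to at most one; hence two ranks per power of two, and one more for a set with
  two neighbours.\<close>

lemma steiner_ranking:
  assumes "conn E S" "S \<subseteq> V" "S \<noteq> {}" "card (bd E S) \<le> 2" "card S < 2 ^ j"
  shows "\<exists>\<delta>. ranking E S \<delta> \<and> (\<forall>v\<in>S. \<delta> v < 2 * j + (if card (bd E S) \<le> 1 then 0 else 1) \<and>
    card (bd E (comp E {w\<in>S. \<delta> v \<le> \<delta> w} v)) \<le> 2)"
  using assms
proof (induction "card S" arbitrary: S j rule: less_induct)
  case less
  note S = less.prems
  have finS: "finite S" using S(2) fin finite_subset by blast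
  define B where "B = 2 * j + (if card (bd E S) \<le> 1 then 0 else 1)"
  obtain r where r: "r \<in> S" "\<And>u. u \<in> S - {r} \<Longrightarrow> card (bd E (comp E (S - {r}) u)) \<le> 2 \<and>
    (2 * card (comp E (S - {r}) u) \<le> card S \<or> card (bd E (comp E (S - {r}) u)) \<le> 1 \<and> 1 < card (bd E S))"
    using steiner_vertex[OF S(1-4)] unfolding Let_def by blast
  let ?K = "\<lambda>v. comp E (S - {r}) v"
  have "\<exists>\<delta>. ranking E C \<delta> \<and> (\<forall>v\<in>C. Suc (\<delta> v) < B \<and>
      card (bd E (comp E {w\<in>C. \<delta> v \<le> \<delta> w} v)) \<le> 2)"
    if u: "u \<in> S - {r}" and C: "C = ?K u" for u C
  proof -
    have CS: "C \<subseteq> S - {r}" using comp_subset[OF u] C by simp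
    then have lt: "card C < card S" using r(1) finS by (intro psubset_card_mono) auto
    have Cc: "conn E C" "C \<subseteq> V" "C \<noteq> {}" "card (bd E C) \<le> 2"
      using comp_conn[OF u] CS S(2) C r(2)[OF u] comp_refl by blast+
    consider "2 * card C \<le> card S" | "card (bd E C) \<le> 1" "1 < card (bd E S)"
      using r(2)[OF u] C by blast
    then show ?thesis
    proof cases
      case 1
      have "j \<noteq> 0" using S(5) r(1) finS by (cases j) auto
      then obtain i where i: "j = Suc i" by (cases j) auto
      then have "card C < 2 ^ i" using 1 S(5) by simp
      from less.hyps[OF lt Cc this] obtain \<delta> where \<delta>: "ranking E C \<delta>"
        "\<And>v. v \<in> C \<Longrightarrow> \<delta> v < 2 * i + (if card (bd E C) \<le> 1 then 0 else 1)"
        "\<And>v. v \<in> C \<Longrightarrow> card (bd E (comp E {w\<in>C. \<delta> v \<le> \<delta> w} v)) \<le> 2" by blast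
      have "Suc (\<delta> v) < B" if "v \<in> C" for v
        using \<delta>(2)[OF that] i by (auto simp: B_def split: if_splits)
      then show ?thesis using \<delta> by blast
    next
      case 2
      have "card C < 2 ^ j" using lt S(5) by simp
      from less.hyps[OF lt Cc this] obtain \<delta> where \<delta>: "ranking E C \<delta>"
        "\<And>v. v \<in> C \<Longrightarrow> \<delta> v < 2 * j + (if card (bd E C) \<le> 1 then 0 else 1)"
        "\<And>v. v \<in> C \<Longrightarrow> card (bd E (comp E {w\<in>C. \<delta> v \<le> \<delta> w} v)) \<le> 2" by blast
      have "Suc (\<delta> v) < B" if "v \<in> C" for v
        using \<delta>(2)[OF that] 2 by (auto simp: B_def)
      then show ?thesis using \<delta> by blast
    qed
  qed
  note ex = this
  define Q where "Q C \<delta> \<longleftrightarrow> ranking E C \<delta> \<and> (\<forall>v\<in>C. Suc (\<delta> v) < B \<and>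
      card (bd E (comp E {w\<in>C. \<delta> v \<le> \<delta> w} v)) \<le> 2)" for C \<delta>
  define \<delta>0 where "\<delta>0 u = (SOME \<delta>. Q (?K u) \<delta>)" for u
  have \<delta>0: "ranking E (?K u) (\<delta>0 u) \<and> (\<forall>v\<in>?K u. Suc (\<delta>0 u v) < B \<and>
      card (bd E (comp E {w\<in>?K u. \<delta>0 u v \<le> \<delta>0 u w} v)) \<le> 2)" if "u \<in> S - {r}" for u
  proof -
    have "\<exists>\<delta>. Q (?K u) \<delta>" using ex[OF that refl] unfolding Q_def .
    then have "Q (?K u) (\<delta>0 u)" unfolding \<delta>0_def by (rule someI_ex)
    then show ?thesis by (simp add: Q_def)
  qed
  define rep where "rep v = (SOME u. u \<in> ?K v)" for v
  have rep: "rep v \<in> S - {r}" "?K (rep v) = ?K v" if "v \<in> S - {r}" for v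
  proof -
    have "rep v \<in> ?K v" unfolding rep_def by (rule someI[of _ v]) simp
    then show "rep v \<in> S - {r}" "?K (rep v) = ?K v" using comp_subset[OF that] comp_eq by blast+
  qed
  have rep_eq: "rep w = rep v" if "w \<in> ?K v" for v w
    using comp_eq[OF that] by (simp add: rep_def)
  define \<delta> where "\<delta> v = (if v = r then 0 else Suc (\<delta>0 (rep v) v))" for v
  have \<delta>K: "\<delta> w = Suc (\<delta>0 (rep v) w)" if "v \<in> S - {r}" "w \<in> ?K v" for v w
    using that rep_eq[OF that(2)] comp_subset[OF that(1)] by (auto simp: \<delta>_def)
  have "ranking E S \<delta>" unfolding ranking_def
  proof (intro allI impI)
    fix C u w
    assume C: "conn E C" "C \<subseteq> S" "u \<in> C" "w \<in> C" "\<forall>x\<in>C. \<delta> u \<le> \<delta> x" "\<forall>x\<in>C. \<delta> w \<le> \<delta> x"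
    show "u = w"
    proof (cases "r \<in> C")
      case True
      then have "\<delta> u \<le> \<delta> r" "\<delta> w \<le> \<delta> r" using C(5,6) by blast+
      then have "\<delta> u = 0" "\<delta> w = 0" by (auto simp: \<delta>_def)
      then show ?thesis by (auto simp: \<delta>_def split: if_splits)
    next
      case False
      then have CK: "u \<in> S - {r}" "C \<subseteq> ?K u" using C conn_sub_comp[OF C(1), of "S - {r}" u] by auto
      have "ranking E (?K u) (\<delta>0 (rep u))" using \<delta>0[OF rep(1)[OF CK(1)]] rep(2)[OF CK(1)] by simp
      moreover have "\<forall>x\<in>C. \<delta>0 (rep u) u \<le> \<delta>0 (rep u) x" "\<forall>x\<in>C. \<delta>0 (rep u) w \<le> \<delta>0 (rep u) x"
        using C CK \<delta>K[OF CK(1)] by (metis Suc_le_mono subsetD)+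
      ultimately show ?thesis using C CK unfolding ranking_def by blast
    qed
  qed
  moreover have "\<delta> v < B \<and> card (bd E (comp E {w\<in>S. \<delta> v \<le> \<delta> w} v)) \<le> 2" if v: "v \<in> S" for v
  proof (cases "v = r")
    case True
    have "{w\<in>S. \<delta> v \<le> \<delta> w} = S" using True by (simp add: \<delta>_def)
    moreover have "comp E S v = S" using conn_sub_comp[OF S(1), of S v] comp_subset[OF v] v by blast
    moreover have "0 < B" using S(5) r(1) finS by (cases j) (auto simp: B_def)
    ultimately show ?thesis using S(4) True by (simp add: \<delta>_def)
  next
    case False
    then have v': "v \<in> S - {r}" using v by blast
    let ?d = "\<delta>0 (rep v)"
    have K: "\<forall>x\<in>?K v. Suc (?d x) < B \<and> card (bd E (comp E {w\<in>?K v. ?d x \<le> ?d w} x)) \<le> 2"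
      using \<delta>0[OF rep(1)[OF v']] rep(2)[OF v'] by simp
    have KS: "?K v \<subseteq> S - {r}" using comp_subset[OF v'] .
    have "comp E {w\<in>S. \<delta> v \<le> \<delta> w} v = comp E {w\<in>?K v. ?d v \<le> ?d w} v"
    proof
      have sub: "comp E {w\<in>S. \<delta> v \<le> \<delta> w} v \<subseteq> {w\<in>S. \<delta> v \<le> \<delta> w}" by (rule comp_subset) (use v in simp)
      have cc: "conn E (comp E {w\<in>S. \<delta> v \<le> \<delta> w} v)" by (rule comp_conn) (use v in simp)
      have "{w\<in>S. \<delta> v \<le> \<delta> w} \<subseteq> S - {r}" using False by (auto simp: \<delta>_def)
      with sub have "comp E {w\<in>S. \<delta> v \<le> \<delta> w} v \<subseteq> S - {r}" by blast
      then have "comp E {w\<in>S. \<delta> v \<le> \<delta> w} v \<subseteq> ?K v" by (intro conn_sub_comp cc comp_refl)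
      then have "comp E {w\<in>S. \<delta> v \<le> \<delta> w} v \<subseteq> {w\<in>?K v. ?d v \<le> ?d w}"
        using sub \<delta>K[OF v'] by fastforce
      then show "comp E {w\<in>S. \<delta> v \<le> \<delta> w} v \<subseteq> comp E {w\<in>?K v. ?d v \<le> ?d w} v"
        by (intro conn_sub_comp cc) auto
      have sub2: "comp E {w\<in>?K v. ?d v \<le> ?d w} v \<subseteq> {w\<in>?K v. ?d v \<le> ?d w}" by (rule comp_subset) simp
      have cc2: "conn E (comp E {w\<in>?K v. ?d v \<le> ?d w} v)" by (rule comp_conn) simp
      have "{w\<in>?K v. ?d v \<le> ?d w} \<subseteq> {w\<in>S. \<delta> v \<le> \<delta> w}"
        using KS \<delta>K[OF v'] by auto
      then show "comp E {w\<in>?K v. ?d v \<le> ?d w} v \<subseteq> comp E {w\<in>S. \<delta> v \<le> \<delta> w} v"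
        using sub2 by (intro conn_sub_comp cc2) auto
    qed
    then show ?thesis using K \<delta>K[OF v', of v] by simp
  qed
  ultimately show ?case unfolding B_def by blast
qed

text \<open>The reference tree: of logarithmic depth, and every subtree has at most two
  neighbours, so that the vertex set of each root-to-leaf path is closed under
  taking branching points.\<close>
lemma reference_tree_exists:
  assumes "card V < 2 ^ j"
  obtains P dep where "STT P" "\<And>v u. P v = Some u \<Longrightarrow> dep v = Suc (dep u)"
    "\<And>v. v \<in> V \<Longrightarrow> P v = None \<Longrightarrow> dep v = 0"
    "\<And>v. v \<in> V \<Longrightarrow> dep v < 2 * j" "\<And>v. v \<in> V \<Longrightarrow> card (bd E (desc P v)) \<le> 2"
proof -
  have "bd E V = {}" using EV by (auto simp: bd_def)
  then obtain \<delta> where \<delta>: "ranking E V \<delta>" "\<And>v. v \<in> V \<Longrightarrow> \<delta> v < 2 * j"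
    "\<And>v. v \<in> V \<Longrightarrow> card (bd E (comp E {w\<in>V. \<delta> v \<le> \<delta> w} v)) \<le> 2"
    using steiner_ranking[OF conV subset_refl ne _ assms] by auto
  obtain P where P: "STT P" "heap P \<delta>"
  proof (rule rank_tree_exists[of \<delta>])
    fix C u w assume "conn E C" "C \<subseteq> V" "u \<in> C" "w \<in> C" "\<forall>x\<in>C. \<delta> u \<le> \<delta> x" "\<forall>x\<in>C. \<delta> w \<le> \<delta> x"
    then show "u = w" using \<delta>(1) unfolding ranking_def by blast
  qed
  define dep where "dep v = card (anc P v) - 1" for v
  have anc_pos: "0 < card (anc P v)" for v
    using anc_finite[OF P(1), of v] desc_refl[of v P] unfolding card_gt_0_iff anc_def by blast
  have "dep v = Suc (dep u)" if "P v = Some u" for v u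
    unfolding dep_def using anc_parent(3)[OF P(1) that] anc_pos[of u] by simp
  moreover have "dep v = 0" if "v \<in> V" "P v = None" for v
  proof -
    have "anc P v \<subseteq> {v}" using desc_up that by (fastforce simp: anc_def)
    then have "card (anc P v) \<le> 1" using card_mono[of "{v}"] by simp
    then show ?thesis by (simp add: dep_def)
  qed
  moreover have "dep v < 2 * j" if "v \<in> V" for v
  proof -
    \<comment> \<open>Ranks strictly increase along a root path but may skip values, so the depth is
      bounded by counting distinct ranks.\<close>
    have "inj_on \<delta> (anc P v)"
    proof (rule inj_onI)
      fix x y assume xy: "x \<in> anc P v" "y \<in> anc P v" "\<delta> x = \<delta> y"
      then have "x \<in> desc P y \<or> y \<in> desc P x" using desc_comparable[of v P x y] by (auto simp: anc_def)
      then show "x = y" using heap_desc[OF _ P(2), of x y] heap_desc[OF _ P(2), of y x] xy(3) by force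
    qed
    moreover have "\<delta> ` anc P v \<subseteq> {..<2 * j}" using \<delta>(2) anc_sub[OF P(1) that] by auto
    ultimately have "card (anc P v) \<le> card {..<2 * j}" by (intro card_inj_on_le) auto
    then have "card (anc P v) \<le> 2 * j" by simp
    then show ?thesis using anc_pos[of v] by (simp add: dep_def)
  qed
  moreover have "card (bd E (desc P v)) \<le> 2" if "v \<in> V" for v
    using \<delta>(3)[OF that] desc_eq_comp[OF P that] by simp
  ultimately show ?thesis using that P(1) by blast
qed

end

section \<open>The lower bound\<close>

text \<open>\<open>2 ^ k\<close> bounds a depth that is itself logarithmic, so \<open>k\<close> is
  the doubly logarithmic quantity of the final bound.\<close>

locale reftree = cgraph +
  fixes P :: "nat \<Rightarrow> nat option" and dep :: "nat \<Rightarrow> nat" and k :: nat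
  assumes PS: "STT P" and dep_Suc: "P v = Some u \<Longrightarrow> dep v = Suc (dep u)"
    and dep_less: "v \<in> V \<Longrightarrow> dep v < 2 ^ k"
    and bd2: "v \<in> V \<Longrightarrow> card (bd E (desc P v)) \<le> 2"
begin

definition ch :: "nat \<Rightarrow> nat \<Rightarrow> nat" where
  "ch v x = (THE c. P c = Some v \<and> x \<in> desc P c)"

lemma child_unique:
  assumes "P c = Some v" "P c' = Some v" "x \<in> desc P c" "x \<in> desc P c'"
  shows "c = c'"
proof -
  have *: "a = b" if "P a = Some v" "P b = Some v" "a \<in> desc P b" for a b
    using that desc_up[of a P b] STT_parent_notin[OF PS that(2)] by auto
  show ?thesis using desc_comparable[OF assms(3,4)] *[of c c'] *[of c' c] assms(1,2) by metis
qed

lemma ch: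
  assumes "x \<in> desc P v" "x \<noteq> v"
  shows "P (ch v x) = Some v" "x \<in> desc P (ch v x)"
proof -
  obtain c where c: "P c = Some v" "x \<in> desc P c" using desc_child assms by metis
  have "ch v x = c" unfolding ch_def by (rule the_equality) (use c child_unique in blast)+
  with c show "P (ch v x) = Some v" "x \<in> desc P (ch v x)" by auto
qed

lemma ch_eq: "P c = Some v \<Longrightarrow> x \<in> desc P c \<Longrightarrow> ch v x = c"
  unfolding ch_def by (rule the_equality) (use child_unique in blast)+

lemma desc_child_subset: "P c = Some v \<Longrightarrow> desc P c \<subseteq> desc P v"
  using desc_child_psub[OF PS] by blast

lemma desc_mono: "u \<in> desc P v \<Longrightarrow> desc P u \<subseteq> desc P v"
  using desc_trans by blast

definition upd :: "(nat \<Rightarrow> nat option) \<Rightarrow> nat \<Rightarrow> nat \<Rightarrow> nat option" where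
  "upd pref x = (\<lambda>v. if x \<in> desc P v \<and> x \<noteq> v then Some (ch v x) else pref v)"

definition changes :: "(nat \<Rightarrow> nat option) \<Rightarrow> nat \<Rightarrow> nat set" where
  "changes pref x = {v\<in>V. x \<in> desc P v \<and> x \<noteq> v \<and> pref v \<noteq> Some (ch v x)}"

text \<open>A change of preferred child that costs \<open>T\<close> no separate node puts its vertex
  into this set; leaving the set again has to be paid for by the depth of a search or by a
  rotation.\<close>

definition hi :: "(nat \<Rightarrow> nat option) \<Rightarrow> (nat \<Rightarrow> nat option) \<Rightarrow> nat set" where
  "hi T pref = {v\<in>V. \<exists>d. P d = Some v \<and> pref v = Some d \<and> top T (desc P d) = top T (desc P v)}"

lemma changes_finite: "finite (changes pref x)" and hi_finite: "finite (hi T pref)"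
  using fin by (auto simp: changes_def hi_def)

lemma top_desc:
  assumes "STT T" "v \<in> V"
  shows "top T (desc P v) \<in> desc P v" "desc P v \<subseteq> desc T (top T (desc P v))"
  using top[OF assms(1) desc_conn[OF PS] desc_sub[OF PS assms(2)]] desc_refl by blast+

text \<open>Let \<open>N\<close> be the vertices whose top changes when passing to the child towards
  \<open>x\<close>. The tops of these children are distinct \<open>T\<close>-ancestors of
  \<open>x\<close>, which bounds \<open>N\<close>. A changed vertex outside \<open>N\<close> enters
  \<open>hi\<close>, since the common top lies in the new preferred child and so not in the old one;
  only vertices of \<open>N\<close> can leave \<open>hi\<close>. Hence the factor two.\<close>

lemma search_potential:
  assumes T: "STT T" and x: "x \<in> V"
  shows "card (changes pref x) + card (hi T pref) \<le> 2 * card (anc T x) + card (hi T (upd pref x))"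
proof -
  let ?t = "\<lambda>v. top T (desc P v)"
  define N where "N = {v\<in>V. x \<in> desc P v \<and> x \<noteq> v \<and> ?t (ch v x) \<noteq> ?t v}"
  have finN: "finite N" using fin by (simp add: N_def)
  have chV: "ch v x \<in> V" if "x \<in> desc P v" "x \<noteq> v" for v using ch(1)[OF that] STT_V[OF PS] by blast
  \<comment> \<open>The subtree of the lower vertex \<open>v\<close> lies inside that of the child
    of \<open>u\<close> and contains that of its own child. If these two have equal tops, the top of
    \<open>v\<close> coincides with them, against \<open>v \<in> N\<close>.\<close>
  have inj': False if uv: "u \<in> N" "v \<in> N" "?t (ch u x) = ?t (ch v x)" "v \<in> desc P u" "v \<noteq> u" for u v
  proof -
    have u: "x \<in> desc P u" "x \<noteq> u" "?t (ch u x) \<noteq> ?t u" and v: "x \<in> desc P v" "x \<noteq> v"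
      "v \<in> V" "?t (ch v x) \<noteq> ?t v"
      using uv by (auto simp: N_def)
    obtain c where c: "P c = Some u" "v \<in> desc P c" using desc_child[OF uv(4,5)] by blast
    then have "c = ch u x" using ch_eq[of c u x] v(1) desc_trans by blast
    then have sub: "desc P v \<subseteq> desc P (ch u x)" using desc_mono c by blast
    have "?t (ch u x) \<in> desc P v"
      using uv(3) top_desc(1)[OF T chV[OF v(1,2)]] desc_child_subset[OF ch(1)[OF v(1,2)]] by auto
    moreover have "desc P v \<subseteq> desc T (?t (ch u x))" using sub top_desc(2)[OF T chV[OF u(1,2)]] by blast
    ultimately have "?t v = ?t (ch u x)" by (rule top_eqI[OF T])
    then show False using uv(3) v by simp
  qed
  have "inj_on (\<lambda>v. ?t (ch v x)) N"
  proof (rule inj_onI)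
    fix u v assume uv: "u \<in> N" "v \<in> N" "?t (ch u x) = ?t (ch v x)"
    then have "u \<in> desc P v \<or> v \<in> desc P u" using desc_comparable[of x P u v] by (auto simp: N_def)
    then show "u = v" using inj'[OF uv] inj'[OF uv(2,1) uv(3)[symmetric]] by blast
  qed
  moreover have "(\<lambda>v. ?t (ch v x)) ` N \<subseteq> anc T x"
    using ch(2) top_desc(2)[OF T chV] by (auto simp: N_def anc_def)
  ultimately have Nle: "card N \<le> card (anc T x)" using card_inj_on_le anc_finite[OF T] by blast
  have 1: "changes pref x \<subseteq> N \<union> (hi T (upd pref x) - hi T pref)"
  proof
    fix v assume v: "v \<in> changes pref x"
    then have v': "x \<in> desc P v" "x \<noteq> v" "v \<in> V" "pref v \<noteq> Some (ch v x)" by (auto simp: changes_def)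
    show "v \<in> N \<union> (hi T (upd pref x) - hi T pref)"
    proof (cases "v \<in> N")
      case False
      then have t: "?t (ch v x) = ?t v" using v' by (simp add: N_def)
      then have "v \<in> hi T (upd pref x)" using v' ch(1)[OF v'(1,2)] by (simp add: hi_def upd_def)
      moreover have "v \<notin> hi T pref"
      proof
        assume "v \<in> hi T pref"
        then obtain d where d: "P d = Some v" "pref v = Some d" "?t d = ?t v" by (auto simp: hi_def)
        have "?t v \<in> desc P d" using top_desc(1)[OF T, of d] d STT_V[OF PS] by metis
        moreover have "?t v \<in> desc P (ch v x)" using t top_desc(1)[OF T chV[OF v'(1,2)]] by simp
        ultimately have "d = ch v x" using child_unique d(1) ch(1)[OF v'(1,2)] by blast
        then show False using d v' by simp
      qed
      ultimately show ?thesis by blast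
    qed simp
  qed
  have 2: "hi T pref - hi T (upd pref x) \<subseteq> N"
  proof
    fix v assume v: "v \<in> hi T pref - hi T (upd pref x)"
    then have "upd pref x v \<noteq> pref v" by (auto simp: hi_def)
    then have v': "x \<in> desc P v" "x \<noteq> v" "upd pref x v = Some (ch v x)" by (auto simp: upd_def split: if_splits)
    then show "v \<in> N" using v ch(1)[OF v'(1,2)] by (auto simp: hi_def N_def)
  qed
  have "card (changes pref x) \<le> card (N \<union> (hi T (upd pref x) - hi T pref))"
    using 1 finN hi_finite by (intro card_mono) auto
  also have "\<dots> \<le> card N + card (hi T (upd pref x) - hi T pref)" by (rule card_Un_le)
  finally have "card (changes pref x) + card (hi T pref) \<le>
      card N + (card (hi T pref) + card (hi T (upd pref x) - hi T pref))" by simp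
  also have "card (hi T pref) + card (hi T (upd pref x) - hi T pref) =
      card (hi T (upd pref x)) + card (hi T pref - hi T (upd pref x))"
    using hi_finite by (metis Un_Diff_cancel Un_commute add.commute card_Un_disjoint Diff_disjoint finite_Diff)
  also have "card (hi T pref - hi T (upd pref x)) \<le> card N" using 2 finN card_mono by blast
  finally show ?thesis using Nle by simp
qed

text \<open>A vertex leaves \<open>hi\<close> only if \<open>q\<close> lies in its preferred child
  subtree while \<open>v\<close> lies below the vertex but outside that subtree. It is then the
  lowest common ancestor of \<open>q\<close> and \<open>v\<close> in \<open>P\<close>, so there is
  at most one.\<close>

lemma rot_potential:
  assumes T: "STT T" and vq: "T v = Some q"
  shows "card (hi T pref) \<le> Suc (card (hi (rot E T v q) pref))"
proof -
  let ?T = "rot E T v q"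
  let ?D = "hi T pref - hi ?T pref"
  have R: "\<exists>d. P d = Some u \<and> q \<in> desc P d \<and> v \<in> desc P u \<and> v \<notin> desc P d" if u: "u \<in> ?D" for u
  proof -
    obtain d where d: "u \<in> V" "P d = Some u" "pref u = Some d" "top T (desc P d) = top T (desc P u)"
      using u by (auto simp: hi_def)
    then have n: "top ?T (desc P d) \<noteq> top ?T (desc P u)" using u by (auto simp: hi_def)
    have dV: "d \<in> V" using d STT_V[OF PS] by blast
    have tr: "top ?T (desc P w) = (if top T (desc P w) = q \<and> v \<in> desc P w then v else top T (desc P w))"
      if "w \<in> V" for w
      using top_rot[OF T vq desc_conn[OF PS] desc_sub[OF PS that]] desc_refl by blast
    have "v \<notin> desc P d \<and> v \<in> desc P u \<and> top T (desc P d) = q"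
      using n d(4) tr[OF dV] tr[OF d(1)] desc_child_subset[OF d(2)] by (auto split: if_splits)
    then show ?thesis using d(2) top_desc(1)[OF T dV] by auto
  qed
  have *: False if uw: "u \<in> ?D" "w \<in> ?D" "u \<in> desc P w" "u \<noteq> w" for u w
  proof -
    obtain d where d: "P d = Some u" "q \<in> desc P d" "v \<in> desc P u" using R[OF uw(1)] by blast
    obtain e where e: "P e = Some w" "q \<in> desc P e" "v \<notin> desc P e" using R[OF uw(2)] by blast
    obtain c where c: "P c = Some w" "u \<in> desc P c" using desc_child[OF uw(3,4)] by blast
    have "q \<in> desc P c" using d c desc_child_subset desc_trans by blast
    then have "c = e" using child_unique c e by blast
    then show False using c d e desc_trans by blast
  qed
  have "card ?D \<le> 1"
  proof -
    have "u = w" if uw: "u \<in> ?D" "w \<in> ?D" for u w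
    proof -
      have "q \<in> desc P u" "q \<in> desc P w" using R uw desc_child_subset by blast+
      then have "u \<in> desc P w \<or> w \<in> desc P u" using desc_comparable by blast
      then show ?thesis using *[OF uw] *[OF uw(2,1)] by blast
    qed
    then show ?thesis by (metis card_le_Suc0_iff_eq hi_finite finite_Diff One_nat_def)
  qed
  moreover have "card (hi T pref) \<le> card (hi ?T pref \<union> ?D)" using hi_finite by (intro card_mono) auto
  moreover have "card (hi ?T pref \<union> ?D) \<le> card (hi ?T pref) + card ?D" by (rule card_Un_le)
  ultimately show ?thesis by linarith
qed

lemma gst_step_cases:
  assumes "gst_step E (T, c) op = Some s'" "STT T"
  obtains q where "op = ToParent" "T c = Some q" "s' = (T, q)"
  | w where "op = ToChild w" "T w = Some c" "s' = (T, w)"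
  | q where "op = Rotate" "T c = Some q" "s' = (rot E T c q, c)"
  using assms by (cases op) (auto split: option.splits if_splits)

lemma trace_potential:
  assumes "gst_trace E (T, c) ops = Some ss" "STT T"
  shows "STT (fst (last ss)) \<and> card (hi T pref) \<le> card (hi (fst (last ss)) pref) + length ops"
  using assms
proof (induction ops arbitrary: T c ss)
  case (Cons op1 os)
  obtain T1 c1 ss1 where s: "gst_step E (T, c) op1 = Some (T1, c1)"
    "gst_trace E (T1, c1) os = Some ss1" "ss = (T, c) # ss1"
    using Cons.prems(1) by (auto split: option.splits)
  have "ss1 \<noteq> []" using s(2) by (cases os) (auto split: option.splits)
  then have l: "last ss = last ss1" using s by simp
  have "STT T1 \<and> card (hi T pref) \<le> Suc (card (hi T1 pref))"
    using s(1) Cons.prems(2)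
    by (cases rule: gst_step_cases) (use rot_STT rot_potential Cons.prems(2) in auto)
  then show ?case using Cons.IH[OF s(2)] l by auto
qed simp

text \<open>A move changes the depth of the pointer by one; a rotation removes at most one ancestor
  of \<open>x\<close> and never makes the pointer deeper.\<close>

lemma trace_depth:
  assumes "gst_trace E (T, c) ops = Some ss" "STT T" "x \<in> snd ` set ss"
  shows "card (anc T x) \<le> length ops + card (anc T c)"
  using assms
proof (induction ops arbitrary: T c ss)
  case (Cons op1 os)
  obtain T1 c1 ss1 where s: "gst_step E (T, c) op1 = Some (T1, c1)"
    "gst_trace E (T1, c1) os = Some ss1" "ss = (T, c) # ss1"
    using Cons.prems(1) by (auto split: option.splits)
  show ?case
  proof (cases "x = c")
    case False
    then have x: "x \<in> snd ` set ss1" using Cons.prems(3) s(3) by auto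
    from s(1) Cons.prems(2) show ?thesis
    proof (cases rule: gst_step_cases)
      case (1 q)
      then show ?thesis using Cons.IH[OF s(2) _ x] Cons.prems(2) anc_parent(3)[of T c q] by simp
    next
      case (2 w)
      then show ?thesis using Cons.IH[OF s(2) _ x] Cons.prems(2) anc_parent(3)[of T w c] by simp
    next
      case (3 q)
      note r = Cons.prems(2) 3(2)
      have "card (anc T x) \<le> card (insert q (anc (rot E T c q) x))"
        using rot_anc_sup[OF r] anc_finite[OF rot_STT[OF r]] by (intro card_mono) auto
      also have "\<dots> \<le> Suc (card (anc (rot E T c q) x))"
        by (simp add: card_insert_if anc_finite[OF rot_STT[OF r]])
      also have "\<dots> \<le> Suc (length os + card (anc (rot E T c q) c))"
        using Cons.IH[OF s(2) _ x] rot_STT[OF r] 3 by simp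
      also have "card (anc (rot E T c q) c) \<le> card (anc T c)"
        using rot_anc_v[OF r] anc_finite[OF Cons.prems(2)] card_mono by blast
      finally show ?thesis by simp
    qed
  qed simp
qed auto

fun total_changes :: "(nat \<Rightarrow> nat option) \<Rightarrow> nat list \<Rightarrow> nat" where
  "total_changes pref [] = 0"
| "total_changes pref (x # xs) = card (changes pref x) + total_changes (upd pref x) xs"

text \<open>Of the factor three, two come from \<open>search_potential\<close>, as the depth of
  \<open>x\<close> is at most the cost of the search, and one from the rotations. Preferred children
  are updated against the tree before the search; the rotations then act with the updated ones. The
  potential is at most \<open>card V\<close> throughout.\<close>

lemma serves_lower_bound:
  assumes "serves V E T X oss" "STT T" "set X \<subseteq> V"
  shows "total_changes pref X + card (hi T pref) \<le> 3 * gst_cost oss + card V \<and>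
    length X \<le> gst_cost oss"
  using assms
proof (induction X arbitrary: T oss pref)
  case Nil
  have "card (hi T pref) \<le> card V" using fin by (intro card_mono) (auto simp: hi_def)
  then show ?case by simp
next
  case (Cons x xs)
  from Cons.prems(1) obtain os oss' where o: "oss = os # oss'" by (cases oss) auto
  obtain ss where ss: "gst_trace E (T, st_root V T) os = Some ss" "x \<in> snd ` set ss"
    "serves V E (fst (last ss)) xs oss'"
    using Cons.prems(1) o by (auto split: option.splits)
  have x: "x \<in> V" using Cons.prems by simp
  note T' = trace_potential[OF ss(1) Cons.prems(2), of "upd pref x"]
  have "card (anc T x) \<le> Suc (length os)"
    using trace_depth[OF ss(1) Cons.prems(2) ss(2)] anc_root[OF Cons.prems(2)] by simp
  moreover have "card (changes pref x) + card (hi T pref) \<le> 2 * card (anc T x) + card (hi T (upd pref x))"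
    by (rule search_potential[OF Cons.prems(2) x])
  moreover have "total_changes (upd pref x) xs + card (hi (fst (last ss)) (upd pref x)) \<le>
      3 * gst_cost oss' + card V \<and> length xs \<le> gst_cost oss'"
    using Cons.IH[OF ss(3)] T' Cons.prems(3) by auto
  moreover have "gst_cost oss = Suc (length os) + gst_cost oss'" using o by (simp add: gst_cost_def)
  ultimately show ?case using T' by simp
qed

lemma OPT_lower_bound:
  assumes "valid_st V E p" "serves V E p X oss" "set X \<subseteq> V"
  shows "total_changes pref X \<le> 3 * OPT V E X + card V \<and> length X \<le> OPT V E X"
proof -
  let ?S = "{gst_cost oss | p oss. valid_st V E p \<and> serves V E p X oss}"
  \<comment> \<open>An infimum of naturals is attained only over a nonempty set, so some serving
    sequence has to be at hand.\<close>
  have "?S \<noteq> {}" using assms by blast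
  then have "OPT V E X \<in> ?S" unfolding OPT_def by (rule Inf_nat_def1)
  then obtain q oss' where "OPT V E X = gst_cost oss'" "valid_st V E q" "serves V E q X oss'" by blast
  then show ?thesis using serves_lower_bound[of q X oss' pref] valid_imp_STT assms(3) by auto
qed

end

section \<open>Preferred paths and canonical search trees\<close>

text \<open>Binary subdivision: the midpoint of the doubled range gets the coarsest level 0, and
  both halves repeat the old levels shifted by one. Small values are coarse.\<close>

lemma ruler_exists:
  "\<exists>lev :: nat \<Rightarrow> nat. (\<forall>m<2 ^ k. lev m \<le> k) \<and>
     (\<forall>m m'. m < m' \<longrightarrow> m' < 2 ^ k \<longrightarrow> lev m = lev m' \<longrightarrow> (\<exists>i. m < i \<and> i < m' \<and> lev i < lev m))"
proof (induction k)
  case 0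
  show ?case by (intro exI[of _ "\<lambda>_. 0"]) auto
next
  case (Suc k)
  then obtain lev :: "nat \<Rightarrow> nat" where l: "\<And>m. m < 2 ^ k \<Longrightarrow> lev m \<le> k"
    "\<And>m m'. m < m' \<Longrightarrow> m' < 2 ^ k \<Longrightarrow> lev m = lev m' \<Longrightarrow> \<exists>i. m < i \<and> i < m' \<and> lev i < lev m"
    by blast
  define n :: nat where "n = 2 ^ k"
  define f where "f m = (if m < n then Suc (lev m) else if m = n then 0 else Suc (lev (m - n)))" for m
  have fle: "f m \<le> Suc k" if "m < 2 ^ Suc k" for m
    using that l(1)[of m] l(1)[of "m - n"] by (auto simp: f_def n_def)
  have sep: "\<exists>i. m < i \<and> i < m' \<and> f i < f m" if m: "m < m'" "m' < 2 ^ Suc k" "f m = f m'" for m m'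
  proof -
    consider "m' < n" | "m < n" "n < m'" | "n < m" | "m' = n" | "m = n" using m by linarith
    then show ?thesis
    proof cases
      case 1
      then obtain i where "m < i" "i < m'" "lev i < lev m"
        using l(2)[of m m'] m by (auto simp: f_def n_def)
      then show ?thesis using 1 m by (intro exI[of _ i]) (auto simp: f_def)
    next
      case 2
      then show ?thesis by (intro exI[of _ n]) (auto simp: f_def)
    next
      case 3
      then have "m - n < m' - n" "m' - n < 2 ^ k" "lev (m - n) = lev (m' - n)"
        using m by (auto simp: f_def n_def)
      then obtain i where "m - n < i" "i < m' - n" "lev i < lev (m - n)"
        using l(2)[of "m - n" "m' - n"] by blast
      then show ?thesis using 3 m by (intro exI[of _ "i + n"]) (auto simp: f_def)
    qed (use m in \<open>auto simp: f_def split: if_splits\<close>)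
  qed
  show ?case using fle sep by blast
qed

lemma mult_add_less_iff:
  fixes x y v w N :: nat
  assumes "v < N" "w < N"
  shows "x * N + v < y * N + w \<longleftrightarrow> x < y \<or> x = y \<and> v < w"
proof -
  have *: "a * N + v < b * N + w" if "a < b" "v < N" for a b v w :: nat
  proof -
    have "a * N + v < Suc a * N" using that by simp
    also have "\<dots> \<le> b * N" using that by (intro mult_le_mono1) simp
    finally show ?thesis by simp
  qed
  show ?thesis using *[of x y v w] *[of y x w v] assms by (cases x y rule: linorder_cases) auto
qed

locale leveled = reftree +
  fixes lev :: "nat \<Rightarrow> nat"
  assumes lev_le: "m < 2 ^ k \<Longrightarrow> lev m \<le> k"
    and lev_sep: "m < m' \<Longrightarrow> m' < 2 ^ k \<Longrightarrow> lev m = lev m' \<Longrightarrow> \<exists>i. m < i \<and> i < m' \<and> lev i < lev m"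
begin

lemma dep_heap: "heap P dep"
  using dep_Suc by (simp add: heap_def)

lemma dep_desc: "v \<in> desc P u \<Longrightarrow> dep u \<le> dep v"
  by (rule heap_desc_le[OF _ dep_heap])

lemma dep_desc_less: "v \<in> desc P u \<Longrightarrow> v \<noteq> u \<Longrightarrow> dep u < dep v"
  by (rule heap_desc[OF _ dep_heap])

text \<open>Adjacent vertices are comparable in \<open>P\<close>, so a subtree is seen from outside
  only by proper ancestors of its root.\<close>

lemma bd_desc:
  assumes "b \<in> bd E (desc P w)" shows "w \<in> desc P b" "b \<noteq> w" "b \<in> V"
proof -
  obtain a where a: "b \<notin> desc P w" "a \<in> desc P w" "E a b" using assms by (auto simp: bd_def)
  then show "b \<noteq> w" "b \<in> V" using EV by auto
  from STT_comparable[OF PS a(3)] show "w \<in> desc P b"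
    using a desc_comparable[of a P w b] desc_trans by blast
qed

lemma parent_in_bd: "P c = Some z \<Longrightarrow> z \<in> bd E (desc P c)"
  using STT_adj[OF PS] STT_parent_notin[OF PS] unfolding bd_def by blast

text \<open>The counter only makes the recursion terminate; starting it at \<open>dep v\<close>
  suffices because each step to the parent lowers \<open>dep\<close> by one.\<close>

fun headn :: "nat \<Rightarrow> (nat \<Rightarrow> nat option) \<Rightarrow> nat \<Rightarrow> nat" where
  "headn 0 pref v = v"
| "headn (Suc n) pref v = (case P v of None \<Rightarrow> v | Some u \<Rightarrow> if pref u = Some v then headn n pref u else v)"

definition head :: "(nat \<Rightarrow> nat option) \<Rightarrow> nat \<Rightarrow> nat" where
  "head pref v = headn (dep v) pref v"

lemma head_parent: "P v = Some u \<Longrightarrow> pref u = Some v \<Longrightarrow> head pref v = head pref u"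
  using dep_Suc by (simp add: head_def)

lemma head_self: "(\<And>u. P v = Some u \<Longrightarrow> pref u \<noteq> Some v) \<Longrightarrow> head pref v = v"
  unfolding head_def by (cases "dep v") (auto split: option.splits)

lemma head_cases:
  obtains "head pref v = v" "\<And>u. P v = Some u \<Longrightarrow> pref u \<noteq> Some v"
  | u where "P v = Some u" "pref u = Some v" "head pref v = head pref u"
  using head_self head_parent by (metis (no_types))

lemma dep_induct [case_names less]:
  assumes "\<And>v. (\<And>u. dep u < dep v \<Longrightarrow> Q u) \<Longrightarrow> Q v" shows "Q v"
  using assms by (induction "dep v" arbitrary: v rule: less_induct) blast

lemma desc_head: "v \<in> desc P (head pref v)"
proof (induction v rule: dep_induct)
  case (less v)
  then show ?case
    by (cases rule: head_cases[of pref v]) (use dep_Suc desc_parent desc_trans in \<open>auto, fastforce\<close>)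
qed

lemma head_head [simp]: "head pref (head pref v) = head pref v"
proof (induction v rule: dep_induct)
  case (less v)
  then show ?case by (cases rule: head_cases[of pref v]) (use dep_Suc in auto)
qed

lemma head_between: "v \<in> desc P u \<Longrightarrow> u \<in> desc P (head pref v) \<Longrightarrow> head pref u = head pref v"
proof (induction v rule: desc_induct)
  case (step v w)
  show ?case
  proof (cases rule: head_cases[of pref v])
    case 1
    then have "u \<in> desc P v" using step by simp
    then have "v = u" using STT_antisym[OF PS] step(1,2) desc_parent desc_trans by metis
    then show ?thesis by simp
  next
    case (2 u')
    then show ?thesis using step by auto
  qed
qed simp

lemma head_in: "head pref H = H \<Longrightarrow> v \<in> desc P H \<Longrightarrow> head pref v \<in> desc P H"
proof -
  assume a: "head pref H = H" "v \<in> desc P H"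
  then consider "head pref v \<in> desc P H" | "H \<in> desc P (head pref v)"
    using desc_comparable desc_head by blast
  then show ?thesis
  proof cases
    case 2
    then have "head pref H = head pref v" using head_between a by blast
    then show ?thesis using a by simp
  qed
qed

lemma head_V: "v \<in> V \<Longrightarrow> head pref v \<in> V"
  using desc_head[of v pref] anc_sub[OF PS, of v] by (auto simp: anc_def)

lemma anc_head: "z \<in> desc P b \<Longrightarrow> head pref b = head pref z \<or> dep b < dep (head pref z)"
proof -
  assume z: "z \<in> desc P b"
  then consider "b \<in> desc P (head pref z)" | "head pref z \<in> desc P b" "head pref z \<noteq> b"
    using desc_comparable[OF z desc_head[of z pref]] desc_refl by metis
  then show ?thesis using head_between[OF z] dep_desc_less by cases blast+
qed

lemma same_head_desc: "head pref v = head pref w \<Longrightarrow> dep w \<le> dep v \<Longrightarrow> v \<in> desc P w"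
proof (induction v arbitrary: w rule: dep_induct)
  case (less v)
  show ?case
  proof (cases rule: head_cases[of pref v])
    case 1
    then have "w \<in> desc P v" using less.prems desc_head[of w pref] by simp
    then have "w = v" using dep_desc_less less.prems(2) by fastforce
    then show ?thesis by simp
  next
    case (2 u)
    then have du: "dep v = Suc (dep u)" using dep_Suc by simp
    show ?thesis
    proof (cases "dep w \<le> dep u")
      case True
      then have "u \<in> desc P w" using less 2 du by simp
      then show ?thesis using 2 desc_parent desc_trans by metis
    next
      case False
      then have dw: "dep w = dep v" using less.prems(2) du by simp
      show ?thesis
      proof (cases rule: head_cases[of pref w])
        case 1
        then have "u \<in> desc P w" using less.prems(1) 2 desc_head[of u pref] by simp
        then show ?thesis using dep_desc dw du by fastforce
      next
        case w2: (2 u')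
        then have "dep u' = dep u" using dw du dep_Suc by simp
        then have "u \<in> desc P u'" using less.IH[of u u'] less.prems(1) 2 w2 du by simp
        then have "u = u'" using dep_desc_less \<open>dep u' = dep u\<close> by fastforce
        then show ?thesis using 2 w2 by simp
      qed
    qed
  qed
qed

lemma intermediate:
  "v \<in> desc P w \<Longrightarrow> dep w \<le> m \<Longrightarrow> m \<le> dep v \<Longrightarrow> \<exists>y. dep y = m \<and> v \<in> desc P y \<and> y \<in> desc P w"
proof (induction v rule: desc_induct)
  case refl
  then show ?case by (intro exI[of _ w]) auto
next
  case (step v u)
  show ?case
  proof (cases "m = dep v")
    case True
    then show ?thesis using step desc_parent desc_trans by (intro exI[of _ v]) (metis desc_refl)
  next
    case False
    then obtain y where "dep y = m" "u \<in> desc P y" "y \<in> desc P w" using step dep_Suc[OF step(1)] by auto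
    then show ?thesis using step(1) desc_parent desc_trans by metis
  qed
qed

text \<open>This is not the level of the depth of \<open>v\<close> itself. The part of the path
  below some \<open>w\<close> is separated from the rest by removing the neighbours of the subtree
  of \<open>w\<close>, so these inherit the level of \<open>w\<close>, and a vertex takes the
  coarsest level offered to it. The default \<open>Suc k\<close> is left to the last vertex of a
  path: every other one is a neighbour of the subtree of its successor.\<close>

definition lam :: "(nat \<Rightarrow> nat option) \<Rightarrow> nat \<Rightarrow> nat" where
  "lam pref v = Min (insert (Suc k)
     ((\<lambda>w. lev (dep w)) ` {w\<in>V. v \<in> bd E (desc P w) \<and> head pref w = head pref v}))"

lemma lam_le_Suc: "lam pref v \<le> Suc k"
  unfolding lam_def using fin by (intro Min_le) auto

lemma lam_le: "w \<in> V \<Longrightarrow> v \<in> bd E (desc P w) \<Longrightarrow> head pref w = head pref v \<Longrightarrow> lam pref v \<le> lev (dep w)"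
  unfolding lam_def using fin by (intro Min_le) auto

lemma lam_witness:
  assumes "lam pref v \<noteq> Suc k"
  obtains w where "w \<in> V" "v \<in> bd E (desc P w)" "head pref w = head pref v" "lam pref v = lev (dep w)"
proof -
  have "lam pref v \<in> insert (Suc k)
     ((\<lambda>w. lev (dep w)) ` {w\<in>V. v \<in> bd E (desc P w) \<and> head pref w = head pref v})"
    unfolding lam_def using fin by (intro Min_in) auto
  then show ?thesis using assms that by auto
qed

abbreviation hdep :: "(nat \<Rightarrow> nat option) \<Rightarrow> nat \<Rightarrow> nat" where
  "hdep pref v \<equiv> dep (head pref v)"

text \<open>The shift reserves rank 0 for raised vertices. As levels are at most
  \<open>Suc k\<close>, ranks stay below \<open>k + 3\<close>, the base used in
  \<open>key\<close>.\<close>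

definition rk :: "nat set \<Rightarrow> (nat \<Rightarrow> nat option) \<Rightarrow> nat \<Rightarrow> nat" where
  "rk U pref v = (if v \<in> U then 0 else Suc (lam pref v))"

text \<open>Encodes the lexicographic order on the triples formed by the depth of the head
  of the preferred path, the level on the path, and the vertex itself; the vertices
  in \<open>U\<close> are raised to the top of their path.\<close>
definition key :: "nat set \<Rightarrow> (nat \<Rightarrow> nat option) \<Rightarrow> nat \<Rightarrow> nat" where
  "key U pref v = (hdep pref v * (k + 3) + rk U pref v) * Suc (Max V) + v"

lemma key_less:
  assumes "v \<in> V" "w \<in> V"
  shows "key U pref v < key U' pref' w \<longleftrightarrow> hdep pref v < hdep pref' w \<or> hdep pref v = hdep pref' w \<and>
    (rk U pref v < rk U' pref' w \<or> rk U pref v = rk U' pref' w \<and> v < w)"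
proof -
  have V: "v < Suc (Max V)" "w < Suc (Max V)" using assms fin by (simp_all add: less_Suc_eq_le)
  have rk: "rk U pref v < k + 3" "rk U' pref' w < k + 3"
    using lam_le_Suc[of pref v] lam_le_Suc[of pref' w] by (auto simp: rk_def)
  have eq: "a * (k + 3) + r = b * (k + 3) + s \<longleftrightarrow> a = b \<and> r = s" if "r < k + 3" "s < k + 3" for a b r s
    using mult_add_less_iff[OF that, of a b] mult_add_less_iff[OF that(2,1), of b a]
    by (metis linorder_neq_iff)
  show ?thesis unfolding key_def mult_add_less_iff[OF V] mult_add_less_iff[OF rk] eq[OF rk] by blast
qed

lemma key_le_hdep: "v \<in> V \<Longrightarrow> w \<in> V \<Longrightarrow> key U pref v \<le> key U pref w \<Longrightarrow> hdep pref v \<le> hdep pref w"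
  using key_less[of w v U pref U pref] by linarith

lemma key_inj: "inj_on (key U pref) V"
proof (rule inj_onI)
  fix x y assume "x \<in> V" "y \<in> V" "key U pref x = key U pref y"
  then show "x = y" using key_less[of x y U pref U pref] key_less[of y x U pref U pref]
    by (metis less_irrefl linorder_neq_iff)
qed

section \<open>Nodes of one preferred path met by a search\<close>

lemma heap_cross:
  assumes "STT T" "heap T \<pi>" "v \<in> desc T w" "w \<in> V" "v \<in> X" "w \<notin> X"
  obtains a b where "a \<in> X" "b \<notin> X" "E a b" "\<pi> w \<le> \<pi> a" "\<pi> w \<le> \<pi> b" "b \<in> bd E X"
proof -
  have "reach E (desc T w) v w" using desc_conn[OF assms(1)] assms(3) by (simp add: conn_def)
  then obtain a b where "a \<in> desc T w" "b \<in> desc T w" "a \<in> X" "b \<notin> X" "E a b"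
    using reach_cross[OF _ assms(5,6)] by metis
  then show ?thesis using that heap_desc_le[OF _ assms(2)] by (auto simp: bd_def)
qed

lemma heap_cross':
  assumes "STT T" "heap T \<pi>" "v \<in> desc T w" "w \<in> V" "v \<notin> X" "w \<in> X"
  obtains a b where "a \<in> X" "b \<notin> X" "E a b" "\<pi> w \<le> \<pi> a" "\<pi> w \<le> \<pi> b" "b \<in> bd E X"
proof -
  have "reach E (desc T w) w v" using desc_conn[OF assms(1)] assms(3) by (simp add: conn_def)
  then obtain a b where "a \<in> desc T w" "b \<in> desc T w" "a \<in> X" "b \<notin> X" "E a b"
    using reach_cross[OF _ assms(6,5)] by metis
  then show ?thesis using that heap_desc_le[OF _ assms(2)] by (auto simp: bd_def)
qed

text \<open>Otherwise the route from \<open>w\<close> to \<open>x\<close> inside the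
  \<open>T\<close>-subtree of \<open>w\<close> would leave the \<open>P\<close>-subtree of the head
  of \<open>w\<close> through one of its neighbours, which lies on a path with a strictly shallower
  head and so has a smaller key than \<open>w\<close>. Hence a search meets only paths whose head is
  on the root path of \<open>x\<close> in \<open>P\<close>.\<close>

lemma anc_path:
  assumes T: "STT T" "heap T (key U pref)" and x: "x \<in> V" "w \<in> anc T x"
  shows "x \<in> desc P (head pref w)"
proof (rule ccontr)
  assume n: "x \<notin> desc P (head pref w)"
  have w: "x \<in> desc T w" "w \<in> V" using x anc_sub[OF T(1)] by (auto simp: anc_def)
  obtain b where b: "key U pref w \<le> key U pref b" "b \<in> bd E (desc P (head pref w))"
    using heap_cross'[OF T w n desc_head] by blast
  note b' = bd_desc[OF b(2)]
  have "hdep pref w \<le> hdep pref b" using key_le_hdep[OF w(2) b'(3) b(1)] .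
  also have "hdep pref b \<le> dep b" by (rule dep_desc[OF desc_head])
  also have "dep b < hdep pref w" using dep_desc_less b' by metis
  finally show False by simp
qed

text \<open>The levels of \<open>u\<close> and \<open>u'\<close> come from cuts at \<open>w\<close>
  and \<open>w'\<close>; the ruler provides a coarser cut at some \<open>y\<close> in between.
  Either \<open>u'\<close> is a neighbour of the subtree of \<open>y\<close> and so has a coarser
  level, or this subtree separates \<open>u\<close> from \<open>u'\<close>; then one of its
  neighbours lies in \<open>T\<close> below the upper of the two although its key is
  smaller.\<close>

lemma chain_level_aux:
  assumes T: "STT T" "heap T (key {} pref)" and V: "u \<in> V" "u' \<in> V" and cmp: "u \<in> desc T u' \<or> u' \<in> desc T u"
    and H: "head pref u = H" "head pref u' = H" "head pref w = H" "head pref w' = H"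
    and lam: "lam pref u = lev (dep w)" "lam pref u' = lev (dep w)" "lev (dep w') = lev (dep w)"
    and W: "w \<in> V" "u \<in> bd E (desc P w)" "w' \<in> V" "u' \<in> bd E (desc P w')"
  shows "\<not> dep w < dep w'"
proof
  assume lt: "dep w < dep w'"
  obtain m where m: "dep w < m" "m < dep w'" "lev m < lev (dep w)"
    using lev_sep[OF lt dep_less[OF W(3)]] lam by auto
  have ww: "w' \<in> desc P w" using same_head_desc[of pref w' w] H lt by simp
  obtain y where y: "dep y = m" "w' \<in> desc P y" "y \<in> desc P w" using intermediate[OF ww, of m] m by auto
  have yV: "y \<in> V" using y(2) anc_sub[OF PS W(3)] by (auto simp: anc_def)
  have yH: "head pref y = H"
    using head_between[OF y(2), of pref] H y(3) desc_head[of w pref] desc_trans by metis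
  have uy: "u \<notin> desc P y"
    using dep_desc[of u y] dep_desc_less[OF bd_desc(1)[OF W(2)]] bd_desc(2)[OF W(2)] y m by fastforce
  show False
  proof (cases "u' \<in> desc P y")
    case False
    have "u' \<in> bd E (desc P y)" using W(4) False y(2) desc_trans unfolding bd_def by blast
    then have "lam pref u' \<le> lev m" using lam_le[OF yV] yH H y(1) by metis
    then show False using m lam by simp
  next
    case True
    obtain b x where b: "b \<in> bd E (desc P y)" "key {} pref x \<le> key {} pref b" "x = u \<or> x = u'"
      using cmp
    proof
      assume "u \<in> desc T u'"
      then show thesis using heap_cross'[OF T _ V(2) uy True] that by blast
    next
      assume "u' \<in> desc T u"
      then show thesis using heap_cross[OF T _ V(1) True uy] that by blast
    qed
    have xx: "x \<in> V" "head pref x = H" "lam pref x = lev (dep w)" using b(3) V H lam by auto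
    note b' = bd_desc[OF b(1)]
    have "dep H \<le> hdep pref b" using key_le_hdep[OF xx(1) b'(3) b(2)] xx(2) by simp
    then have "head pref b = H" using anc_head[OF b'(1), of pref] yH dep_desc[OF desc_head[of b pref]] by force
    then have "lam pref b \<le> lev m" using lam_le[OF yV b(1)] yH y(1) by metis
    then have "key {} pref b < key {} pref x"
      unfolding key_less[OF b'(3) xx(1)] using \<open>head pref b = H\<close> xx m by (simp add: rk_def)
    then show False using b(2) by simp
  qed
qed

text \<open>At a level up to \<open>k\<close> all vertices stem from a single cut, whose subtree has
  at most two neighbours. Level \<open>Suc k\<close> contributes only the last vertex of the path.
  Together \<open>2 * (k + 1) + 1\<close>.\<close>

lemma chain_bound:
  assumes T: "STT T" "heap T (key {} pref)" and x: "x \<in> V"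
  shows "card {w\<in>anc T x. head pref w = H} \<le> 2 * k + 3"
proof -
  define W where "W i = {w\<in>anc T x. head pref w = H \<and> lam pref w = i}" for i
  have Wfin: "finite (W i)" for i using anc_finite[OF T(1)] by (simp add: W_def)
  have WV: "u \<in> V" "head pref u = H" "lam pref u = i" if "u \<in> W i" for u i
    using that anc_sub[OF T(1) x] by (auto simp: W_def)
  have cmp: "u \<in> desc T v \<or> v \<in> desc T u" if "u \<in> W i" "v \<in> W i" for u v i
    using that desc_comparable[of x T u v] by (auto simp: W_def anc_def)
  have "{w\<in>anc T x. head pref w = H} = (\<Union>i\<le>Suc k. W i)"
    using lam_le_Suc by (auto simp: W_def)
  then have "card {w\<in>anc T x. head pref w = H} \<le> (\<Sum>i\<le>Suc k. card (W i))"
    using card_UN_le[of "{..Suc k}" W] by simp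
  also have "\<dots> = (\<Sum>i\<le>k. card (W i)) + card (W (Suc k))" by simp
  also have "(\<Sum>i\<le>k. card (W i)) \<le> (\<Sum>i\<le>k. 2)"
  proof (rule sum_mono)
    fix i assume i: "i \<in> {..k}"
    show "card (W i) \<le> 2"
    proof (cases "W i = {}")
      case False
      then obtain u where u: "u \<in> W i" by blast
      then obtain w where w: "w \<in> V" "u \<in> bd E (desc P w)" "head pref w = H" "lev (dep w) = i"
        using lam_witness[of pref u] WV[OF u] i by (metis Suc_n_not_le_n atMost_iff)
      have "W i \<subseteq> bd E (desc P w)"
      proof
        fix u' assume u': "u' \<in> W i"
        then obtain w' where w': "w' \<in> V" "u' \<in> bd E (desc P w')" "head pref w' = H" "lev (dep w') = i"
          using lam_witness[of pref u'] WV[OF u'] i by (metis Suc_n_not_le_n atMost_iff)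
        have "\<not> dep w < dep w'"
          by (rule chain_level_aux[OF T WV(1)[OF u] WV(1)[OF u'] cmp[OF u u'] WV(2)[OF u] WV(2)[OF u']])
            (use w w' WV(3)[OF u] WV(3)[OF u'] in auto)
        moreover have "\<not> dep w' < dep w"
          by (rule chain_level_aux[OF T WV(1)[OF u'] WV(1)[OF u] cmp[OF u' u] WV(2)[OF u'] WV(2)[OF u]])
            (use w w' WV(3)[OF u] WV(3)[OF u'] in auto)
        ultimately have "dep w = dep w'" by simp
        then have "w \<in> desc P w'" "w' \<in> desc P w" using same_head_desc[of pref] w(3) w'(3) by auto
        then show "u' \<in> bd E (desc P w)" using STT_antisym[OF PS] w' by blast
      qed
      moreover have "finite (bd E (desc P w))" by (rule finite_subset[OF _ fin]) (auto simp: bd_def EV)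
      ultimately show ?thesis using bd2[OF w(1)] card_mono le_trans by blast
    qed simp
  qed
  also have "card (W (Suc k)) \<le> 1"
  proof -
    have *: "u = v" if uv: "u \<in> W (Suc k)" "v \<in> W (Suc k)" "dep u \<le> dep v" for u v
    proof (rule ccontr)
      assume "u \<noteq> v"
      moreover have vu: "v \<in> desc P u" using same_head_desc[of pref v u] WV[OF uv(1)] WV[OF uv(2)] uv(3) by simp
      ultimately obtain c where c: "P c = Some u" "v \<in> desc P c" using desc_child[of v P u] by blast
      have cV: "c \<in> V" using STT_V[OF PS c(1)] by simp
      have "head pref c = H"
        using head_between[OF c(2), of pref] WV[OF uv(1)] WV[OF uv(2)] desc_head[of u pref]
          desc_trans[OF desc_parent[of P c u, OF c(1)]] by simp
      then have "lam pref u \<le> lev (dep c)" using lam_le[OF cV parent_in_bd[OF c(1)], of pref] WV(2)[OF uv(1)] by simp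
      also have "\<dots> \<le> k" using lev_le dep_less cV by blast
      finally show False using WV[OF uv(1)] by simp
    qed
    have "u = v" if "u \<in> W (Suc k)" "v \<in> W (Suc k)" for u v
      using *[OF that] *[OF that(2,1)] by linarith
    then show ?thesis using Wfin by (simp add: card_le_Suc0_iff_eq)
  qed
  finally show ?thesis by simp
qed

end

section \<open>Changing one preferred child\<close>

context leveled
begin

context
  fixes pref pref' z c
  assumes c: "P c = Some z" and pz: "pref z \<noteq> Some c" and pref': "pref' = pref(z := Some c)"
begin

lemma pref'_simps: "pref' z = Some c" "u \<noteq> z \<Longrightarrow> pref' u = pref u"
  by (simp_all add: pref')

text \<open>The part cut off from the path of \<open>z\<close>. Heads change only inside this set
  and inside \<open>desc P c\<close>.\<close>

definition lost :: "nat set" where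
  "lost = {v. \<exists>d. P d = Some z \<and> pref z = Some d \<and> v \<in> desc P d}"

text \<open>The vertices on the path of \<open>z\<close> that see one of the two exchanged subtrees:
  the only ones whose level can change.\<close>

definition swing :: "nat set" where
  "swing = {u. head pref u = head pref z \<and> (u \<in> bd E (desc P c) \<or> u \<in> bd E lost)}"

lemma lost_cases:
  obtains "lost = {}" "\<And>d. P d = Some z \<Longrightarrow> pref z \<noteq> Some d"
  | d where "P d = Some z" "pref z = Some d" "lost = desc P d"
  unfolding lost_def by (cases "\<exists>d. P d = Some z \<and> pref z = Some d") auto

lemma lost_down: "v \<in> desc P w \<Longrightarrow> w \<in> lost \<Longrightarrow> v \<in> lost"
  unfolding lost_def using desc_trans by blast

lemma head_c: "head pref c = c"
  using head_self[of c pref] c pz by simp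

lemma z_notin: "z \<notin> desc P c" "z \<notin> lost"
  using STT_parent_notin[OF PS] c by (auto simp: lost_def)

lemma swing_above: "u \<in> swing \<Longrightarrow> z \<in> desc P u"
proof -
  assume "u \<in> swing"
  then obtain e where e: "P e = Some z" "u \<in> bd E (desc P e)"
    by (cases rule: lost_cases) (use c in \<open>auto simp: swing_def bd_def\<close>)
  then show ?thesis using bd_desc[OF e(2)] desc_up by (metis option.inject)
qed

lemma swing_V: "swing \<subseteq> V"
  by (auto simp: swing_def bd_def EV)

lemma swing_card: "finite swing" "card swing \<le> 4"
proof -
  show f: "finite swing" using swing_V fin finite_subset by blast
  have b: "finite (bd E X)" for X by (rule finite_subset[OF _ fin]) (auto simp: bd_def EV)
  have "swing \<subseteq> bd E (desc P c) \<union> bd E lost" by (auto simp: swing_def)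
  then have "card swing \<le> card (bd E (desc P c)) + card (bd E lost)"
    using b by (meson card_Un_le card_mono finite_UnI le_trans)
  also have "card (bd E (desc P c)) \<le> 2" using bd2 STT_V[OF PS c] by blast
  also have "card (bd E lost) \<le> 2"
    by (cases rule: lost_cases) (use bd2 STT_V[OF PS] in \<open>auto simp: bd_def\<close>)
  finally show "card swing \<le> 4" by simp
qed

lemma swing_notin: "u \<in> swing \<Longrightarrow> u \<notin> desc P c \<and> u \<notin> lost"
proof -
  assume "u \<in> swing"
  then have z: "z \<in> desc P u" by (rule swing_above)
  then show ?thesis using z_notin desc_trans lost_down by blast
qed

lemma c_lost_disjoint: "v \<in> desc P c \<Longrightarrow> v \<notin> lost"
  using child_unique c pz by (auto simp: lost_def)

lemma step_in_iff:
  assumes "P v = Some u" "u \<noteq> z"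
  shows "v \<in> desc P c \<longleftrightarrow> u \<in> desc P c" "v \<in> lost \<longleftrightarrow> u \<in> lost"
proof -
  have *: "v \<in> desc P e \<longleftrightarrow> u \<in> desc P e" if e: "P e = Some z" for e
  proof
    have "v \<noteq> e" using assms e by auto
    then show "v \<in> desc P e \<Longrightarrow> u \<in> desc P e" using desc_up[of v P e] assms(1) by auto
  qed (rule desc_trans[OF desc_parent[of P v u, OF assms(1)]])
  show "v \<in> desc P c \<longleftrightarrow> u \<in> desc P c" using * c by blast
  show "v \<in> lost \<longleftrightarrow> u \<in> lost" using * by (auto simp: lost_def)
qed

lemma child_of_z:
  assumes "P v = Some z"
  shows "v \<in> desc P c \<longleftrightarrow> v = c" "v \<in> lost \<longleftrightarrow> pref z = Some v"
  using child_unique[OF assms _ desc_refl] c assms by (auto simp: lost_def)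

lemma head_lost: "v \<in> lost \<Longrightarrow> head pref v = head pref z \<or> head pref v \<in> lost \<and> head pref v \<noteq> head pref z
    \<and> P (head pref v) \<noteq> Some z"
proof (induction v rule: dep_induct)
  case (less v)
  show ?case
  proof (cases rule: head_cases[of pref v])
    case 1
    have "head pref z \<noteq> v" using less.prems z_notin(2) desc_head[of z pref] lost_down by blast
    moreover have "P v \<noteq> Some z" using less.prems child_of_z 1 by metis
    ultimately show ?thesis using 1 less.prems by metis
  next
    case (2 u)
    show ?thesis
    proof (cases "u = z")
      case False
      then show ?thesis using less step_in_iff(2)[OF 2(1)] 2 dep_Suc by auto
    qed (use 2 in simp)
  qed
qed

lemma head_upd:
  "head pref' v = (if v \<in> desc P c then (if head pref v = c then head pref z else head pref v)
     else if v \<in> lost \<and> head pref v = head pref z then the (pref z) else head pref v)"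
proof (induction v rule: dep_induct)
  case (less v)
  show ?case
  proof (cases "P v")
    case None
    then have "v \<notin> desc P c" using c desc_up by fastforce
    moreover have "v \<notin> lost" using None desc_up by (fastforce simp: lost_def)
    ultimately show ?thesis using head_self[of v pref] head_self[of v pref'] None by (metis option.distinct(1))
  next
    case (Some u)
    show ?thesis
    proof (cases "u = z")
      case True
      note cz = child_of_z[OF Some[unfolded True]]
      have hz: "head pref' z = head pref z" using less[of z] Some True dep_Suc z_notin by simp
      consider "v = c" | "pref z = Some v" | "v \<noteq> c" "pref z \<noteq> Some v" by blast
      then show ?thesis
      proof cases
        case 1
        then show ?thesis using head_parent[of c z pref'] c hz head_c pref'_simps by simp
      next
        case 2
        then have "v \<noteq> c" using pz by auto
        then show ?thesis using 2 cz head_self[of v pref'] head_parent[of v z pref] Some True pref'_simps by simp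
      next
        case 3
        then show ?thesis using cz head_self[of v pref'] head_self[of v pref] Some True pref'_simps by simp
      qed
    next
      case False
      note st = step_in_iff[OF Some False]
      show ?thesis
      proof (cases "pref u = Some v")
        case True
        then show ?thesis
          using head_parent[of v u pref] head_parent[of v u pref'] Some False less[of u] st dep_Suc pref'_simps by simp
      next
        case nu: False
        then have hv: "head pref v = v" "head pref' v = v"
          using head_self[of v pref] head_self[of v pref'] Some False pref'_simps by auto
        have "v \<noteq> c" using c Some False by auto
        moreover have "v \<in> lost \<Longrightarrow> head pref z \<noteq> v"
          using z_notin(2) desc_head[of z pref] lost_down by blast
        ultimately show ?thesis using hv by auto
      qed
    qed
  qed
qed

lemma bd_same_side:
  assumes "v \<in> bd E (desc P w)"
  shows "v \<in> desc P c \<Longrightarrow> w \<in> desc P c" "v \<in> lost \<Longrightarrow> w \<in> lost"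
  using bd_desc(1)[OF assms] desc_trans lost_down by blast+

text \<open>The level depends on which \<open>w\<close> with \<open>v\<close> adjacent to their
  subtree share the path of \<open>v\<close>. This can change only if \<open>w\<close> lies in an
  exchanged subtree and \<open>v\<close> does not. Then \<open>v\<close> is a neighbour of that
  subtree, and outside \<open>swing\<close> it is not on the path of \<open>z\<close>, so
  \<open>v\<close> and \<open>w\<close> are on different paths before and after.\<close>

lemma lam_upd:
  assumes v: "v \<in> V" "v \<notin> swing"
  shows "lam pref' v = lam pref v"
proof -
  have hc: "head pref w \<in> desc P c" if "w \<in> desc P c" for w by (rule head_in[OF head_c that])
  have hz: "head pref z \<notin> desc P c" "head pref z \<notin> lost"
    using z_notin desc_head[of z pref] desc_trans lost_down by blast+
  have dl: "the (pref z) \<in> lost \<and> P (the (pref z)) = Some z" if "w \<in> lost" for w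
    using that by (auto simp: lost_def)
  have hv: "v \<in> desc P (head pref v)" by (rule desc_head)
  have up: "v \<in> desc P c" if "head pref v \<in> desc P c" using that hv desc_trans by blast
  have upl: "v \<in> lost" if "head pref v \<in> lost" using that hv lost_down by blast
  have "head pref' w = head pref' v \<longleftrightarrow> head pref w = head pref v" if b: "v \<in> bd E (desc P w)" for w
  proof -
    consider "v \<in> desc P c" "w \<in> desc P c" | "v \<in> lost" "w \<in> lost" "v \<notin> desc P c" "w \<notin> desc P c"
      | "v \<notin> desc P c" "v \<notin> lost" "w \<in> desc P c" | "v \<notin> desc P c" "v \<notin> lost" "w \<in> lost" "w \<notin> desc P c"
      | "v \<notin> desc P c" "v \<notin> lost" "w \<notin> desc P c" "w \<notin> lost"
      using bd_same_side[OF b] c_lost_disjoint by blast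
    then show ?thesis
    proof cases
      case 1
      then show ?thesis using hc[OF 1(1)] hc[OF 1(2)] hz by (auto simp: head_upd)
    next
      case 2
      then show ?thesis using head_lost[OF 2(1)] head_lost[OF 2(2)] dl[OF 2(1)] by (auto simp: head_upd)
    next
      case 3
      then have "v \<in> bd E (desc P c)" using b desc_trans by (auto simp: bd_def)
      then have "head pref v \<noteq> head pref z" using v by (auto simp: swing_def)
      then show ?thesis using 3 hc[OF 3(3)] up by (auto simp: head_upd)
    next
      case 4
      then have "v \<in> bd E lost" using b lost_down by (fastforce simp: bd_def)
      then have "head pref v \<noteq> head pref z" using v by (auto simp: swing_def)
      then show ?thesis using 4 head_lost[OF 4(3)] upl dl[OF 4(3)] by (auto simp: head_upd)
    next
      case 5
      then show ?thesis by (simp add: head_upd)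
    qed
  qed
  then have "{w\<in>V. v \<in> bd E (desc P w) \<and> head pref' w = head pref' v} =
    {w\<in>V. v \<in> bd E (desc P w) \<and> head pref w = head pref v}" by blast
  then show ?thesis by (simp add: lam_def)
qed

lemma rk_upd: "v \<in> V \<Longrightarrow> rk swing pref' v = rk swing pref v"
  using lam_upd by (simp add: rk_def)

lemma hdep_z: "hdep pref z < dep c"
  using dep_desc[OF desc_head[of z pref]] dep_Suc[OF c] by simp

lemma hdep_c:
  assumes "v \<in> desc P c"
  shows "hdep pref v = dep c \<and> hdep pref' v = hdep pref z \<or> dep c < hdep pref v \<and> hdep pref' v = hdep pref v"
  using dep_desc_less[OF head_in[OF head_c assms]] assms by (auto simp: head_upd)

lemma hdep_lost:
  assumes "v \<in> lost"
  shows "hdep pref v = hdep pref z \<and> hdep pref' v = dep c \<or> dep c < hdep pref v \<and> hdep pref' v = hdep pref v"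
proof -
  obtain d where d: "P d = Some z" "pref z = Some d" "lost = desc P d"
    using assms by (cases rule: lost_cases) auto
  have "dep d = dep c" using d c dep_Suc by simp
  moreover have "dep d < hdep pref v" if "head pref v \<noteq> head pref z"
    using head_lost[OF assms] that d dep_desc_less[of "head pref v" d] by auto
  ultimately show ?thesis using assms d c_lost_disjoint[of v] by (auto simp: head_upd)
qed

lemma hdep_other: "v \<notin> desc P c \<Longrightarrow> v \<notin> lost \<Longrightarrow> hdep pref' v = hdep pref v"
  by (simp add: head_upd)

lemma cross_swing:
  assumes "b \<in> bd E (desc P c) \<or> b \<in> bd E lost"
  shows "b \<in> V" "b \<in> swing \<or> hdep pref b < hdep pref z" "hdep pref b \<le> hdep pref z"
proof -
  obtain e where e: "P e = Some z" "b \<in> bd E (desc P e)"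
    using assms by (cases rule: lost_cases) (use c in \<open>auto simp: bd_def\<close>)
  then have zb: "z \<in> desc P b" using bd_desc[OF e(2)] desc_up by (metis option.inject)
  show "b \<in> V" using bd_desc(3)[OF e(2)] .
  show 2: "b \<in> swing \<or> hdep pref b < hdep pref z"
    using anc_head[OF zb, of pref] assms dep_desc[OF desc_head[of b pref]] by (auto simp: swing_def)
  then show "hdep pref b \<le> hdep pref z" by (auto simp: swing_def)
qed

text \<open>Raising the at most four neighbours of the two swapped subtrees that lie on the
  path makes the search tree insensitive to the change of the preferred child.\<close>
lemma raised_heap:
  assumes T: "STT T" "heap T (key swing pref)"
  shows "heap T (key swing pref')"
  unfolding heap_def
proof (intro allI impI)
  fix v w assume vw: "T v = Some w"
  have V: "v \<in> V" "w \<in> V" using STT_V[OF T(1) vw] by auto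
  have lt: "key swing pref w < key swing pref v" using heapD[OF T(2) vw] .
  then have lex: "hdep pref w < hdep pref v \<or> hdep pref w = hdep pref v \<and>
    (rk swing pref w < rk swing pref v \<or> rk swing pref w = rk swing pref v \<and> w < v)"
    unfolding key_less[OF V(2,1)] .
  have d: "v \<in> desc T w" using desc_parent[of T v w, OF vw] .
  have goal: "hdep pref' w < hdep pref' v \<or> hdep pref' w = hdep pref' v \<and>
    (rk swing pref w < rk swing pref v \<or> rk swing pref w = rk swing pref v \<and> w < v)"
  proof -
    have ns: "0 < rk swing pref x" if "x \<in> desc P c \<or> x \<in> lost" for x
      using swing_notin[of x] that by (auto simp: rk_def)
    have s0: "x \<in> swing" if "rk swing pref x = 0" for x using that by (auto simp: rk_def split: if_splits)
    \<comment> \<open>A neighbour \<open>b\<close> of an exchanged subtree is raised or belongs to a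
      path with a shallower head. Since raised vertices have the least rank, the same dichotomy
      passes to every \<open>w\<close> not after \<open>b\<close>.\<close>
    have low: "hdep pref w < hdep pref z \<or> hdep pref w = hdep pref z \<and> w \<in> swing"
      if "b \<in> bd E (desc P c) \<or> b \<in> bd E lost" "key swing pref w \<le> key swing pref b" for b
    proof -
      note b = cross_swing[OF that(1)]
      have "\<not> key swing pref b < key swing pref w" using that(2) by simp
      then have "\<not> (hdep pref b < hdep pref w \<or> hdep pref b = hdep pref w \<and> rk swing pref b < rk swing pref w)"
        unfolding key_less[OF b(1) V(2)] by blast
      then consider "hdep pref w < hdep pref b" | "hdep pref w = hdep pref b" "rk swing pref w \<le> rk swing pref b"
        by linarith
      then show ?thesis
      proof cases
        case 2
        show ?thesis
        proof (cases "b \<in> swing")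
          case True
          then have "rk swing pref b = 0" "hdep pref b = hdep pref z" by (simp_all add: rk_def swing_def)
          then show ?thesis using 2 s0[of w] by simp
        next
          case False
          then show ?thesis using b(2) 2 by linarith
        qed
      qed (use b(3) in simp)
    qed
    have out: "w \<notin> desc P c \<and> w \<notin> lost \<and> hdep pref' w = hdep pref w"
      if "hdep pref w < hdep pref z \<or> hdep pref w = hdep pref z \<and> w \<in> swing"
    proof -
      have "w \<notin> desc P c" using hdep_c[of w] hdep_z that by fastforce
      moreover have "w \<notin> lost" using hdep_lost[of w] hdep_z that swing_notin by fastforce
      ultimately show ?thesis using hdep_other by simp
    qed
    have crossX: "\<exists>b. b \<in> bd E X \<and> key swing pref w \<le> key swing pref b" if "(v \<in> X) \<noteq> (w \<in> X)" for X
      using that heap_cross[OF T d V(2), of X] heap_cross'[OF T d V(2), of X] by metis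
    consider "v \<in> desc P c" "w \<in> desc P c" | "v \<in> lost" "w \<in> lost"
      | "(v \<in> desc P c) \<noteq> (w \<in> desc P c)" | "(v \<in> lost) \<noteq> (w \<in> lost)"
      | "v \<notin> desc P c" "w \<notin> desc P c" "v \<notin> lost" "w \<notin> lost" by blast
    then show ?thesis
    proof cases
      \<comment> \<open>Inside an exchanged subtree only one head depth moves, between
        \<open>dep c\<close> and that of the path of \<open>z\<close>; all others exceed both, so
        the order is preserved.\<close>
      case 1
      then show ?thesis using lex hdep_c[OF 1(1)] hdep_c[OF 1(2)] hdep_z by linarith
    next
      case 2
      then show ?thesis using lex hdep_lost[OF 2(1)] hdep_lost[OF 2(2)] hdep_z by linarith
    next
      \<comment> \<open>The parent \<open>w\<close> must be the end outside the subtree. If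
        \<open>v\<close> now has the same head depth as \<open>w\<close>, the rank 0 of the raised
        \<open>w\<close> decides.\<close>
      case 3
      then have l: "hdep pref w < hdep pref z \<or> hdep pref w = hdep pref z \<and> w \<in> swing"
        using low crossX by blast
      note o = out[OF l]
      then have v: "v \<in> desc P c" using 3 by blast
      then show ?thesis using l o hdep_c[OF v] hdep_z ns[of v] by (auto simp: rk_def split: if_splits)
    next
      case 4
      then have l: "hdep pref w < hdep pref z \<or> hdep pref w = hdep pref z \<and> w \<in> swing"
        using low crossX by blast
      note o = out[OF l]
      then have v: "v \<in> lost" using 4 by blast
      then show ?thesis using l o hdep_lost[OF v] hdep_z by auto
    next
      case 5
      then show ?thesis using lex hdep_other by simp
    qed
  qed
  show "key swing pref' w < key swing pref' v"
    unfolding key_less[OF V(2,1)] rk_upd[OF V(1)] rk_upd[OF V(2)] using goal .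
qed

end

end

section \<open>Cost of a search\<close>

inductive go :: "(nat \<Rightarrow> nat \<Rightarrow> bool) \<Rightarrow> nat \<Rightarrow> gst_state \<Rightarrow> gst_state \<Rightarrow> bool" for E where
  go_refl: "go E 0 s s"
| go_step: "gst_step E s op = Some s' \<Longrightarrow> go E n s' s'' \<Longrightarrow> go E (Suc n) s s''"

lemma go_trans: "go E m s s' \<Longrightarrow> go E n s' s'' \<Longrightarrow> go E (m + n) s s''"
  by (induction rule: go.induct) (auto intro: go_step)

lemma go_one: "gst_step E s op = Some s' \<Longrightarrow> go E 1 s s'"
  using go_step[OF _ go_refl] by simp

lemma go_snoc: "go E n s s' \<Longrightarrow> gst_step E s' op = Some s'' \<Longrightarrow> go E (Suc n) s s''"
  using go_trans[OF _ go_one] by simp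

lemma trace_start: "gst_trace E s os = Some ss \<Longrightarrow> s \<in> set ss"
  by (cases os) (auto split: option.splits)

lemma go_trace:
  assumes "go E n s s1" "gst_trace E s1 os = Some ss1"
  shows "\<exists>os' ss. length os' = n + length os \<and> gst_trace E s os' = Some ss \<and> set ss1 \<subseteq> set ss \<and> last ss = last ss1"
  using assms
proof (induction rule: go.induct)
  case (go_step s op s' n s'')
  then obtain os' ss where o: "length os' = n + length os" "gst_trace E s' os' = Some ss"
    "set ss1 \<subseteq> set ss" "last ss = last ss1" by blast
  then have "ss \<noteq> []" using trace_start by fastforce
  then show ?case using o go_step(1)
    by (intro exI[of _ "op # os'"] exI[of _ "s # ss"]) auto
qed auto

context sgraph
begin

lemma gst_step_STT: "gst_step E (T, c) op = Some s' \<Longrightarrow> STT T \<Longrightarrow> STT (fst s')"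
  by (cases op) (auto split: option.splits if_splits intro: rot_STT)

text \<open>A rotation of \<open>c\<close> over \<open>q\<close> is undone by stepping down to
  \<open>q\<close>, rotating \<open>q\<close>, and stepping down to \<open>c\<close>: three
  operations.\<close>

lemma gst_step_reverse:
  assumes "gst_step E (T, c) op = Some s'" "STT T"
  shows "\<exists>m\<le>3. go E m s' (T, c)"
proof (cases op)
  case ToParent
  then obtain q where "T c = Some q" "s' = (T, q)" using assms by (auto split: option.splits)
  then have "go E 1 s' (T, c)" by (intro go_one[of _ _ "ToChild c"]) simp
  then show ?thesis by (intro exI[of _ 1]) simp
next
  case (ToChild w)
  then have "T w = Some c" "s' = (T, w)" using assms by (auto split: if_splits)
  then have "go E 1 s' (T, c)" by (intro go_one[of _ _ ToParent]) simp
  then show ?thesis by (intro exI[of _ 1]) simp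
next
  case Rotate
  then obtain q where q: "T c = Some q" "s' = (rot E T c q, c)" using assms by (auto split: option.splits)
  have r: "rot E T c q q = Some c" by (rule rot_q[OF assms(2) q(1)])
  have i: "rot E (rot E T c q) q c = T" by (rule rot_inverse[OF assms(2) q(1)])
  have "go E 1 s' (rot E T c q, q)" using q r by (intro go_one[of _ _ "ToChild q"]) simp
  then have "go E (Suc 1) s' (T, q)" by (rule go_snoc[of _ _ _ _ Rotate]) (simp add: r i)
  then have "go E (Suc (Suc 1)) s' (T, c)" by (rule go_snoc[of _ _ _ _ "ToChild c"]) (simp add: q)
  then show ?thesis by (intro exI[of _ "Suc (Suc 1)"]) simp
qed

lemma go_reverse: "go E n s s' \<Longrightarrow> STT (fst s) \<Longrightarrow> \<exists>m\<le>3 * n. go E m s' s"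
proof (induction rule: go.induct)
  case (go_step s op s' n s'')
  have "STT (fst s')" using gst_step_STT[of "fst s" "snd s" op s'] go_step by simp
  then obtain m where m: "m \<le> 3 * n" "go E m s'' s'" using go_step by blast
  obtain m' where m': "m' \<le> 3" "go E m' s' s"
    using gst_step_reverse[of "fst s" "snd s" op s'] go_step by auto
  show ?case using go_trans[OF m(2) m'(2)] m(1) m'(1) by (intro exI[of _ "m + m'"]) simp
qed (auto intro: go_refl)

lemma gst_step_depth:
  assumes "gst_step E (T, c) op = Some (T', c')" "STT T"
  shows "card (anc T' c') \<le> Suc (card (anc T c))"
proof (cases op)
  case ToParent
  then show ?thesis using assms anc_parent(3)[of T c c'] by (auto split: option.splits)
next
  case (ToChild w)
  then show ?thesis using assms anc_parent(3)[of T w c] by (auto split: if_splits)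
next
  case Rotate
  obtain q where q: "T c = Some q" using assms(1) Rotate by (cases "T c") auto
  then have "T' = rot E T c q" "c' = c" using assms(1) Rotate by auto
  then show ?thesis using card_mono[OF anc_finite[OF assms(2)] rot_anc_v[OF assms(2) q]] by simp
qed

lemma go_depth: "go E n s s' \<Longrightarrow> STT (fst s) \<Longrightarrow>
  card (anc (fst s') (snd s')) \<le> card (anc (fst s) (snd s)) + n"
proof (induction rule: go.induct)
  case (go_step s op s' n s'')
  have "STT (fst s')" using gst_step_STT[of "fst s" "snd s" op s'] go_step by simp
  then show ?case using go_step gst_step_depth[of "fst s" "snd s" op "fst s'" "snd s'"] by simp
qed simp

lemma walk:
  assumes "STT T" "u \<in> desc T t"
  shows "card (anc T t) \<le> card (anc T u) \<and> go E (card (anc T u) - card (anc T t)) (T, t) (T, u) \<and>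
    go E (card (anc T u) - card (anc T t)) (T, u) (T, t)"
  using assms(2)
proof (induction u rule: desc_induct)
  case (step x z)
  have c: "card (anc T x) = Suc (card (anc T z))" by (rule anc_parent(3)[OF assms(1) step(1)])
  have e: "card (anc T x) - card (anc T t) = Suc (card (anc T z) - card (anc T t))" using step c by linarith
  have "go E (Suc (card (anc T z) - card (anc T t))) (T, t) (T, x)"
    using step by (intro go_snoc[of _ _ _ "(T, z)" "ToChild x"]) auto
  moreover have "go E (Suc (card (anc T z) - card (anc T t))) (T, x) (T, t)"
    using step by (intro go_step[of _ _ ToParent "(T, z)"]) auto
  ultimately show ?case using step c e by simp
qed (simp add: go_refl)

text \<open>\<open>T\<close> is heap-ordered except that \<open>u\<close> may sit too low; the last
  hypothesis keeps the order for children of \<open>u\<close> that pass to its parent. Each rotation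
  removes one vertex of larger priority from the root path of \<open>u\<close>, and other root paths
  gain at most \<open>u\<close>.\<close>

lemma raise:
  assumes "STT T" "u \<in> V" "inj_on \<pi> V" "\<And>v w. v \<noteq> u \<Longrightarrow> T v = Some w \<Longrightarrow> \<pi> w < \<pi> v"
    "\<And>a q. T a = Some u \<Longrightarrow> T u = Some q \<Longrightarrow> \<pi> q < \<pi> a"
  shows "\<exists>r T'. go E r (T, u) (T', u) \<and> STT T' \<and> heap T' \<pi> \<and>
    r \<le> card {w\<in>anc T u. w \<noteq> u \<and> \<pi> u < \<pi> w} \<and> (\<forall>y. anc T' y \<subseteq> insert u (anc T y))"
  using assms
proof (induction "card (anc T u)" arbitrary: T rule: less_induct)
  case less
  show ?case
  proof (cases "\<exists>q. T u = Some q \<and> \<pi> u < \<pi> q")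
    case False
    have "\<pi> w < \<pi> u" if "T u = Some w" for w
      using False that STT_V[OF less.prems(1) that] less.prems(3) STT_not_self[OF less.prems(1), of u]
      by (metis inj_on_contraD linorder_neqE_nat)
    then have "heap T \<pi>" unfolding heap_def using less.prems(4) by metis
    then show ?thesis using less.prems(1) go_refl by (intro exI[of _ 0] exI[of _ T]) auto
  next
    case True
    then obtain q where q: "T u = Some q" "\<pi> u < \<pi> q" by blast
    note r = less.prems(1) q(1)
    let ?T = "rot E T u q"
    have nuq: "u \<noteq> q" using q by auto
    have sub: "anc ?T u \<subseteq> anc T u" by (rule rot_anc_v[OF r])
    have qa: "q \<notin> anc ?T u" using STT_parent_notin[OF rot_STT[OF r] rot_q[OF r]] by (simp add: anc_def)
    have qa': "q \<in> anc T u" using desc_parent[of T u q, OF q(1)] by (simp add: anc_def)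
    have lt: "card (anc ?T u) < card (anc T u)"
      using sub qa qa' anc_finite[OF less.prems(1)] by (intro psubset_card_mono) auto
    have 1: "\<pi> w < \<pi> v" if "v \<noteq> u" "?T v = Some w" for v w
      using that(2)
      by (cases rule: rot_cases[OF r, of v]) (use that q less.prems(4,5) in auto)
    have 2: "\<pi> g < \<pi> a" if "?T a = Some u" "?T u = Some g" for a g
    proof -
      have g: "\<pi> g < \<pi> q" using that(2) rot_v[OF r] less.prems(4)[of q g] nuq by simp
      show ?thesis
        using that(1) by (cases rule: rot_cases[OF r, of a])
          (use g nuq less.prems(4,5) q rot_v[OF r] STT_not_self[OF rot_STT[OF r], of u] in \<open>auto intro: less_trans\<close>)
    qed
    obtain n T' where n: "go E n (?T, u) (T', u)" "STT T'" "heap T' \<pi>"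
      "n \<le> card {w\<in>anc ?T u. w \<noteq> u \<and> \<pi> u < \<pi> w}" "\<And>y. anc T' y \<subseteq> insert u (anc ?T y)"
      using less.hyps[OF lt rot_STT[OF r] less.prems(2,3) 1 2] by blast
    have "go E (Suc n) (T, u) (T', u)" using n(1) q by (intro go_step[of _ _ Rotate "(?T, u)"]) auto
    moreover have "Suc n \<le> card {w\<in>anc T u. w \<noteq> u \<and> \<pi> u < \<pi> w}"
    proof -
      have "Suc n \<le> card (insert q {w\<in>anc ?T u. w \<noteq> u \<and> \<pi> u < \<pi> w})"
        using n(4) qa anc_finite[OF rot_STT[OF r]] by simp
      also have "\<dots> \<le> card {w\<in>anc T u. w \<noteq> u \<and> \<pi> u < \<pi> w}"
        using sub qa' q nuq anc_finite[OF less.prems(1)] by (intro card_mono) auto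
      finally show ?thesis .
    qed
    moreover have "anc T' y \<subseteq> insert u (anc T y)" for y
      using n(5)[of y] rot_anc_sub[OF r, of y] by blast
    ultimately show ?thesis using n(2,3) by blast
  qed
qed

end

context leveled
begin

section \<open>Raising vertices inside one preferred path\<close>

definition path_bound :: "(nat \<Rightarrow> nat option) \<Rightarrow> (nat \<Rightarrow> nat option) \<Rightarrow> nat \<Rightarrow> nat \<Rightarrow> bool" where
  "path_bound T pref H m \<longleftrightarrow> (\<forall>y\<in>V. card {w\<in>anc T y. head pref w = H} \<le> m)"

lemma top_path:
  assumes "STT T" "H \<in> V"
  shows "top T (desc P H) \<in> desc P H" "desc P H \<subseteq> desc T (top T (desc P H))" "top T (desc P H) \<in> V"
  using top_desc[OF assms] desc_sub[OF PS assms(2)] by auto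

text \<open>Between the top of the path's subtree and \<open>u\<close> the keys are squeezed, which
  forces head depth \<open>dep H\<close>. By \<open>anc_path\<close> these heads also lie above
  \<open>u\<close> in \<open>P\<close>, hence equal \<open>H\<close>.\<close>

lemma depth_in_path:
  assumes T: "STT T" "heap T (key U pref)" and u: "u \<in> V" "head pref u = H" and b: "path_bound T pref H m"
  shows "card (anc T u) - card (anc T (top T (desc P H))) \<le> m" "u \<in> desc T (top T (desc P H))"
proof -
  let ?t = "top T (desc P H)"
  have HV: "H \<in> V" using head_V u by blast
  note t = top_path[OF T(1) HV]
  have uH: "u \<in> desc P H" using desc_head[of u pref] u by simp
  then show ut: "u \<in> desc T ?t" using t(2) by blast
  have "anc T u - anc T ?t \<subseteq> {w\<in>anc T u. head pref w = H}"
  proof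
    fix w assume w: "w \<in> anc T u - anc T ?t"
    then have wV: "w \<in> V" using anc_sub[OF T(1) u(1)] by blast
    have uw: "u \<in> desc T w" using w by (simp add: anc_def)
    then have "w \<in> desc T ?t" using w desc_comparable[OF uw ut] by (auto simp: anc_def)
    then have k: "key U pref ?t \<le> key U pref w" "key U pref w \<le> key U pref u"
      using heap_desc_le[OF _ T(2)] uw by auto
    have HH: "head pref H = H" using head_head u by metis
    have "dep H \<le> hdep pref ?t" using dep_desc[OF head_in[OF HH t(1)]] .
    moreover have "hdep pref ?t \<le> hdep pref w" using key_le_hdep[OF t(3) wV k(1)] .
    moreover have "hdep pref w \<le> dep H" using key_le_hdep[OF wV u(1) k(2)] u by simp
    ultimately have "hdep pref w = dep H" by simp
    moreover have "u \<in> desc P (head pref w)" using anc_path[OF T u(1)] w by blast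
    ultimately have "head pref w = H"
      using desc_comparable[OF uH, of "head pref w"] dep_desc_less by (metis less_irrefl)
    then show "w \<in> {w\<in>anc T u. head pref w = H}" using w by simp
  qed
  then have "card (anc T u - anc T ?t) \<le> card {w\<in>anc T u. head pref w = H}"
    using anc_finite[OF T(1)] by (intro card_mono) auto
  moreover have "card (anc T u) - card (anc T ?t) \<le> card (anc T u - anc T ?t)"
    by (rule diff_card_le_card_Diff[OF anc_finite[OF T(1)]])
  ultimately show "card (anc T u) - card (anc T ?t) \<le> m" using b u(1) unfolding path_bound_def by fastforce
qed

text \<open>Down to \<open>u\<close>, at most \<open>m\<close> rotations, and back up along a root
  path that may have gained \<open>u\<close>: \<open>m + m + (m + 1)\<close> operations.\<close>

lemma raise_one:
  assumes T: "STT T" "heap T (key U pref)" and u: "u \<in> V" "head pref u = H" and b: "path_bound T pref H m"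
  shows "\<exists>n T'. n \<le> 3 * m + 1 \<and> go E n (T, top T (desc P H)) (T', top T' (desc P H)) \<and> STT T' \<and>
    heap T' (key (insert u U) pref) \<and> path_bound T' pref H (Suc m)"
proof -
  let ?\<pi> = "key (insert u U) pref"
  have eq: "?\<pi> v = key U pref v" if "v \<noteq> u" for v using that by (simp add: key_def rk_def)
  have le: "?\<pi> u \<le> key U pref u"
    using key_less[OF u(1) u(1), of U pref "insert u U" pref] by (auto simp: rk_def)
  have i: "?\<pi> w < ?\<pi> v" if "v \<noteq> u" "T v = Some w" for v w
    using heapD[OF T(2) that(2)] eq[OF that(1)] eq[of w] le by (cases "w = u") auto
  have ii: "?\<pi> q < ?\<pi> a" if "T a = Some u" "T u = Some q" for a q
  proof -
    have "a \<noteq> u" "q \<noteq> u" using that STT_not_self[OF T(1)] by auto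
    then show ?thesis using heapD[OF T(2) that(1)] heapD[OF T(2) that(2)] eq by simp
  qed
  obtain r T' where r: "go E r (T, u) (T', u)" "STT T'" "heap T' ?\<pi>"
    "r \<le> card {w\<in>anc T u. w \<noteq> u \<and> ?\<pi> u < ?\<pi> w}" "\<And>y. anc T' y \<subseteq> insert u (anc T y)"
    using raise[OF T(1) u(1) key_inj i ii] by blast
  have "{w\<in>anc T u. w \<noteq> u \<and> ?\<pi> u < ?\<pi> w} \<subseteq> {w\<in>anc T u. head pref w = H}"
  proof
    fix w assume w: "w \<in> {w\<in>anc T u. w \<noteq> u \<and> ?\<pi> u < ?\<pi> w}"
    then have wV: "w \<in> V" using anc_sub[OF T(1) u(1)] by blast
    have uw: "u \<in> desc T w" using w by (simp add: anc_def)
    have "hdep pref w \<le> hdep pref u" using key_le_hdep[OF wV u(1)] heap_desc_le[OF uw T(2)] .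
    moreover have "hdep pref u \<le> hdep pref w" using key_le_hdep[OF u(1) wV, of "insert u U"] w by simp
    moreover have "u \<in> desc P (head pref w)" using anc_path[OF T u(1)] w by blast
    ultimately have "head pref w = H"
      using desc_comparable[OF desc_head[of u pref], of "head pref w"] dep_desc_less u(2)
      by (metis less_irrefl order_antisym)
    then show "w \<in> {w\<in>anc T u. head pref w = H}" using w by simp
  qed
  then have "card {w\<in>anc T u. w \<noteq> u \<and> ?\<pi> u < ?\<pi> w} \<le> card {w\<in>anc T u. head pref w = H}"
    using anc_finite[OF T(1)] by (intro card_mono) auto
  then have rm: "r \<le> m" using r(4) b u(1) unfolding path_bound_def by fastforce
  have b': "path_bound T' pref H (Suc m)" unfolding path_bound_def
  proof
    fix y assume y: "y \<in> V"
    have "card {w\<in>anc T' y. head pref w = H} \<le> card (insert u {w\<in>anc T y. head pref w = H})"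
      using r(5)[of y] anc_finite[OF T(1), of y] by (intro card_mono) auto
    also have "\<dots> \<le> Suc (card {w\<in>anc T y. head pref w = H})"
      using anc_finite[OF T(1), of y] by (simp add: card_insert_if)
    also have "\<dots> \<le> Suc m" using b y by (simp add: path_bound_def)
    finally show "card {w\<in>anc T' y. head pref w = H} \<le> Suc m" .
  qed
  note d = depth_in_path[OF T u b]
  note d' = depth_in_path[OF r(2,3) u b']
  have "go E ((card (anc T u) - card (anc T (top T (desc P H)))) + r +
     (card (anc T' u) - card (anc T' (top T' (desc P H))))) (T, top T (desc P H)) (T', top T' (desc P H))"
    using go_trans[OF go_trans[OF _ r(1)]] walk[OF T(1) d(2)] walk[OF r(2) d'(2)] by blast
  then show ?thesis using r(2,3) b' d(1) d'(1) rm
    by (intro exI[of _ "(card (anc T u) - card (anc T (top T (desc P H)))) + r +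
     (card (anc T' u) - card (anc T' (top T' (desc P H))))"] exI[of _ T']) auto
qed

lemma raise_set:
  assumes T: "STT T" "heap T (key {} pref)" and b: "path_bound T pref H m"
    and F: "finite F" "F \<subseteq> V" "\<And>u. u \<in> F \<Longrightarrow> head pref u = H"
  shows "\<exists>n T'. n \<le> card F * (3 * (m + card F) + 1) \<and> go E n (T, top T (desc P H)) (T', top T' (desc P H)) \<and>
    STT T' \<and> heap T' (key F pref) \<and> path_bound T' pref H (m + card F)"
  using F
proof (induction F rule: finite_induct)
  case empty
  then show ?case using T b go_refl by (intro exI[of _ 0] exI[of _ T]) auto
next
  case (insert u F)
  then obtain n T' where n: "n \<le> card F * (3 * (m + card F) + 1)"
    "go E n (T, top T (desc P H)) (T', top T' (desc P H))"
    "STT T'" "heap T' (key F pref)" "path_bound T' pref H (m + card F)" by auto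
  obtain n2 T2 where n2: "n2 \<le> 3 * (m + card F) + 1"
    "go E n2 (T', top T' (desc P H)) (T2, top T2 (desc P H))"
    "STT T2" "heap T2 (key (insert u F) pref)" "path_bound T2 pref H (Suc (m + card F))"
    using raise_one[OF n(3,4) _ _ n(5), of u] insert.prems by auto
  have "n + n2 \<le> Suc (card F) * (3 * (m + card F) + 1)" using n(1) n2(1) by simp
  also have "\<dots> \<le> Suc (card F) * (3 * (m + Suc (card F)) + 1)" by (intro mult_le_mono2) simp
  finally have "n + n2 \<le> card (insert u F) * (3 * (m + card (insert u F)) + 1)"
    using insert.hyps by simp
  then show ?case using go_trans[OF n(2) n2(2)] n2(3-5) insert.hyps
    by (intro exI[of _ "n + n2"] exI[of _ T2]) simp
qed

text \<open>Four raised vertices; the path bound starts at \<open>2 * k + 3\<close> from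
  \<open>chain_bound\<close> and grows by at most one for each.\<close>

definition raise_cost :: nat where
  "raise_cost = 4 * (3 * (2 * k + 3 + 4) + 1)"

lemma raise_swing:
  assumes T: "STT T" "heap T (key {} pref)"
    and F: "F \<subseteq> V" "card F \<le> 4" "\<And>u. u \<in> F \<Longrightarrow> head pref u = H"
  shows "\<exists>n T'. n \<le> raise_cost \<and> go E n (T, top T (desc P H)) (T', top T' (desc P H)) \<and>
    STT T' \<and> heap T' (key F pref)"
proof -
  have "path_bound T pref H (2 * k + 3)" unfolding path_bound_def using chain_bound[OF T] by blast
  then obtain n T' where n: "n \<le> card F * (3 * (2 * k + 3 + card F) + 1)"
    "go E n (T, top T (desc P H)) (T', top T' (desc P H))" "STT T'" "heap T' (key F pref)"
    using raise_set[OF T _ finite_subset[OF F(1) fin] F(1,3)] by blast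
  have "card F * (3 * (2 * k + 3 + card F) + 1) \<le> raise_cost"
    unfolding raise_cost_def using F(2) by (intro mult_le_mono) auto
  then show ?thesis using n by (intro exI[of _ n] exI[of _ T']) simp
qed

text \<open>The pointer depth acts as a potential, so that climbing is paid for by depth already
  reached. Raising costs one \<open>raise_cost\<close>, the reversed raising three, and the pointer
  may end deeper by as much as these four: eight in all.\<close>

lemma change_one:
  assumes T: "STT T" "heap T (key {} pref)" and c: "P c = Some z" "pref z \<noteq> Some c"
    and x: "x \<in> desc P (head pref z)"
  defines "pref' \<equiv> pref(z := Some c)"
  shows "\<exists>n T' t. go E n (T, x) (T', t) \<and> STT T' \<and> heap T' (key {} pref') \<and>
    t \<in> desc P (head pref' z) \<and> n + card (anc T' t) \<le> card (anc T x) + 8 * raise_cost"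
proof -
  have pref': "pref' = pref(z := Some c)" by (simp add: pref'_def)
  let ?F = "swing pref z c"
  let ?H = "head pref z"
  have zV: "z \<in> V" using STT_V[OF PS c(1)] by simp
  have HV: "?H \<in> V" by (rule head_V[OF zV])
  note F = swing_V[where pref = pref and pref' = pref' and z = z and c = c, OF c pref'] swing_card(2)[where pref = pref and pref' = pref' and z = z and c = c, OF c pref']
  have Fh: "head pref u = ?H" if "u \<in> ?F" for u using that by (simp add: swing_def[where pref = pref and pref' = pref' and z = z and c = c, OF c pref'])
  have Fh': "head pref' u = ?H" if "u \<in> ?F" for u
    using Fh[OF that] swing_notin[where pref = pref and pref' = pref' and z = z and c = c, OF c pref', OF that] head_upd[where pref = pref and pref' = pref' and z = z and c = c, OF c pref', of u] by simp
  have Hz: "head pref' z = ?H" using head_upd[where pref = pref and pref' = pref' and z = z and c = c, OF c pref', of z] z_notin[where pref = pref and pref' = pref' and z = z and c = c, OF c pref'] by simp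
  obtain n1 T1 where n1: "n1 \<le> raise_cost" "go E n1 (T, top T (desc P ?H)) (T1, top T1 (desc P ?H))"
    "STT T1" "heap T1 (key ?F pref)"
    using raise_swing[OF T F Fh] by blast
  have h1: "heap T1 (key ?F pref')" by (rule raised_heap[where pref = pref and pref' = pref' and z = z and c = c, OF c pref' n1(3,4)])
  obtain T' where T': "STT T'" "heap T' (key {} pref')" using inj_tree_exists[OF key_inj] by blast
  obtain n2 T2 where n2: "n2 \<le> raise_cost" "go E n2 (T', top T' (desc P ?H)) (T2, top T2 (desc P ?H))"
    "STT T2" "heap T2 (key ?F pref')"
    using raise_swing[OF T' F Fh'] by blast
  have "T2 = T1" by (rule heap_unique[OF n2(3) n1(3) n2(4) h1])
  then obtain n3 where n3: "n3 \<le> 3 * n2" "go E n3 (T1, top T1 (desc P ?H)) (T', top T' (desc P ?H))"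
    using go_reverse[OF n2(2)] T'(1) by auto
  let ?t = "top T (desc P ?H)" and ?t' = "top T' (desc P ?H)"
  have "x \<in> desc T ?t" using top_path(2)[OF T(1) HV] x by blast
  note w = walk[OF T(1) this]
  have g: "go E (n1 + n3) (T, ?t) (T', ?t')" by (rule go_trans[OF n1(2) n3(2)])
  have "card (anc T' ?t') \<le> card (anc T ?t) + (n1 + n3)" using go_depth[OF g] T(1) by simp
  moreover have "n1 + n3 \<le> 4 * raise_cost" using n1(1) n2(1) n3(1) by simp
  ultimately have "card (anc T x) - card (anc T ?t) + (n1 + n3) + card (anc T' ?t') \<le>
      card (anc T x) + 8 * raise_cost" using w by linarith
  moreover have "go E (card (anc T x) - card (anc T ?t) + (n1 + n3)) (T, x) (T', ?t')"
    using go_trans w g by blast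
  moreover have "?t' \<in> desc P (head pref' z)" using top_path(1)[OF T'(1) HV] Hz by simp
  ultimately show ?thesis using T' by blast
qed

lemma desc_induct_up [consumes 1, case_names refl step]:
  assumes "x \<in> desc p y" "Q x" "\<And>z y. p z = Some y \<Longrightarrow> x \<in> desc p z \<Longrightarrow> Q z \<Longrightarrow> Q y"
  shows "Q y"
proof -
  from assms(1) have "(\<lambda>a b. p a = Some b)\<^sup>*\<^sup>* x y" by (simp add: desc_def)
  then show ?thesis
    by (induction rule: rtranclp_induct) (use assms in \<open>auto simp: desc_def\<close>)
qed

text \<open>Preferred children are corrected one at a time from \<open>x\<close> upwards. In this
  order the pointer climbs from path to path, and by the depth potential the climbing is covered by
  the depth of \<open>x\<close> and the charges per change.\<close>

lemma search_restructure:
  assumes T: "STT T" "heap T (key {} pref)" and x: "x \<in> V"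
  shows "\<exists>n T' t. go E n (T, x) (T', t) \<and> STT T' \<and> heap T' (key {} (upd pref x)) \<and>
    n \<le> card (anc T x) + 8 * raise_cost * card (changes pref x)"
proof -
  \<comment> \<open>The intermediate preferences: already updated at the proper ancestors of
    \<open>x\<close> up to and including \<open>y\<close>, and still old above
    \<open>y\<close>.\<close>
  define pf where "pf y = (\<lambda>v. if x \<in> desc P v \<and> v \<in> desc P y \<and> x \<noteq> v then Some (ch v x) else pref v)" for y
  define cg where "cg y = {v\<in>changes pref x. v \<in> desc P y}" for y
  have cgfin: "finite (cg y)" for y using changes_finite by (simp add: cg_def)
  have main: "\<exists>n T' t. go E n (T, x) (T', t) \<and> STT T' \<and> heap T' (key {} (pf y)) \<and>
      t \<in> desc P (head (pf y) y) \<and> n + card (anc T' t) \<le> card (anc T x) + 8 * raise_cost * card (cg y)"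
    if "x \<in> desc P y" for y
    using that
  proof (induction y rule: desc_induct_up)
    case refl
    have "pf x = pref" unfolding pf_def using STT_antisym[OF PS] by (intro ext) (metis (full_types))
    then show ?case using T go_refl desc_head by (intro exI[of _ 0] exI[of _ T] exI[of _ x]) simp
  next
    case (step z y)
    from step.IH obtain n T' t where n: "go E n (T, x) (T', t)" "STT T'" "heap T' (key {} (pf z))"
      "t \<in> desc P (head (pf z) z)" "n + card (anc T' t) \<le> card (anc T x) + 8 * raise_cost * card (cg z)" by blast
    have yz: "y \<notin> desc P z" using STT_parent_notin[OF PS step(1)] .
    have xy: "x \<in> desc P y" "x \<noteq> y" using step yz desc_parent[of P z y] desc_trans by blast+
    have cz: "ch y x = z" by (rule ch_eq[OF step(1,2)])
    have py: "pf z y = pref y" using yz by (simp add: pf_def)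
    have pf: "pf y = (pf z)(y := Some z)"
    proof
      fix v
      show "pf y v = ((pf z)(y := Some z)) v"
      proof (cases "v = y")
        case True then show ?thesis using xy cz by (simp add: pf_def)
      next
        case False
        have "v \<in> desc P z" if xv: "x \<in> desc P v" "v \<in> desc P y"
        proof -
          obtain c where "P c = Some y" "v \<in> desc P c" using desc_child xv(2) False by metis
          then show ?thesis using child_unique[of c y z x] step(1,2) xv(1) desc_trans by blast
        qed
        then show ?thesis using False desc_child_subset[OF step(1)] by (auto simp: pf_def)
      qed
    qed
    have cgs: "cg z \<subseteq> cg y" using desc_child_subset[OF step(1)] by (auto simp: cg_def)
    show ?case
    proof (cases "pref y = Some z")
      case True
      then have "pf y = pf z" using pf py by (simp add: fun_upd_idem)
      moreover have "head (pf z) z = head (pf z) y" using head_parent[OF step(1), of "pf z"] py True by simp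
      moreover have "8 * raise_cost * card (cg z) \<le> 8 * raise_cost * card (cg y)"
        using cgs cgfin by (intro mult_le_mono2 card_mono)
      then have "n + card (anc T' t) \<le> card (anc T x) + 8 * raise_cost * card (cg y)"
        using n(5) by linarith
      ultimately show ?thesis using n(1-4) by metis
    next
      case False
      then have nz: "pf z y \<noteq> Some z" using py by simp
      have "head (pf z) z = z" by (rule head_self) (use nz step(1) in auto)
      then have "t \<in> desc P (head (pf z) y)"
        using n(4) desc_child_subset[OF step(1)] desc_head[of y "pf z"] desc_trans by auto
      from change_one[OF n(2,3) step(1) nz this]
      obtain n2 T2 t2 where n2: "go E n2 (T', t) (T2, t2)" "STT T2" "heap T2 (key {} (pf y))"
        "t2 \<in> desc P (head (pf y) y)" "n2 + card (anc T2 t2) \<le> card (anc T' t) + 8 * raise_cost"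
        unfolding pf[symmetric] by blast
      have "y \<in> V" using STT_V[OF PS step(1)] by simp
      then have "insert y (cg z) \<subseteq> cg y" using cgs False xy cz by (auto simp: cg_def changes_def)
      then have "card (insert y (cg z)) \<le> card (cg y)" using cgfin card_mono by blast
      moreover have "y \<notin> cg z" using yz by (simp add: cg_def)
      ultimately have "Suc (card (cg z)) \<le> card (cg y)" using cgfin by simp
      then have "8 * raise_cost * Suc (card (cg z)) \<le> 8 * raise_cost * card (cg y)" by (rule mult_le_mono2)
      then have "(n + n2) + card (anc T2 t2) \<le> card (anc T x) + 8 * raise_cost * card (cg y)"
        using n(5) n2(5) by simp
      then show ?thesis using go_trans[OF n(1) n2(1)] n2 by blast
    qed
  qed
  obtain r where r: "r \<in> V" "V \<subseteq> desc P r" using root_exists[OF PS] by blast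
  have eq: "pf r = upd pref x"
  proof
    fix v
    have "v \<in> V" if "x \<in> desc P v" using that anc_sub[OF PS x] by (auto simp: anc_def)
    then show "pf r v = upd pref x v" using r by (auto simp: pf_def upd_def)
  qed
  have le: "8 * raise_cost * card (cg r) \<le> 8 * raise_cost * card (changes pref x)"
    using changes_finite by (intro mult_le_mono2 card_mono) (auto simp: cg_def)
  have "x \<in> desc P r" using r x by blast
  then obtain n T' t where n: "go E n (T, x) (T', t)" "STT T'" "heap T' (key {} (pf r))"
    "n + card (anc T' t) \<le> card (anc T x) + 8 * raise_cost * card (cg r)" using main[of r] by blast
  have "n \<le> card (anc T x) + 8 * raise_cost * card (changes pref x)" using n(4) le by linarith
  with n(1-3) show ?thesis unfolding eq by blast
qed

text \<open>The head of a path met by the search is the root of \<open>P\<close> or a child towards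
  \<open>x\<close> that its parent does not prefer, and such a parent is counted in
  \<open>changes\<close>. This bounds the number of paths, and \<open>chain_bound\<close> the nodes
  on each.\<close>

lemma search_depth:
  assumes T: "STT T" "heap T (key {} pref)" and x: "x \<in> V"
  shows "card (anc T x) \<le> (card (changes pref x) + 1) * (2 * k + 3)"
proof -
  obtain r where r: "r \<in> V" "V \<subseteq> desc P r" using root_exists[OF PS] by blast
  let ?H = "insert r ((\<lambda>v. ch v x) ` changes pref x)"
  have "head pref w \<in> ?H" if w: "w \<in> anc T x" for w
  proof -
    define h where "h = head pref w"
    have h: "x \<in> desc P h" "head pref h = h" using anc_path[OF T x w] by (auto simp: h_def)
    have "h \<in> ?H"
    proof (cases "P h")
      case None
      have "h \<in> V" using h(1) anc_sub[OF PS x] by (auto simp: anc_def)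
      then have "h = r" using root_unique[OF PS r(2)] None by blast
      then show ?thesis by simp
    next
      case (Some v)
      have nv: "v \<notin> desc P h" by (rule STT_parent_notin[OF PS Some])
      have "pref v \<noteq> Some h"
        using head_parent[OF Some, of pref] h(2) desc_head[of v pref] nv by auto
      moreover have "ch v x = h" by (rule ch_eq[OF Some h(1)])
      moreover have "x \<in> desc P v" "x \<noteq> v" "v \<in> V"
        using nv h(1) desc_child_subset[OF Some] STT_V[OF PS Some] by auto
      ultimately have "v \<in> changes pref x" by (simp add: changes_def)
      then show ?thesis using \<open>ch v x = h\<close> by blast
    qed
    then show ?thesis by (simp add: h_def)
  qed
  then have "anc T x \<subseteq> (\<Union>H\<in>?H. {w\<in>anc T x. head pref w = H})" by blast
  then have "card (anc T x) \<le> card (\<Union>H\<in>?H. {w\<in>anc T x. head pref w = H})"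
    using changes_finite anc_finite[OF T(1)] by (intro card_mono) auto
  also have "\<dots> \<le> (\<Sum>H\<in>?H. card {w\<in>anc T x. head pref w = H})"
    using changes_finite by (intro card_UN_le) simp
  also have "\<dots> \<le> (\<Sum>H\<in>?H. 2 * k + 3)" using chain_bound[OF T x] by (intro sum_mono)
  also have "\<dots> = card ?H * (2 * k + 3)" by simp
  also have "card ?H \<le> card (changes pref x) + 1"
    using card_image_le[OF changes_finite, of "\<lambda>v. ch v x" pref x] changes_finite[of pref x]
    by (simp add: card_insert_if)
  finally show ?thesis by simp
qed

text \<open>The depth of \<open>x\<close> is paid twice, for walking down and as the initial
  potential of the restructuring; the final 1 is the charge for touching the root.\<close>

definition search_cost :: nat where
  "search_cost = 2 * (2 * k + 3) + 8 * raise_cost + 1"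

lemma search:
  assumes T: "STT T" "heap T (key {} pref)" and x: "x \<in> V"
  shows "\<exists>os ss. gst_trace E (T, st_root V T) os = Some ss \<and> x \<in> snd ` set ss \<and> STT (fst (last ss)) \<and>
    heap (fst (last ss)) (key {} (upd pref x)) \<and>
    Suc (length os) \<le> (card (changes pref x) + 1) * search_cost"
proof -
  let ?r = "st_root V T" and ?s = "card (changes pref x)"
  have "x \<in> desc T ?r" using st_root(3)[OF T(1)] x by blast
  then have 1: "go E (card (anc T x) - card (anc T ?r)) (T, ?r) (T, x)" using walk[OF T(1)] by blast
  obtain n T' t where n: "go E n (T, x) (T', t)" "STT T'" "heap T' (key {} (upd pref x))"
    "n \<le> card (anc T x) + 8 * raise_cost * ?s" using search_restructure[OF T x] by blast
  obtain os ss where os: "length os = n" "gst_trace E (T, x) os = Some ss" "last ss = (T', t)"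
    using go_trace[OF n(1), of "[]"] by auto
  obtain os' ss' where os': "length os' = card (anc T x) - card (anc T ?r) + length os"
    "gst_trace E (T, ?r) os' = Some ss'" "set ss \<subseteq> set ss'" "last ss' = last ss"
    using go_trace[OF 1 os(2)] by blast
  have "x \<in> snd ` set ss'" using trace_start[OF os(2)] os'(3) by force
  moreover have "Suc (length os') \<le> (?s + 1) * search_cost"
  proof -
    have "Suc (length os') \<le> 2 * card (anc T x) + 8 * raise_cost * ?s + 1" using os' os n(4) by simp
    also have "\<dots> \<le> 2 * ((?s + 1) * (2 * k + 3)) + 8 * raise_cost * ?s + 1"
      using search_depth[OF T x] by simp
    also have "\<dots> \<le> (?s + 1) * search_cost" by (simp add: search_cost_def algebra_simps)
    finally show ?thesis .
  qed
  ultimately show ?thesis using os' os n by (intro exI[of _ os'] exI[of _ ss']) simp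
qed

end

section \<open>The online algorithm\<close>

context leveled
begin

text \<open>The strategy recomputes the current tree and preferences by folding over the history, so
  it depends on past searches and the current one only. Initially every preferred path is a single
  vertex and keys are ordered by \<open>dep\<close>, so \<open>P\<close> itself is the canonical
  tree.\<close>

lemma online_algorithm:
  "\<exists>strat. \<forall>X. set X \<subseteq> V \<longrightarrow>
     serves V E P X (map (\<lambda>i. strat (take i X) (X ! i)) [0..<length X]) \<and>
     gst_cost (map (\<lambda>i. strat (take i X) (X ! i)) [0..<length X])
       \<le> (length X + total_changes (\<lambda>_. None) X) * search_cost"
proof -
  define good where "good T pref x os \<longleftrightarrow> (\<exists>ss. gst_trace E (T, st_root V T) os = Some ss \<and>
    x \<in> snd ` set ss \<and> STT (fst (last ss)) \<and> heap (fst (last ss)) (key {} (upd pref x)) \<and>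
    Suc (length os) \<le> (card (changes pref x) + 1) * search_cost)" for T pref x os
  define f where "f T pref x = (SOME os. good T pref x os)" for T pref x
  have f: "good T pref x (f T pref x)" if "STT T" "heap T (key {} pref)" "x \<in> V" for T pref x
    unfolding f_def by (rule someI_ex) (use search[OF that] in \<open>simp add: good_def\<close>)
  define nxt where "nxt s x = (case s of (T, pref) \<Rightarrow>
    (fst (last (the (gst_trace E (T, st_root V T) (f T pref x)))), upd pref x))" for s x
  define st where "st h = foldl nxt (P, \<lambda>_. None) h" for h
  define strat where "strat h x = f (fst (st h)) (snd (st h)) x" for h x
  have main: "serves V E T X (map (\<lambda>i. strat (h @ take i X) (X ! i)) [0..<length X]) \<and>
      gst_cost (map (\<lambda>i. strat (h @ take i X) (X ! i)) [0..<length X])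
        \<le> (length X + total_changes pref X) * search_cost"
    if "st h = (T, pref)" "STT T" "heap T (key {} pref)" "set X \<subseteq> V" for h T pref X
    using that
  proof (induction X arbitrary: h T pref)
    case Nil
    then show ?case by (simp add: gst_cost_def)
  next
    case (Cons x xs)
    have x: "x \<in> V" using Cons.prems by simp
    obtain ss where ss: "gst_trace E (T, st_root V T) (f T pref x) = Some ss" "x \<in> snd ` set ss"
      "STT (fst (last ss))" "heap (fst (last ss)) (key {} (upd pref x))"
      "Suc (length (f T pref x)) \<le> (card (changes pref x) + 1) * search_cost"
      using f[OF Cons.prems(2,3) x] unfolding good_def by blast
    have st': "st (h @ [x]) = (fst (last ss), upd pref x)"
      using Cons.prems(1) ss(1) by (simp add: st_def nxt_def)
    have hd: "strat h x = f T pref x" using Cons.prems(1) by (simp add: strat_def)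
    have m: "map (\<lambda>i. strat (h @ take i (x # xs)) ((x # xs) ! i)) [0..<length (x # xs)] =
      f T pref x # map (\<lambda>i. strat ((h @ [x]) @ take i xs) (xs ! i)) [0..<length xs]"
      by (simp add: hd map_upt_Suc del: upt_Suc)
    note IH = Cons.IH[OF st' ss(3,4)]
    have "gst_cost (map (\<lambda>i. strat (h @ take i (x # xs)) ((x # xs) ! i)) [0..<length (x # xs)]) \<le>
      (card (changes pref x) + 1) * search_cost + (length xs + total_changes (upd pref x) xs) * search_cost"
      unfolding m using IH ss(5) Cons.prems(4) by (simp add: gst_cost_def)
    also have "\<dots> = (length (x # xs) + total_changes pref (x # xs)) * search_cost"
      by (simp add: algebra_simps)
    finally show ?case unfolding m using IH ss(1,2) Cons.prems(4) by simp
  qed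
  have P0: "heap P (key {} (\<lambda>_. None))" unfolding heap_def
  proof (intro allI impI)
    fix v u assume vu: "P v = Some u"
    have "head (\<lambda>_. None) w = w" for w by (rule head_self) simp
    then show "key {} (\<lambda>_. None) u < key {} (\<lambda>_. None) v"
      using key_less[of u v] STT_V[OF PS vu] dep_Suc[OF vu] by simp
  qed
  show ?thesis using main[of "[]" P "\<lambda>_. None"] PS P0 by (intro exI[of _ strat]) (simp add: st_def)
qed

lemma competitive:
  assumes "set X \<subseteq> V" "card V \<le> length X" "serves V E P X oss"
    "gst_cost oss \<le> (length X + total_changes (\<lambda>_. None) X) * search_cost"
  shows "gst_cost oss \<le> 5 * search_cost * OPT V E X"
proof -
  have "total_changes (\<lambda>_. None) X \<le> 3 * OPT V E X + card V" "length X \<le> OPT V E X"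
    using OPT_lower_bound[OF STT_imp_valid[OF PS] assms(3,1)] by auto
  \<comment> \<open>One \<open>OPT\<close> for the length, three from the lower bound, and one for
    \<open>card V \<le> length X\<close>.\<close>
  then have "length X + total_changes (\<lambda>_. None) X \<le> 5 * OPT V E X" using assms(2) by linarith
  then have "(length X + total_changes (\<lambda>_. None) X) * search_cost \<le> 5 * OPT V E X * search_cost"
    by (rule mult_le_mono1)
  with assms(4) have "gst_cost oss \<le> 5 * OPT V E X * search_cost" by (rule le_trans)
  then show ?thesis by (simp add: ac_simps)
qed

end

section \<open>Choosing the parameters for a given tree\<close>

lemma power_of_two_between:
  fixes n :: nat
  shows "0 < n \<Longrightarrow> \<exists>j::nat. n < 2 ^ j \<and> 2 ^ j \<le> 2 * n"
proof (induction n)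
  case (Suc n)
  show ?case
  proof (cases n)
    case 0
    then show ?thesis by (intro exI[of _ 1]) simp
  next
    case (Suc m)
    then obtain j :: nat where j: "n < 2 ^ j" "2 ^ j \<le> 2 * n" using Suc.IH by auto
    show ?thesis
    proof (cases "Suc n < 2 ^ j")
      case True then show ?thesis using j by (intro exI[of _ j]) simp
    next
      case False then show ?thesis using j by (intro exI[of _ "Suc j"]) simp
    qed
  qed
qed simp

lemma level_bound:
  assumes "0 < n" "2 ^ j \<le> 2 * n" "2 ^ k \<le> 4 * j" "0 < j"
  shows "real k \<le> 3 * (1 + log 2 (log 2 (real n)))" "0 \<le> log 2 (log 2 (real n))"
proof -
  have k: "real k \<le> 2 + log 2 (real j)"
  proof -
    have "(2::real) ^ k \<le> 4 * real j" using assms(3) by (metis of_nat_le_iff of_nat_mult of_nat_numeral of_nat_power)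
    then have "log 2 (2 ^ k) \<le> log 2 (4 * real j)" by (intro log_mono) auto
    also have "\<dots> = 2 + log 2 (real j)"
      using assms(4) log_mult[of 2 4 "real j"] log_pow_cancel[of 2 2] by simp
    finally show ?thesis by (simp add: log_pow_cancel)
  qed
  have j: "real j \<le> 1 + log 2 (real n)"
  proof -
    have "(2::real) ^ j \<le> 2 * real n" using assms(2) by (metis of_nat_le_iff of_nat_mult of_nat_numeral of_nat_power)
    then have "log 2 (2 ^ j) \<le> log 2 (2 * real n)" by (intro log_mono) auto
    also have "\<dots> = 1 + log 2 (real n)" using assms(1) by (simp add: log_mult)
    finally show ?thesis by (simp add: log_pow_cancel)
  qed
  show "real k \<le> 3 * (1 + log 2 (log 2 (real n)))" and "0 \<le> log 2 (log 2 (real n))"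
  proof -
    show "real k \<le> 3 * (1 + log 2 (log 2 (real n)))"
    \<comment> \<open>For \<open>n = 1\<close> the inner logarithm is 0 and \<open>log 2 0\<close>
      evaluates to 0; then \<open>j = 1\<close>, and \<open>k\<close> is at most 2.\<close>
    proof (cases "n = 1")
      case True
      then have "j = 1" using j assms(4) by simp
      then show ?thesis using k True by (simp add: log_def)
    next
      case False
      then have n1: "1 \<le> log 2 (real n)" using assms(1) by (simp add: le_log_iff)
      then have "real j \<le> 2 * log 2 (real n)" using j by linarith
      then have "log 2 (real j) \<le> log 2 (2 * log 2 (real n))" using assms(4) by (intro log_mono) auto
      also have "\<dots> = 1 + log 2 (log 2 (real n))" using n1 by (simp add: log_mult)
      finally have "real k \<le> 3 + log 2 (log 2 (real n))" using k by simp
      moreover have "0 \<le> log 2 (log 2 (real n))" using n1 by simp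
      ultimately show ?thesis by simp
    qed
    show "0 \<le> log 2 (log 2 (real n))"
    proof (cases "n = 1")
      case False
      then have "1 \<le> log 2 (real n)" using assms(1) by (simp add: le_log_iff)
      then show ?thesis by simp
    qed (simp add: log_def)
  qed
qed

lemma tree_algorithm:
  assumes T: "is_tree V E"
  shows "\<exists>P strat. \<forall>X. set X \<subseteq> V \<and> card V \<le> length X \<longrightarrow>
    valid_st V E P \<and> serves V E P X (map (\<lambda>i. strat (take i X) (X ! i)) [0..<length X]) \<and>
    real (gst_cost (map (\<lambda>i. strat (take i X) (X ! i)) [0..<length X]))
      \<le> 6500 * (1 + log 2 (log 2 (real (card V)))) * real (OPT V E X)"
proof -
  interpret cgraph V E using is_tree_cgraph[OF T] .
  obtain g where g: "STT g" "\<And>a b. E a b \<Longrightarrow> g a = Some b \<or> g b = Some a" "\<And>a b. g a = Some b \<Longrightarrow> E a b"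
    using is_tree_parent[OF T] by blast
  interpret tgraph V E g by unfold_locales (use g in auto)
  have n: "0 < card V" using ne fin by (simp add: card_gt_0_iff)
  obtain j :: nat where j: "card V < 2 ^ j" "2 ^ j \<le> 2 * card V" using power_of_two_between[OF n] by blast
  have j0: "0 < j" using j(1) n by (cases j) auto
  \<comment> \<open>Depths are below \<open>2 * j\<close>, so they fit the ruler of length
    \<open>2 ^ k\<close>.\<close>
  obtain k :: nat where k: "2 * j < 2 ^ k" "2 ^ k \<le> 4 * j" using power_of_two_between[of "2 * j"] j0 by auto
  obtain P dep where P: "STT P" "\<And>v u. P v = Some u \<Longrightarrow> dep v = Suc (dep u)"
    "\<And>v. v \<in> V \<Longrightarrow> dep v < 2 * j" "\<And>v. v \<in> V \<Longrightarrow> card (bd E (desc P v)) \<le> 2"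
    using reference_tree_exists[OF j(1)] by metis
  obtain lev :: "nat \<Rightarrow> nat" where lev: "\<And>m. m < 2 ^ k \<Longrightarrow> lev m \<le> k"
    "\<And>m m'. m < m' \<Longrightarrow> m' < 2 ^ k \<Longrightarrow> lev m = lev m' \<Longrightarrow> \<exists>i. m < i \<and> i < m' \<and> lev i < lev m"
    using ruler_exists[of k] by blast
  interpret leveled V E P dep k lev
    by unfold_locales (use P k(1) lev in \<open>auto intro: less_trans\<close>)
  obtain strat where strat: "\<And>X. set X \<subseteq> V \<Longrightarrow>
     serves V E P X (map (\<lambda>i. strat (take i X) (X ! i)) [0..<length X]) \<and>
     gst_cost (map (\<lambda>i. strat (take i X) (X ! i)) [0..<length X])
       \<le> (length X + total_changes (\<lambda>_. None) X) * search_cost"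
    using online_algorithm by blast
  let ?L = "log 2 (log 2 (real (card V)))"
  \<comment> \<open>\<open>search_cost\<close> is \<open>196 * k + 711\<close> and \<open>k\<close>
    is at most \<open>3 * (1 + ?L)\<close>, so the left side is at most
    \<open>2940 * (1 + ?L) + 3555\<close>; here \<open>?L\<close> is nonnegative.\<close>
  have sc: "5 * real search_cost \<le> 6500 * (1 + ?L)"
    using level_bound[OF n j(2) k(2) j0] by (simp add: search_cost_def raise_cost_def)
  have "real (gst_cost oss) \<le> 6500 * (1 + ?L) * real (OPT V E X)"
    if "set X \<subseteq> V" "card V \<le> length X" "serves V E P X oss"
    "gst_cost oss \<le> (length X + total_changes (\<lambda>_. None) X) * search_cost" for X oss
  proof -
    have "real (gst_cost oss) \<le> real (5 * search_cost * OPT V E X)"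
      using competitive[OF that] of_nat_le_iff by blast
    also have "\<dots> = 5 * real search_cost * real (OPT V E X)" by simp
    also have "\<dots> \<le> 6500 * (1 + ?L) * real (OPT V E X)" using sc by (rule mult_right_mono) simp
    finally show ?thesis .
  qed
  then show ?thesis using strat STT_imp_valid[OF P(1)] by blast
qed

theorem theorem4:
  shows "\<exists>(C::real) init strat. \<forall>V E X.
     is_tree V E \<and> set X \<subseteq> V \<and> length X \<ge> card V \<longrightarrow>
       valid_st V E (init V E) \<and>
       serves V E (init V E) X (online_ops strat V E X) \<and>
       real (gst_cost (online_ops strat V E X))
         \<le> C * (1 + log 2 (log 2 (real (card V)))) * real (OPT V E X)"
proof -
  define Q where "Q V E a \<longleftrightarrow> (\<forall>X. set X \<subseteq> V \<and> card V \<le> length X \<longrightarrow>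
    valid_st V E (fst a) \<and> serves V E (fst a) X (map (\<lambda>i. snd a (take i X) (X ! i)) [0..<length X]) \<and>
    real (gst_cost (map (\<lambda>i. snd a (take i X) (X ! i)) [0..<length X]))
      \<le> 6500 * (1 + log 2 (log 2 (real (card V)))) * real (OPT V E X))"
    for V E and a :: "(nat \<Rightarrow> nat option) \<times> (nat list \<Rightarrow> nat \<Rightarrow> gst_op list)"
  \<comment> \<open>Tree and strategy are chosen together, once per graph and before any search
    sequence is given.\<close>
  define A where "A V E = (SOME a. Q V E a)" for V E
  have A: "Q V E (A V E)" if tree: "is_tree V E" for V E
  proof -
    obtain P strat where "Q V E (P, strat)" using tree_algorithm[OF tree] unfolding Q_def by auto
    then show ?thesis unfolding A_def by (rule someI)
  qed
  show ?thesis
  proof (intro exI[of _ 6500] exI[of _ "\<lambda>V E. fst (A V E)"] exI[of _ "\<lambda>V E. snd (A V E)"] allI impI)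
    fix V E X assume "is_tree V E \<and> set X \<subseteq> V \<and> card V \<le> length X"
    then show "valid_st V E (fst (A V E)) \<and>
       serves V E (fst (A V E)) X (online_ops (\<lambda>V E. snd (A V E)) V E X) \<and>
       real (gst_cost (online_ops (\<lambda>V E. snd (A V E)) V E X))
         \<le> 6500 * (1 + log 2 (log 2 (real (card V)))) * real (OPT V E X)"
      using A[of V E] unfolding Q_def online_ops_def by blast
  qed
qed

end
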